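(* In a graph where the agents' prior on $n$ is the geometric prior on the integers of an interval $[\alpha,\beta]$, an equilibrium for Leader Election exists if and only if $\beta=\alpha$.
   Context: **Network and agents.** The network is a bidirectional, 2-vertex-connected graph $G=(V,E)$ with $n$ nodes ($n$ always denotes the actual number of nodes). Each node is an agent with unlimited computational power. Agents communicate over edges in synchronous rounds and all start at round $0$. Initially each agent knows its own id and private input (including its preference), but not those of other agents. Private information comes from a finite set, and each agent's prior over the private information of the others is uniform. The agents do not know $n$ but know its prior $\sigma$. *Geometric prior on $[\alpha,\beta]$*: $\Pr[n=t]=2^{\alpha-t-1}+c$ for integers $\alpha\le t\le\beta$, where $c=\frac{2^{\alpha-\beta-1}}{\beta-\alpha+1}$. **Outputs and utilities.** Agent $a$ outputs $o_a$ ($\bot$ means it aborts). Output vectors are $O=(o_1,\dots,o_n)\in\Theta=\Theta_L\sqcup\Theta_E$, where $\Theta_L$ is the set of legal and $\Theta_E$ the set of erroneous output vectors. Each agent $a$ has a single preferred output value $p_a$ and utility $u_a(O)=1$ if $o_a=p_a$ and $O\in\Theta_L$, and $u_a(O)=0$ otherwise. An agent that detects that another agent deviated outputs $\bot$, which makes the output erroneous. **Equilibrium.** For a step $s$ (the entire operation of an agent in one round) of agent $a$ at round $r$ of an execution, $\mathbb{E}_{s,r}[u_a]=\sum_{O\in\Theta}x_O(s,r)u_a(O)$, where $x_O(s,r)$ is the probability, estimated by $a$ at round $r$, that $O$ is output if $a$ takes step $s$ and all other agents follow the algorithm. An algorithm $\Lambda$ whose next step at round $r$ is $s(r)$ is a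 (distributed) equilibrium if for every agent $a$, every round $r$ of every possible execution in which all steps up to round $r$ were according to $\Lambda$, and every deviating step $\bar s$: $\mathbb{E}_{s(r),r}[u_a]\ge \mathbb{E}_{\bar s,r}[u_a]$. Only a single agent deviates (no coalitions). **Duplication (Sybil attack).** A deviating agent may pretend to be $d$ agents, by simulating $d$ imaginary agents with fake ids and distributing its edges among them. The other agents then execute the algorithm as if on the enlarged graph, of size $n'=n+d-1$. Fake id collisions are disregarded. The cheater still produces a single output, and legality is judged on the output vector of the $n$ real agents. The number $d$ is decided at round $0$. If $n'=d+n-1>\beta$, the duplication is detected and the output is erroneous. **Leader Election.** Each agent outputs $o_a\in\{0,1\}$, where $o_a=1$ means that $a$ was elected leader. $\Theta_L=\{O : \exists a:\ o_a=1,\ \forall b\ne a:\ o_b=0\}$. An agent prefers either $0$ or $1$. It is a known requirement that for a Leader Election algorithm to be an equilibrium it must be *fair*, i.e. every agent has equal probability of being elected leader. *)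

theory Defs
  imports "HOL-Probability.Probability"
begin

subsection \<open>Networks\<close>

text \<open>
  A network with \<open>n\<close> agents is a list of \<open>n\<close> adjacency lists.  Agents are named \<open>0, \<dots>, n - 1\<close>;
  the names are not visible to the agents.  Entry \<open>p\<close> of the list of agent \<open>v\<close> is the neighbour
  that \<open>v\<close> reaches through its port \<open>p\<close>.
\<close>

type_synonym network = "nat list list"

definition bidirectional :: "network \<Rightarrow> bool" where
  "bidirectional G \<longleftrightarrow>
     (\<forall>v < length G. distinct (G ! v) \<and> set (G ! v) \<subseteq> {..<length G} - {v}) \<and>
     (\<forall>u < length G. \<forall>v < length G. u \<in> set (G ! v) \<longleftrightarrow> v \<in> set (G ! u))"

definition connected_on :: "network \<Rightarrow> nat set \<Rightarrow> bool" where
  "connected_on G S \<longleftrightarrow>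
     (\<forall>u\<in>S. \<forall>v\<in>S. (u, v) \<in> {(x, y). x \<in> S \<and> y \<in> S \<and> y \<in> set (G ! x)}\<^sup>*)"

definition two_vertex_connected :: "network \<Rightarrow> bool" where
  "two_vertex_connected G \<longleftrightarrow>
     bidirectional G \<and> 3 \<le> length G \<and> connected_on G {..<length G} \<and>
     (\<forall>x < length G. connected_on G ({..<length G} - {x}))"

definition port :: "network \<Rightarrow> nat \<Rightarrow> nat \<Rightarrow> nat" where
  "port G v u = (LEAST p. p < length (G ! v) \<and> G ! v ! p = u)"


subsection \<open>Outputs and utilities\<close>

datatype outval = Abort | Zero | One

text \<open>An output vector maps each agent to its output; \<^term>\<open>None\<close> means that the agent has not
  (yet) produced one.\<close>

type_synonym output_vector = "nat \<Rightarrow> outval option"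

definition legal :: "nat \<Rightarrow> output_vector \<Rightarrow> bool" where
  "legal n os \<longleftrightarrow> (\<exists>a<n. os a = Some One \<and> (\<forall>b<n. b \<noteq> a \<longrightarrow> os b = Some Zero))"

definition elected :: "nat \<Rightarrow> nat \<Rightarrow> output_vector \<Rightarrow> bool" where
  "elected n a os \<longleftrightarrow> legal n os \<and> os a = Some One"

definition utility :: "nat \<Rightarrow> nat \<Rightarrow> outval \<Rightarrow> output_vector \<Rightarrow> real" where
  "utility n a p os = (if legal n os \<and> os a = Some p then 1 else 0)"


subsection \<open>Synchronous executions\<close>

text \<open>
  A message is a finite sequence of numbers, the empty sequence being silence.  A step is the whole
  operation of an agent in one round: the messages it sends on its ports (silence on the ports
  beyond the end of the list) and possibly an output.  Only the first output of an agent counts.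
\<close>

type_synonym msg = "nat list"

record step =
  sent :: "msg list"
  decision :: "outval option"

definition idle :: step where
  "idle = \<lparr>sent = [], decision = None\<rparr>"

text \<open>
  All that an agent has observed: its id, its preference, its number of ports and, for each past
  round, its own step and the messages received on its ports.
\<close>

record view =
  my_id :: nat
  my_pref :: outval
  my_degree :: nat
  my_history :: "(step \<times> msg list) list"

text \<open>
  An algorithm gives the (randomised) next step as a function of the view.  Views record all past
  steps of the agent, so this covers algorithms with private random memory.
\<close>

type_synonym algorithm = "view \<Rightarrow> step pmf"

record config =
  net :: network
  ident :: "nat \<Rightarrow> nat"
  pref :: "nat \<Rightarrow> outval"
  hist :: "nat \<Rightarrow> (step \<times> msg list) list"
  out :: output_vector

definition init_config :: "network \<Rightarrow> (nat \<Rightarrow> nat) \<Rightarrow> (nat \<Rightarrow> outval) \<Rightarrow> config" where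
  "init_config G ids prefs =
     \<lparr>net = G, ident = ids, pref = prefs, hist = (\<lambda>_. []), out = (\<lambda>_. None)\<rparr>"

definition local_view :: "config \<Rightarrow> nat \<Rightarrow> view" where
  "local_view c v =
     \<lparr>my_id = ident c v, my_pref = pref c v, my_degree = length (net c ! v), my_history = hist c v\<rparr>"

definition received :: "network \<Rightarrow> (nat \<Rightarrow> step) \<Rightarrow> nat \<Rightarrow> msg list" where
  "received G s v =
     map (\<lambda>u. let ms = sent (s u); p = port G u v in if p < length ms then ms ! p else []) (G ! v)"

text \<open>
  One round in which agent \<open>v\<close> takes step \<open>s v\<close> and outputs \<open>ds v\<close>.  These outputs are passed
  separately because the output of a cheater is not that of the agents it simulates.
\<close>

definition advance :: "config \<Rightarrow> (nat \<Rightarrow> step) \<Rightarrow> output_vector \<Rightarrow> config" where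
  "advance c s ds = c\<lparr>
     hist := (\<lambda>v. if v < length (net c) then hist c v @ [(s v, received (net c) s v)] else []),
     out := (\<lambda>v. case out c v of None \<Rightarrow> ds v | Some x \<Rightarrow> Some x)\<rparr>"

definition honest_round :: "algorithm \<Rightarrow> config \<Rightarrow> config pmf" where
  "honest_round \<Lambda> c =
     map_pmf (\<lambda>s. advance c s (\<lambda>v. decision (s v)))
       (Pi_pmf {..<length (net c)} idle (\<lambda>v. \<Lambda> (local_view c v)))"

primrec honest_run :: "algorithm \<Rightarrow> config \<Rightarrow> nat \<Rightarrow> config pmf" where
  "honest_run \<Lambda> c 0 = return_pmf c"
| "honest_run \<Lambda> c (Suc k) = bind_pmf (honest_run \<Lambda> c k) (honest_round \<Lambda>)"


subsection \<open>Cheating\<close>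

text \<open>
  The cheater is agent \<open>v\<close>; it controls the agents in the list \<open>C\<close>, all others follow the algorithm.
  From the views of all agents in \<open>C\<close> it chooses their steps jointly, and separately
  its own single output.
\<close>

type_synonym strategy = "view list \<Rightarrow> (step list \<times> outval option) pmf"

definition cheat_round ::
    "algorithm \<Rightarrow> nat \<Rightarrow> nat list \<Rightarrow> strategy \<Rightarrow> config \<Rightarrow> config pmf" where
  "cheat_round \<Lambda> v C \<tau> c =
     bind_pmf (Pi_pmf ({..<length (net c)} - set C) idle (\<lambda>u. \<Lambda> (local_view c u))) (\<lambda>h.
     map_pmf (\<lambda>(xs, ov).
         let s = (\<lambda>u. case map_of (zip C xs) u of Some x \<Rightarrow> x | None \<Rightarrow> h u)
         in advance c s ((\<lambda>u. decision (s u))(v := ov)))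
       (\<tau> (map (local_view c) C)))"

primrec cheat_run ::
    "algorithm \<Rightarrow> nat \<Rightarrow> nat list \<Rightarrow> strategy \<Rightarrow> config \<Rightarrow> nat \<Rightarrow> config pmf" where
  "cheat_run \<Lambda> v C \<tau> c 0 = return_pmf c"
| "cheat_run \<Lambda> v C \<tau> c (Suc k) = bind_pmf (cheat_run \<Lambda> v C \<tau> c k) (cheat_round \<Lambda> v C \<tau>)"

text \<open>
  Expected utility of agent \<open>v\<close> when the execution continues forever from configuration \<open>c\<close>.
  Outputs are irrevocable, so the sequences below are monotone.  In the second definition \<open>n\<close> is the
  number of real agents, which are \<open>0, \<dots>, n - 1\<close>; only their outputs matter for legality.
\<close>

definition honest_value :: "algorithm \<Rightarrow> nat \<Rightarrow> config \<Rightarrow> real" where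
  "honest_value \<Lambda> v c =
     lim (\<lambda>k. measure_pmf.expectation (honest_run \<Lambda> c k)
                (\<lambda>c'. utility (length (net c)) v (pref c v) (out c')))"

definition cheat_value ::
    "algorithm \<Rightarrow> nat \<Rightarrow> nat \<Rightarrow> nat list \<Rightarrow> strategy \<Rightarrow> config \<Rightarrow> real" where
  "cheat_value \<Lambda> n v C \<tau> c =
     lim (\<lambda>k. measure_pmf.expectation (cheat_run \<Lambda> v C \<tau> c k)
                (\<lambda>c'. utility n v (pref c v) (out c')))"


subsection \<open>Duplication\<close>

text \<open>
  A duplication of an agent with \<open>k\<close> ports into \<open>d\<close> agents is a list of \<open>d\<close> adjacency lists:
  \<open>Outer p\<close> is the edge at the real port \<open>p\<close>, and \<open>Inner j\<close> is an edge to the \<open>j\<close>-th simulated agent.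
\<close>

datatype slot = Outer nat | Inner nat

type_synonym duplication = "slot list list"

definition valid_duplication :: "nat \<Rightarrow> duplication \<Rightarrow> bool" where
  "valid_duplication k S \<longleftrightarrow>
     (\<forall>j < length S. distinct (S ! j)) \<and>
     (\<forall>p < k. \<exists>!j. j < length S \<and> Outer p \<in> set (S ! j)) \<and>
     (\<forall>j < length S. \<forall>p. Outer p \<in> set (S ! j) \<longrightarrow> p < k) \<and>
     (\<forall>j < length S. \<forall>i. Inner i \<in> set (S ! j) \<longrightarrow>
        i < length S \<and> i \<noteq> j \<and> Inner j \<in> set (S ! i))"

definition owner :: "duplication \<Rightarrow> nat \<Rightarrow> nat" where
  "owner S p = (THE j. j < length S \<and> Outer p \<in> set (S ! j))"

text \<open>In the enlarged network simulated agent \<open>0\<close> takes the name \<open>v\<close> of the cheater; the others take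
  the new names \<open>n, \<dots>, n + d - 2\<close>.\<close>

definition sim_name :: "nat \<Rightarrow> nat \<Rightarrow> nat \<Rightarrow> nat" where
  "sim_name n v j = (if j = 0 then v else n + j - 1)"

definition enlarge :: "network \<Rightarrow> nat \<Rightarrow> duplication \<Rightarrow> network" where
  "enlarge G v S =
     (let n = length G;
          nbrs = (\<lambda>j. map (\<lambda>e. case e of Outer p \<Rightarrow> G ! v ! p | Inner i \<Rightarrow> sim_name n v i) (S ! j))
      in map (\<lambda>u. if u = v then nbrs 0
                  else map (\<lambda>w. if w = v then sim_name n v (owner S (port G v u)) else w) (G ! u))
           [0..<n]
         @ map nbrs [1..<length S])"

definition injections :: "nat set \<Rightarrow> nat set \<Rightarrow> (nat \<Rightarrow> nat) set" where
  "injections A B = {f \<in> A \<rightarrow>\<^sub>E B. inj_on f A}"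

text \<open>
  Disregarding id collisions: simulated agent \<open>0\<close> has the id of the cheater, and the others
  receive fresh distinct ids.  Ids and preferences of simulated agents reach the other agents only
  through messages, so the cheater is free to claim different ones.
\<close>

definition duplicate :: "nat set \<Rightarrow> nat \<Rightarrow> duplication \<Rightarrow> config \<Rightarrow> config pmf" where
  "duplicate I v S c =
     (let n = length (net c); F = {n..<n + length S - 1}
      in map_pmf (\<lambda>f. c\<lparr>net := enlarge (net c) v S,
                         ident := (\<lambda>u. if u < n then ident c u else f u),
                         pref := (\<lambda>u. if u < n then pref c u else pref c v)\<rparr>)
           (pmf_of_set (injections F (I - ident c ` {..<n}))))"

definition duplication_value ::
    "nat set \<Rightarrow> nat \<Rightarrow> algorithm \<Rightarrow> nat \<Rightarrow> duplication \<Rightarrow> strategy \<Rightarrow> config \<Rightarrow> real" where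
  "duplication_value I \<beta> \<Lambda> v S \<tau> c =
     (let n = length (net c); d = length S
      in if n + d - 1 > \<beta> then 0
         else measure_pmf.expectation (duplicate I v S c)
                (cheat_value \<Lambda> n v (v # [n..<n + d - 1]) \<tau>))"


subsection \<open>Beliefs\<close>

definition geometric :: "nat \<Rightarrow> nat \<Rightarrow> nat \<Rightarrow> real" where
  "geometric \<alpha> \<beta> t =
     (if \<alpha> \<le> t \<and> t \<le> \<beta>
      then 2 powi (int \<alpha> - int t - 1) + 2 powi (int \<alpha> - int \<beta> - 1) / (real \<beta> - real \<alpha> + 1)
      else 0)"

text \<open>
  An agent's prior is about the network and its own position in it.  The prior on the number of agents
  is geometric; beyond that, topology and position may be distributed arbitrarily.
\<close>

definition geometric_prior :: "nat \<Rightarrow> nat \<Rightarrow> (network \<times> nat) pmf \<Rightarrow> bool" where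
  "geometric_prior \<alpha> \<beta> \<mu> \<longleftrightarrow>
     (\<forall>(G, v) \<in> set_pmf \<mu>. two_vertex_connected G \<and> v < length G) \<and>
     (\<forall>t. pmf (map_pmf (\<lambda>(G, v). length G) \<mu>) t = geometric \<alpha> \<beta> t)"

definition prior_start :: "nat set \<Rightarrow> (network \<times> nat) pmf \<Rightarrow> (nat \<times> config) pmf" where
  "prior_start I \<mu> =
     bind_pmf \<mu> (\<lambda>(G, v).
     bind_pmf (pmf_of_set (injections {..<length G} I)) (\<lambda>ids.
     bind_pmf (pmf_of_set ({..<length G} \<rightarrow>\<^sub>E {Zero, One})) (\<lambda>prefs.
     return_pmf (v, init_config G ids prefs))))"

text \<open>The agent's own position paired with the configuration at the beginning of round \<open>r\<close>, when all
  previous steps were according to the algorithm.\<close>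

definition executions ::
    "nat set \<Rightarrow> (network \<times> nat) pmf \<Rightarrow> algorithm \<Rightarrow> nat \<Rightarrow> (nat \<times> config) pmf" where
  "executions I \<mu> \<Lambda> r =
     bind_pmf (prior_start I \<mu>) (\<lambda>(v, c). map_pmf (Pair v) (honest_run \<Lambda> c r))"

definition consistent :: "view \<Rightarrow> (nat \<times> config) set" where
  "consistent h = {(v, c). local_view c v = h}"

definition belief ::
    "nat set \<Rightarrow> (network \<times> nat) pmf \<Rightarrow> algorithm \<Rightarrow> nat \<Rightarrow> view \<Rightarrow> (nat \<times> config) pmf" where
  "belief I \<mu> \<Lambda> r h = cond_pmf (executions I \<mu> \<Lambda> r) (consistent h)"


subsection \<open>Equilibrium\<close>

text \<open>
  After every view \<open>h\<close> possible at round \<open>r\<close>, no deviation from round \<open>r\<close> on is profitable: neither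
  one without duplication nor, at round \<open>0\<close>, one with duplication.  The strategy \<open>\<tau>\<close> consists
  of the deviating step together with the later steps of the deviator.
\<close>

definition equilibrium ::
    "nat set \<Rightarrow> nat \<Rightarrow> (network \<times> nat) pmf \<Rightarrow> algorithm \<Rightarrow> bool" where
  "equilibrium I \<beta> \<mu> \<Lambda> \<longleftrightarrow>
     (\<forall>r h. set_pmf (executions I \<mu> \<Lambda> r) \<inter> consistent h \<noteq> {} \<longrightarrow>
        (\<forall>\<tau>. measure_pmf.expectation (belief I \<mu> \<Lambda> r h) (\<lambda>(v, c). honest_value \<Lambda> v c)
              \<ge> measure_pmf.expectation (belief I \<mu> \<Lambda> r h)
                   (\<lambda>(v, c). cheat_value \<Lambda> (length (net c)) v [v] \<tau> c)) \<and>
        (r = 0 \<longrightarrow> (\<forall>S \<tau>. valid_duplication (my_degree h) S \<and> 2 \<le> length S \<longrightarrow>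
           measure_pmf.expectation (belief I \<mu> \<Lambda> r h) (\<lambda>(v, c). honest_value \<Lambda> v c)
             \<ge> measure_pmf.expectation (belief I \<mu> \<Lambda> r h)
                  (\<lambda>(v, c). duplication_value I \<beta> \<Lambda> v S \<tau> c))))"


subsection \<open>Leader election\<close>

definition instances :: "nat set \<Rightarrow> nat \<Rightarrow> nat \<Rightarrow> config set" where
  "instances I \<alpha> \<beta> =
     {init_config G ids prefs | G ids prefs.
        two_vertex_connected G \<and> \<alpha> \<le> length G \<and> length G \<le> \<beta> \<and>
        ids \<in> injections {..<length G} I \<and> prefs \<in> {..<length G} \<rightarrow>\<^sub>E {Zero, One}}"

definition leader_election :: "nat set \<Rightarrow> nat \<Rightarrow> nat \<Rightarrow> algorithm \<Rightarrow> bool" where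
  "leader_election I \<alpha> \<beta> \<Lambda> \<longleftrightarrow>
     (\<forall>c \<in> instances I \<alpha> \<beta>.
        (\<lambda>k. measure_pmf.prob (honest_run \<Lambda> c k) {c'. legal (length (net c)) (out c')})
          \<longlonglongrightarrow> 1)"

definition election_prob :: "algorithm \<Rightarrow> config \<Rightarrow> nat \<Rightarrow> real" where
  "election_prob \<Lambda> c a =
     lim (\<lambda>k. measure_pmf.prob (honest_run \<Lambda> c k) {c'. elected (length (net c)) a (out c')})"

text \<open>Fairness is with respect to the coin tosses of the agents, for every network and all private
  information.\<close>

definition fair :: "nat set \<Rightarrow> nat \<Rightarrow> nat \<Rightarrow> algorithm \<Rightarrow> bool" where
  "fair I \<alpha> \<beta> \<Lambda> \<longleftrightarrow>
     (\<forall>c \<in> instances I \<alpha> \<beta>. \<forall>a < length (net c). \<forall>b < length (net c).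
        election_prob \<Lambda> c a = election_prob \<Lambda> c b)"

end

theory Submission
  imports Defs
begin

text \<open>
  If \<open>\<alpha> < \<beta>\<close>, an agent that wants to be elected splits itself into two agents joined by an edge, lets
  both follow the algorithm, and claims victory as soon as one of them is elected.  The split network
  is again 2-vertex-connected, so fairness gives it \<open>2 / (n + 1)\<close> instead of \<open>1 / n\<close> unless
  \<open>n = \<beta>\<close>.  Averaged over all views, the gain at \<open>n = \<alpha>\<close> alone exceeds the loss at \<open>n = \<beta>\<close>.

  If the size \<open>n\<close> is known, every agent sends an independent random number below \<open>n\<close> over each of its
  links in the first round.  Afterwards everybody floods its claims about the numbers it sent and received;
  the sum of all numbers modulo \<open>n\<close> selects the leader in the list of sorted ids.  Every number is known
  to both ends of its link and the network minus one agent is connected, so after the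
  first round a cheater can only change the result to an illegal one.  Before, it does
  not know the number on some link between two other agents, so the sum is uniform whatever
  it does.  Simulating additional agents is detected because \<open>n\<close> is known.
\<close>

subsection \<open>Expectations along random processes\<close>

text \<open>Averaging is forced: a view shows the degree, and the prior may tie topology to size, so
  after a single view the belief may sit on \<open>n = \<beta>\<close>, where the split is
  worthless. By total expectation the conditional inequalities of all views that prefer
  \<open>One\<close> combine into one inequality under the prior, in which only the distribution of
  the size is left. Since \<alpha> \<ge> 3, the gain at \<alpha> is at least
  \<open>(2/3) / (\<alpha> + 1)\<close> and the loss at \<beta> at most
  \<open>1 / (\<alpha> + 1)\<close>, so \<open>3 P(\<beta>) < 2 P(\<alpha>)\<close> decides.

  For a known size, a bound at the start is not enough, as honesty must stay optimal after every
  possible view. The predicate \<open>fate\<close> bridges this: it is settled by round 0, bounds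
  the utility of every later cheat and is attained by honesty. Optimality thus holds in each
  configuration separately, and no belief has to be computed. Numbers belong to links because a
  number held by one agent alone could be chosen after seeing the others. The exact election
  probabilities come from inequalities only: honesty is itself a strategy, and the bounds
  \<open>1 / n\<close> and \<open>(n - 1) / n\<close> for the two preferences add up to 1.\<close>

lemma integrable_pmf_unit:
  fixes f :: "'a \<Rightarrow> real"
  assumes "\<And>x. x \<in> set_pmf p \<Longrightarrow> 0 \<le> f x" "\<And>x. x \<in> set_pmf p \<Longrightarrow> f x \<le> 1"
  shows "integrable (measure_pmf p) f"
  by (rule measure_pmf.integrable_const_bound[where B = 1]) (use assms in \<open>auto simp: AE_measure_pmf_iff\<close>)

lemma expectation_pmf_mono:
  fixes f g :: "'a \<Rightarrow> real"
  assumes "\<And>x. x \<in> set_pmf p \<Longrightarrow> 0 \<le> f x" "\<And>x. x \<in> set_pmf p \<Longrightarrow> f x \<le> g x"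
    "\<And>x. x \<in> set_pmf p \<Longrightarrow> g x \<le> 1"
  shows "measure_pmf.expectation p f \<le> measure_pmf.expectation p g"
proof (rule integral_mono_AE)
  show "integrable p f" using assms by (intro integrable_pmf_unit) (auto intro: order_trans)
  show "integrable p g" using assms by (intro integrable_pmf_unit) (auto intro: order_trans)
qed (use assms in \<open>auto simp: AE_measure_pmf_iff\<close>)

lemma expectation_pmf_cong:
  fixes f g :: "'a \<Rightarrow> real"
  assumes "\<And>x. x \<in> set_pmf p \<Longrightarrow> f x = g x"
  shows "measure_pmf.expectation p f = measure_pmf.expectation p g"
  using assms by (intro integral_cong_AE) (auto simp: AE_measure_pmf_iff)

lemma expectation_pmf_unit:
  fixes f :: "'a \<Rightarrow> real"
  assumes "\<And>x. x \<in> set_pmf p \<Longrightarrow> 0 \<le> f x" "\<And>x. x \<in> set_pmf p \<Longrightarrow> f x \<le> 1"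
  shows "0 \<le> measure_pmf.expectation p f" "measure_pmf.expectation p f \<le> 1"
proof -
  show "0 \<le> measure_pmf.expectation p f"
    using expectation_pmf_mono[of p "\<lambda>_. 0" f] assms by simp
  show "measure_pmf.expectation p f \<le> 1"
    using expectation_pmf_mono[of p f "\<lambda>_. 1"] assms by simp
qed

text \<open>For nonnegative integrals the tower rule needs no integrability; the bounds 0 and 1
  carry it over to expectations.\<close>

lemma expectation_bind_pmf_unit:
  fixes f :: "'b \<Rightarrow> real"
  assumes "\<And>x. 0 \<le> f x" "\<And>x. f x \<le> 1"
  shows "measure_pmf.expectation (bind_pmf p k) f =
    measure_pmf.expectation p (\<lambda>x. measure_pmf.expectation (k x) f)"
proof -
  have nn: "ennreal (measure_pmf.expectation q f) = (\<integral>\<^sup>+x. ennreal (f x) \<partial>q)" for q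
    using assms by (intro nn_integral_eq_integral[symmetric] integrable_pmf_unit) auto
  have bd: "0 \<le> measure_pmf.expectation (k x) f" "measure_pmf.expectation (k x) f \<le> 1" for x
    using expectation_pmf_unit[of "k x" f] assms by auto
  have "ennreal (measure_pmf.expectation (bind_pmf p k) f) =
      (\<integral>\<^sup>+x. \<integral>\<^sup>+y. ennreal (f y) \<partial>k x \<partial>p)"
    by (simp add: nn)
  also have "\<dots> = (\<integral>\<^sup>+x. ennreal (measure_pmf.expectation (k x) f) \<partial>p)"
    by (simp add: nn)
  also have "\<dots> = ennreal (measure_pmf.expectation p (\<lambda>x. measure_pmf.expectation (k x) f))"
    using bd by (intro nn_integral_eq_integral integrable_pmf_unit) auto
  finally show ?thesis
    using expectation_pmf_unit[of "bind_pmf p k" f] assms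
      expectation_pmf_unit[of p "\<lambda>x. measure_pmf.expectation (k x) f"] bd by simp
qed

lemma expectation_indicator_pmf:
  "measure_pmf.expectation p (\<lambda>x. if Q x then 1 else (0::real)) = measure_pmf.prob p {x. Q x}"
proof -
  have "(\<lambda>x. if Q x then 1 else (0::real)) = indicator {x. Q x}" by (auto simp: indicator_def)
  then show ?thesis by simp
qed

text \<open>All values in the model are written with \<open>lim\<close>, which says something only
  if the limit exists. An observable that never decreases along a run has monotone expectations, and
  boundedness gives convergence.\<close>

lemma monotone_process:
  fixes u :: "'a \<Rightarrow> real"
  assumes step: "\<And>k. p (Suc k) = bind_pmf (p k) f"
    and mono: "\<And>k x y. x \<in> set_pmf (p k) \<Longrightarrow> y \<in> set_pmf (f x) \<Longrightarrow> u x \<le> u y"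
    and unit: "\<And>x. 0 \<le> u x" "\<And>x. u x \<le> 1"
  defines "e \<equiv> \<lambda>k. measure_pmf.expectation (p k) u"
  shows "incseq e" "e \<longlonglongrightarrow> lim e" "0 \<le> lim e" "lim e \<le> 1" "e k \<le> lim e"
proof -
  have bd: "0 \<le> e k" "e k \<le> 1" for k
    unfolding e_def by (rule expectation_pmf_unit; rule unit)+
  show inc: "incseq e"
  proof (rule incseq_SucI)
    fix k
    have "e k \<le> measure_pmf.expectation (p k) (\<lambda>x. measure_pmf.expectation (f x) u)"
      unfolding e_def
    proof (rule expectation_pmf_mono)
      fix x assume x: "x \<in> set_pmf (p k)"
      show "0 \<le> u x" by (rule unit)
      show "u x \<le> measure_pmf.expectation (f x) u"
        using expectation_pmf_mono[of "f x" "\<lambda>_. u x" u] mono[OF x] unit by simp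
      show "measure_pmf.expectation (f x) u \<le> 1"
        by (rule expectation_pmf_unit; rule unit)
    qed
    also have "\<dots> = e (Suc k)"
      unfolding e_def step using unit by (simp add: expectation_bind_pmf_unit)
    finally show "e k \<le> e (Suc k)" .
  qed
  obtain L where L: "e \<longlonglongrightarrow> L" by (rule incseq_convergent[OF inc, of 1]) (use bd(2) in auto)
  then show lim: "e \<longlonglongrightarrow> lim e" by (simp add: limI)
  show "0 \<le> lim e" by (rule LIMSEQ_le_const[OF lim]) (use bd in auto)
  show "lim e \<le> 1" by (rule LIMSEQ_le_const2[OF lim]) (use bd in auto)
  show "e k \<le> lim e" by (rule incseq_le[OF inc lim])
qed

text \<open>Serves to trace the probability of a property that no later round can change back to the
  round \<open>m\<close> in which it was settled.\<close>

lemma invariant_process: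
  assumes step: "\<And>k. p (Suc k) = bind_pmf (p k) f"
    and inv: "\<And>k x y. m \<le> k \<Longrightarrow> x \<in> set_pmf (p k) \<Longrightarrow> y \<in> set_pmf (f x) \<Longrightarrow> Q y = Q x"
    and "m \<le> k"
  shows "measure_pmf.prob (p k) {x. Q x} = measure_pmf.prob (p m) {x. Q x}"
  using \<open>m \<le> k\<close>
proof (induction k rule: dec_induct)
  case (step k)
  let ?u = "\<lambda>x. if Q x then 1 else (0::real)"
  have "measure_pmf.expectation (p (Suc k)) ?u =
      measure_pmf.expectation (p k) (\<lambda>x. measure_pmf.expectation (f x) ?u)"
    unfolding assms(1) by (rule expectation_bind_pmf_unit) auto
  also have "\<dots> = measure_pmf.expectation (p k) ?u"
  proof (rule expectation_pmf_cong)
    fix x assume "x \<in> set_pmf (p k)"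
    then have "measure_pmf.expectation (f x) ?u = measure_pmf.expectation (f x) (\<lambda>_. ?u x)"
      using inv[OF step(1)] by (intro expectation_pmf_cong) auto
    then show "measure_pmf.expectation (f x) ?u = ?u x" by simp
  qed
  finally show ?case using step.IH by (simp add: expectation_indicator_pmf)
qed simp

text \<open>Total expectation: \<open>p\<close> arises by first drawing the value of
  \<open>w\<close> and then conditioning on it. With \<open>w\<close> the view of an agent, this
  turns the equilibrium conditions after single views into one inequality under the prior;
  \<open>Q\<close> selects the views that take part.\<close>

lemma expectation_le_of_cond_le:
  fixes f g :: "'a \<Rightarrow> real"
  assumes unit: "\<And>x. 0 \<le> f x" "\<And>x. f x \<le> 1" "\<And>x. 0 \<le> g x" "\<And>x. g x \<le> 1"
    and le: "\<And>x. x \<in> set_pmf p \<Longrightarrow> Q (w x) \<Longrightarrow>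
       measure_pmf.expectation (cond_pmf p {y. w y = w x}) g \<le>
       measure_pmf.expectation (cond_pmf p {y. w y = w x}) f"
  shows "measure_pmf.expectation p (\<lambda>x. if Q (w x) then g x else 0) \<le>
         measure_pmf.expectation p (\<lambda>x. if Q (w x) then f x else 0)"
proof -
  define q where "q = map_pmf w p"
  have P: "bind_pmf q (\<lambda>h. cond_pmf p {y. w y = h}) = p"
  proof (rule bind_cond_pmf_cancel)
    show "set_pmf p \<inter> {y. w y = x} \<noteq> {}" if "x \<in> set_pmf q" for x
      using that by (auto simp: q_def)
    show "set_pmf q \<inter> {x. w y = x} \<noteq> {}" if "y \<in> set_pmf p" for y
      using that by (auto simp: q_def)
    show "measure_pmf.prob p {y. w y = x} = measure_pmf.prob q {x. w y = x}"
      if "w y = x" for x y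
    proof -
      have "w -` {a. w y = a} = {y. w y = x}" using that by auto
      then show ?thesis by (simp add: q_def)
    qed
  qed
  have E: "measure_pmf.expectation p (\<lambda>x. if Q (w x) then k x else 0) =
      measure_pmf.expectation q (\<lambda>h. if Q h then measure_pmf.expectation (cond_pmf p {y. w y = h}) k else 0)"
    if "\<And>x. 0 \<le> k x" "\<And>x. k x \<le> 1" for k :: "'a \<Rightarrow> real"
  proof -
    have "measure_pmf.expectation p (\<lambda>x. if Q (w x) then k x else 0) =
      measure_pmf.expectation q (\<lambda>h. measure_pmf.expectation (cond_pmf p {y. w y = h}) (\<lambda>x. if Q (w x) then k x else 0))"
      by (subst P[symmetric], rule expectation_bind_pmf_unit) (auto simp: that)
    also have "\<dots> = measure_pmf.expectation q (\<lambda>h. if Q h then measure_pmf.expectation (cond_pmf p {y. w y = h}) k else 0)"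
    proof (rule expectation_pmf_cong)
      fix h assume "h \<in> set_pmf q"
      then have ne: "set_pmf p \<inter> {y. w y = h} \<noteq> {}" by (auto simp: q_def)
      have "measure_pmf.expectation (cond_pmf p {y. w y = h}) (\<lambda>x. if Q (w x) then k x else 0) =
         measure_pmf.expectation (cond_pmf p {y. w y = h}) (\<lambda>x. if Q h then k x else 0)"
        by (rule expectation_pmf_cong) (auto simp: set_cond_pmf[OF ne])
      then show "measure_pmf.expectation (cond_pmf p {y. w y = h}) (\<lambda>x. if Q (w x) then k x else 0) =
         (if Q h then measure_pmf.expectation (cond_pmf p {y. w y = h}) k else 0)" by auto
    qed
    finally show ?thesis .
  qed
  have unitE: "0 \<le> measure_pmf.expectation r k \<and> measure_pmf.expectation r k \<le> 1"
    if "\<And>x. 0 \<le> k x" "\<And>x. k x \<le> 1" for k :: "'a \<Rightarrow> real" and r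
    using that by (intro conjI expectation_pmf_unit)
  show ?thesis
    unfolding E[of f, OF unit(1,2)] E[of g, OF unit(3,4)]
  proof (rule expectation_pmf_mono, goal_cases)
    case (2 h)
    then show ?case using le by (auto simp: q_def)
  qed (use unitE[of f] unitE[of g] unit in auto)
qed

text \<open>A rotation of the sample space that increments \<open>X\<close> modulo \<open>n\<close> makes all residues equally likely.\<close>

lemma rotation_bound:
  fixes M :: "'a pmf" and X :: "'a \<Rightarrow> nat"
  assumes "0 < n" and inv: "map_pmf \<phi> M = M"
    and X: "\<And>h. h \<in> set_pmf M \<Longrightarrow> good h \<Longrightarrow> X (\<phi> h) mod n = Suc (X h) mod n"
    and good: "\<And>h. h \<in> set_pmf M \<Longrightarrow> good (\<phi> h) \<longleftrightarrow> good h"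
    and J: "\<And>h. h \<in> set_pmf M \<Longrightarrow> good h \<Longrightarrow> J (\<phi> h) = J h"
    and J': "\<And>h. h \<in> set_pmf M \<Longrightarrow> good h \<Longrightarrow> J h \<subseteq> {..<n} \<and> card (J h) = m"
  shows "measure_pmf.prob M {h. good h \<and> X h mod n \<in> J h} \<le> real m / real n"
proof -
  \<comment> \<open>\<open>P j\<close> is the event with the outcome shifted by \<open>j\<close>.
    The map \<open>\<phi>\<close> trades one unit of \<open>j\<close> for one unit of
    \<open>X\<close> and preserves \<open>M\<close>, so all \<open>P j\<close> are equal.\<close>
  define P where "P j = measure_pmf.prob M {h. good h \<and> (X h + j) mod n \<in> J h}" for j
  have "P (Suc j) = P j" for j
  proof -
    have "P j = measure_pmf.prob (map_pmf \<phi> M) {h. good h \<and> (X h + j) mod n \<in> J h}"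
      by (simp add: inv P_def)
    also have "\<dots> = measure_pmf.prob M (\<phi> -` {h. good h \<and> (X h + j) mod n \<in> J h})"
      by simp
    also have "\<dots> = P (Suc j)"
      unfolding P_def
    proof (rule measure_pmf.finite_measure_eq_AE)
      have "(\<phi> h \<in> {h. good h \<and> (X h + j) mod n \<in> J h}) \<longleftrightarrow> good h \<and> (X h + Suc j) mod n \<in> J h"
        if "h \<in> set_pmf M" for h
      proof (cases "good h")
        case True
        have "(X (\<phi> h) + j) mod n = (X (\<phi> h) mod n + j) mod n" by (simp add: mod_add_left_eq)
        also have "\<dots> = (Suc (X h) + j) mod n" by (simp add: X[OF that True] mod_add_left_eq del: add_Suc)
        finally show ?thesis using that True good J by simp
      qed (use that good in simp)
      then show "AE x in measure_pmf M. (x \<in> \<phi> -` {h. good h \<and> (X h + j) mod n \<in> J h}) =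
          (x \<in> {h. good h \<and> (X h + Suc j) mod n \<in> J h})"
        by (auto simp: AE_measure_pmf_iff)
    qed auto
    finally show ?thesis by simp
  qed
  then have P: "P j = P 0" for j
    by (induction j) auto
  define u where "u j h = (if good h \<and> (X h + j) mod n \<in> J h then 1 else (0::real))" for j h
  \<comment> \<open>Over all \<open>n\<close> shifts each good sample passes through every residue
    once and therefore hits \<open>J h\<close> exactly \<open>m\<close> times.\<close>
  have "real n * P 0 = (\<Sum>j<n. P j)"
    by (subst sum.cong[OF refl P]) simp
  also have "\<dots> = (\<Sum>j<n. measure_pmf.expectation M (u j))"
    unfolding P_def u_def by (simp only: expectation_indicator_pmf)
  also have "\<dots> = measure_pmf.expectation M (\<lambda>h. \<Sum>j<n. u j h)"
    by (rule Bochner_Integration.integral_sum[symmetric]) (auto simp: u_def intro!: integrable_pmf_unit)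
  also have "\<dots> = measure_pmf.expectation M (\<lambda>h. real m * (if good h then 1 else 0))"
  proof (rule expectation_pmf_cong)
    fix h assume h: "h \<in> set_pmf M"
    show "(\<Sum>j<n. u j h) = real m * (if good h then 1 else 0)"
    proof (cases "good h")
      case True
      have inj: "inj_on (\<lambda>j. (X h + j) mod n) {..<n}"
      proof (rule linorder_inj_onI)
        fix i j :: nat assume "i < j" "i \<in> {..<n}" "j \<in> {..<n}"
        then have "\<not> n dvd X h + j - (X h + i)" by (auto dest: dvd_imp_le)
        then show "(X h + i) mod n \<noteq> (X h + j) mod n"
          using \<open>i < j\<close> mod_eq_dvd_iff_nat[of "X h + i" "X h + j" n] by auto
      qed auto
      then have im: "(\<lambda>j. (X h + j) mod n) ` {..<n} = {..<n}"
        using \<open>0 < n\<close> by (intro endo_inj_surj) auto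
      have "(\<Sum>j<n. u j h) = (\<Sum>i\<in>(\<lambda>j. (X h + j) mod n) ` {..<n}. if i \<in> J h then 1 else 0)"
        by (subst sum.reindex[OF inj]) (simp add: u_def True)
      also have "\<dots> = real m"
        using J'[OF h True] by (simp add: im sum.If_cases Int_absorb1)
      finally show ?thesis using True by simp
    qed (simp add: u_def)
  qed
  also have "\<dots> = real m * measure_pmf.prob M {h. good h}"
    by (simp add: expectation_indicator_pmf)
  also have "\<dots> \<le> real m" by (simp add: mult_left_le)
  finally show ?thesis using \<open>0 < n\<close> by (simp add: P_def field_simps)
qed

subsection \<open>Claims about links\<close>

text \<open>A claim consists of an id and, for each neighbour, the id of the neighbour, the number sent to it and the
  number received from it.\<close>

type_synonym claim = "nat \<times> (nat \<times> nat \<times> nat) list"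

definition links :: "claim set \<Rightarrow> (nat \<times> nat \<times> nat \<times> nat) set" where
  "links K = {(a, b, x, y) | a b x y. \<exists>L. (a, L) \<in> K \<and> (b, x, y) \<in> set L}"

definition rev_link :: "nat \<times> nat \<times> nat \<times> nat \<Rightarrow> nat \<times> nat \<times> nat \<times> nat" where
  "rev_link = (\<lambda>(a, b, x, y). (b, a, y, x))"

definition sym_links :: "claim set \<Rightarrow> (nat \<times> nat \<times> nat \<times> nat) set" where
  "sym_links H = links H \<union> rev_link ` links H"

text \<open>The two cardinalities force \<open>n\<close> distinct ids, each with one claim and at
  least one link, as \<open>coherent_ids\<close> shows. Distinct neighbour ids leave at most one
  record per ordered pair of ids, so that each number has a definite place in
  \<open>total\<close>.\<close>

definition coherent :: "nat \<Rightarrow> claim set \<Rightarrow> bool" where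
  "coherent n K \<longleftrightarrow> card K = n \<and> card (fst ` links K) = n \<and>
     (\<forall>(a, b, x, y) \<in> links K. (b, a, y, x) \<in> links K \<and> a \<noteq> b) \<and>
     (\<forall>(a, L) \<in> K. distinct (map fst L))"

text \<open>Only the sent component is added: in a symmetric set the number received on a link is
  the sent component of the reversed record, so each number enters once.\<close>

definition total :: "(nat \<times> nat \<times> nat \<times> nat) set \<Rightarrow> nat" where
  "total T = (\<Sum>(a, b, x, y) \<in> T. x)"

definition winner :: "nat \<Rightarrow> (nat \<times> nat \<times> nat \<times> nat) set \<Rightarrow> nat" where
  "winner n T = sorted_list_of_set (fst ` T) ! (total T mod n)"

text \<open>The part of coherence that can be seen without the claim of the cheater.\<close>

definition admissible :: "nat \<Rightarrow> claim set \<Rightarrow> bool" where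
  "admissible n H \<longleftrightarrow> card (fst ` sym_links H) = n \<and> fst ` H \<subseteq> fst ` sym_links H \<and>
     (\<forall>(a, L) \<in> H. distinct (map fst L))"

lemma links_mono: "H \<subseteq> K \<Longrightarrow> links H \<subseteq> links K"
  by (fastforce simp: links_def)

lemma fst_links: "fst ` links K \<subseteq> fst ` K"
  by (force simp: links_def)

text \<open>Pigeonhole: the ids on links are among the ids of claims, of which there are at most
  \<open>n\<close>, while \<open>n\<close> ids occur on links.\<close>

lemma coherent_ids:
  assumes "coherent n K" "0 < n"
  shows "finite K" "fst ` links K = fst ` K" "inj_on fst K"
proof -
  show fin: "finite K" using assms by (auto simp: coherent_def intro: card_ge_0_finite)
  have "card (fst ` K) \<le> n" using assms card_image_le[OF fin] by (auto simp: coherent_def)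
  then show eq: "fst ` links K = fst ` K"
    using assms fin by (intro card_seteq fst_links) (auto simp: coherent_def)
  show "inj_on fst K"
    using assms fin eq by (intro eq_card_imp_inj_on) (auto simp: coherent_def)
qed

text \<open>Here \<open>H\<close> are the claims of the agents other than the cheater: by symmetry they determine what a
  coherent claim of the cheater says about its links, so a cheater cannot alter the result later.\<close>

lemma links_coherent:
  assumes K: "coherent n K" "0 < n" and H: "H \<subseteq> K" "card H = n - 1"
  shows "links K = sym_links H"
proof -
  have fin: "finite K" and inj: "inj_on fst K" using coherent_ids[OF K] by auto
  have sym: "(b, a, y, x) \<in> links K" "a \<noteq> b" if "(a, b, x, y) \<in> links K" for a b x y
    using K that by (auto simp: coherent_def)
  have "card (K - H) = 1"
    using H K fin by (subst card_Diff_subset) (auto simp: coherent_def intro: finite_subset)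
  then obtain z L where "K - H = {(z, L)}" by (metis card_1_singletonE surj_pair)
  then have KH: "K = insert (z, L) H" using H by auto
  have "links K \<subseteq> sym_links H"
  proof (clarify)
    fix a b x y assume t: "(a, b, x, y) \<in> links K"
    have *: "(a, b, x, y) \<in> links H" if "a \<noteq> z" "(a, b, x, y) \<in> links K" for a b x y
      using that by (auto simp: links_def KH)
    show "(a, b, x, y) \<in> sym_links H"
    proof (cases "a = z")
      case True
      then have "(b, a, y, x) \<in> links H" using sym[OF t] * by auto
      then show ?thesis by (force simp: sym_links_def rev_link_def)
    qed (use * t in \<open>auto simp: sym_links_def\<close>)
  qed
  moreover have "sym_links H \<subseteq> links K"
    using links_mono[OF H(1)] sym by (auto simp: sym_links_def rev_link_def)
  ultimately show ?thesis by auto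
qed

text \<open>Replaces a judgement on all claims, which may include a forged one, by a judgement on
  the claims of the others alone; this is what allows \<open>fate\<close> to ignore the
  cheater.\<close>

lemma admissible_coherent:
  assumes K: "coherent n K" "0 < n" and H: "H \<subseteq> K" "card H = n - 1"
  shows "admissible n H" "winner n (sym_links H) \<in> fst ` K"
proof -
  have eq: "links K = sym_links H" by (rule links_coherent) fact+
  have ids: "fst ` sym_links H = fst ` K" using coherent_ids[OF K] eq by simp
  have card: "card (fst ` sym_links H) = n" using K eq by (simp add: coherent_def)
  then show "admissible n H"
    using K H ids by (auto simp: coherent_def admissible_def)
  have "sorted_list_of_set (fst ` sym_links H) ! (total (sym_links H) mod n) \<in>
      set (sorted_list_of_set (fst ` sym_links H))"
    using card K by (intro nth_mem) auto
  then show "winner n (sym_links H) \<in> fst ` K"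
    using card K ids by (simp add: winner_def card_ge_0_finite)
qed

text \<open>The number \<open>x\<close> chosen for one link enters the total exactly once, because all other links
  have different endpoints.\<close>

lemma sym_links_one_link:
  assumes L0: "\<And>c d u w. (c, d, u, w) \<in> L0 \<Longrightarrow> \<not> (c = a \<and> d = b) \<and> \<not> (c = b \<and> d = a)"
    and "finite L0" "a \<noteq> b"
    and H: "links H = {(a, b, x, y), (b, a, y, x)} \<union> L0"
  shows "total (sym_links H) = x + y + total (L0 \<union> rev_link ` L0)"
    and "fst ` sym_links H = {a, b} \<union> fst ` (L0 \<union> rev_link ` L0)"
proof -
  have eq: "sym_links H = insert (a, b, x, y) (insert (b, a, y, x) (L0 \<union> rev_link ` L0))"
    by (auto simp: sym_links_def H rev_link_def image_Un)
  have "(a, b, x, y) \<notin> insert (b, a, y, x) (L0 \<union> rev_link ` L0)" "(b, a, y, x) \<notin> L0 \<union> rev_link ` L0"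
    using assms by (auto simp: rev_link_def)
  then show "total (sym_links H) = x + y + total (L0 \<union> rev_link ` L0)"
    using \<open>finite L0\<close> by (simp add: eq total_def)
  show "fst ` sym_links H = {a, b} \<union> fst ` (L0 \<union> rev_link ` L0)"
    by (auto simp: eq)
qed

text \<open>Separates the link between \<open>a\<close> and \<open>b\<close> from a remainder
  \<open>L0\<close> that does not depend on the number \<open>x'\<close> sent over it.\<close>

lemma links_update:
  assumes L: "distinct (map fst La)" "distinct (map fst Lb)" "p < length La" "q < length Lb"
    and "La ! p = (b, x, y)" "Lb ! q = (a, y, x)" "a \<noteq> b" "a \<notin> fst ` H0" "b \<notin> fst ` H0"
    and "finite H0"
  obtains L0 where "finite L0"
    "\<And>c d u w. (c, d, u, w) \<in> L0 \<Longrightarrow> \<not> (c = a \<and> d = b) \<and> \<not> (c = b \<and> d = a)"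
    "\<And>x'. links (insert (a, La[p := (b, x', y)]) (insert (b, Lb[q := (a, y, x')]) H0)) =
       {(a, b, x', y), (b, a, y, x')} \<union> L0"
proof -
  \<comment> \<open>All other records. Distinct keys rule out a second record from \<open>a\<close>
    to \<open>b\<close> or back, and \<open>H0\<close> has no claim of either.\<close>
  define L0 where "L0 = Pair a ` (set La - {La ! p}) \<union> Pair b ` (set Lb - {Lb ! q}) \<union> links H0"
  have upd: "set (Q[p := z]) = insert z (set Q - {Q ! p})" if "distinct (map fst Q)" "p < length Q"
    for Q :: "(nat \<times> nat \<times> nat) list" and p z
    using that by (simp add: set_update_distinct distinct_map)
  have uniq: "k \<noteq> fst (Q ! p)" if "distinct (map fst Q)" "p < length Q" "(k, u, w) \<in> set Q - {Q ! p}"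
    for Q :: "(nat \<times> nat \<times> nat) list" and p k u w
    using that inj_onD[of fst "set Q" "(k, u, w)" "Q ! p"] by (auto simp: distinct_map)
  show ?thesis
  proof (rule that)
    have "links H0 \<subseteq> (\<Union>(a, L) \<in> H0. Pair a ` set L)" by (auto simp: links_def)
    moreover have "finite (\<Union>(a, L) \<in> H0. Pair a ` set L)" using \<open>finite H0\<close> by auto
    ultimately show "finite L0" by (auto simp: L0_def intro: finite_subset)
    show "\<not> (c = a \<and> d = b) \<and> \<not> (c = b \<and> d = a)" if "(c, d, u, w) \<in> L0" for c d u w
    proof -
      have "c \<in> fst ` H0" if "(c, d, u, w) \<in> links H0" using that fst_links[of H0] by force
      moreover have "d \<noteq> b" if "(d, u, w) \<in> set La - {La ! p}"
        using uniq[OF L(1,3) that] assms by simp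
      moreover have "d \<noteq> a" if "(d, u, w) \<in> set Lb - {Lb ! q}"
        using uniq[OF L(2,4) that] assms by simp
      ultimately show ?thesis using that assms(7-9) unfolding L0_def by blast
    qed
    show "links (insert (a, La[p := (b, x', y)]) (insert (b, Lb[q := (a, y, x')]) H0)) =
       {(a, b, x', y), (b, a, y, x')} \<union> L0" for x'
    proof -
      have ins: "links (insert (c, L) K) = Pair c ` set L \<union> links K" for c L K
        by (auto simp: links_def)
      show ?thesis unfolding ins upd[OF L(1,3)] upd[OF L(2,4)] L0_def by auto
    qed
  qed
qed

text \<open>The number is changed consistently where it is sent and where it is received, so no id
  or key moves and only the total changes. If some keys repeat, neither set is admissible. This is
  the rotation demanded by \<open>rotation_bound\<close>.\<close>

lemma rotate_link:
  assumes L: "p < length La" "q < length Lb"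
    and e: "La ! p = (b, x, y)" "Lb ! q = (a, y, x)" "a \<noteq> b" "a \<notin> fst ` H0" "b \<notin> fst ` H0"
    and "finite H0" "0 < n"
  defines "H \<equiv> insert (a, La) (insert (b, Lb) H0)"
    and "H' \<equiv> insert (a, La[p := (b, Suc x mod n, y)]) (insert (b, Lb[q := (a, y, Suc x mod n)]) H0)"
  shows "admissible n H' \<longleftrightarrow> admissible n H"
    and "admissible n H \<Longrightarrow> fst ` sym_links H' = fst ` sym_links H"
    and "admissible n H \<Longrightarrow> total (sym_links H') mod n = Suc (total (sym_links H)) mod n"
proof -
  have keys: "map fst (La[p := (b, Suc x mod n, y)]) = map fst La"
    "map fst (Lb[q := (a, y, Suc x mod n)]) = map fst Lb"
    using e by (simp_all add: map_update list_update_same_conv L)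
  have main: "fst ` sym_links H' = fst ` sym_links H \<and>
      total (sym_links H') mod n = Suc (total (sym_links H)) mod n"
    if d: "distinct (map fst La)" "distinct (map fst Lb)"
  proof -
    obtain L0 where L0: "finite L0"
      "\<And>c d u w. (c, d, u, w) \<in> L0 \<Longrightarrow> \<not> (c = a \<and> d = b) \<and> \<not> (c = b \<and> d = a)"
      "\<And>x'. links (insert (a, La[p := (b, x', y)]) (insert (b, Lb[q := (a, y, x')]) H0)) =
         {(a, b, x', y), (b, a, y, x')} \<union> L0"
      by (rule links_update[OF d L e \<open>finite H0\<close>]) (rule that; assumption)
    have "La[p := (b, x, y)] = La" "Lb[q := (a, y, x)] = Lb" using e by (metis list_update_id)+
    then have "links H = {(a, b, x, y), (b, a, y, x)} \<union> L0" using L0(3)[of x] by (simp add: H_def)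
    note H = sym_links_one_link[OF L0(2,1) e(3) this]
    have "links H' = {(a, b, Suc x mod n, y), (b, a, y, Suc x mod n)} \<union> L0"
      using L0(3) by (simp add: H'_def)
    note H' = sym_links_one_link[OF L0(2,1) e(3) this]
    have m: "(Suc x mod n + y + c) mod n = Suc (x + y + c) mod n" for c
      by (simp add: mod_add_left_eq add.assoc)
    show ?thesis by (simp only: H H' m)
  qed
  have dist: "(\<forall>(c, L) \<in> H'. distinct (map fst L)) \<longleftrightarrow> (\<forall>(c, L) \<in> H. distinct (map fst L))"
    unfolding H_def H'_def by (simp add: keys)
  have ids: "fst ` H' = fst ` H" unfolding H_def H'_def by simp
  have main': "fst ` sym_links H' = fst ` sym_links H \<and>
      total (sym_links H') mod n = Suc (total (sym_links H)) mod n"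
    if "\<forall>(c, L) \<in> H. distinct (map fst L)"
    by (rule main) (use that in \<open>unfold H_def, simp_all\<close>)
  show "admissible n H' \<longleftrightarrow> admissible n H"
  proof (cases "\<forall>(c, L) \<in> H. distinct (map fst L)")
    case True
    then show ?thesis unfolding admissible_def ids dist by (simp only: main'[OF True])
  qed (unfold admissible_def dist, blast)
  show "fst ` sym_links H' = fst ` sym_links H"
    "total (sym_links H') mod n = Suc (total (sym_links H)) mod n" if "admissible n H"
    using that main' unfolding admissible_def by blast+
qed

text \<open>Later counts the residues that elect a member of a given set of ids.\<close>

lemma card_nth_in:
  assumes "distinct xs" "B \<subseteq> set xs"
  shows "card {i. i < length xs \<and> xs ! i \<in> B} = card B"
proof -
  have "bij_betw (\<lambda>i. xs ! i) {i. i < length xs \<and> xs ! i \<in> B} B"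
    using assms by (auto simp: bij_betw_def inj_on_def nth_eq_iff_index_eq in_set_conv_nth image_def subset_iff)
  then show ?thesis by (rule bij_betw_same_card)
qed

subsection \<open>Executions with a set of honest agents\<close>

text \<open>Agents outside \<open>A\<close> may send and output anything. Thus
  \<open>A = {..<n}\<close> covers honest runs and \<open>A = {..<n} - {v}\<close> every run with
  cheater \<open>v\<close>, and what can happen at all is proved for both without
  probabilities.\<close>

inductive reach :: "algorithm \<Rightarrow> nat set \<Rightarrow> config \<Rightarrow> nat \<Rightarrow> config \<Rightarrow> bool"
  for \<Lambda> A c0 where
  reach_init: "reach \<Lambda> A c0 0 c0"
| reach_step: "reach \<Lambda> A c0 t c \<Longrightarrow> (\<And>u. u \<in> A \<Longrightarrow> s u \<in> set_pmf (\<Lambda> (local_view c u))) \<Longrightarrow>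
    (\<And>u. u \<in> A \<Longrightarrow> ds u = decision (s u)) \<Longrightarrow> reach \<Lambda> A c0 (Suc t) (advance c s ds)"

lemma reach_antimono: "reach \<Lambda> A c0 t c \<Longrightarrow> B \<subseteq> A \<Longrightarrow> reach \<Lambda> B c0 t c"
  by (induction rule: reach.induct) (auto intro!: reach.intros)

lemma advance_simps [simp]:
  "net (advance c s ds) = net c" "ident (advance c s ds) = ident c" "pref (advance c s ds) = pref c"
  "u < length (net c) \<Longrightarrow> hist (advance c s ds) u = hist c u @ [(s u, received (net c) s u)]"
  "out (advance c s ds) u = (case out c u of None \<Rightarrow> ds u | Some x \<Rightarrow> Some x)"
  by (auto simp: advance_def)

lemma init_config_simps [simp]:
  "net (init_config G ids prefs) = G" "ident (init_config G ids prefs) = ids"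
  "pref (init_config G ids prefs) = prefs" "hist (init_config G ids prefs) u = []"
  "out (init_config G ids prefs) u = None"
  by (auto simp: init_config_def)

lemma reach_honest_round:
  assumes "reach \<Lambda> {..<length (net c)} c0 t c" "c' \<in> set_pmf (honest_round \<Lambda> c)"
  shows "reach \<Lambda> {..<length (net c)} c0 (Suc t) c'"
  using assms by (auto simp: honest_round_def set_Pi_pmf PiE_dflt_def intro!: reach.intros)

lemma reach_cheat_round:
  assumes "reach \<Lambda> ({..<length (net c)} - {v}) c0 t c" "c' \<in> set_pmf (cheat_round \<Lambda> v [v] \<tau> c)"
  shows "reach \<Lambda> ({..<length (net c)} - {v}) c0 (Suc t) c'"
proof -
  obtain h xs ov where h: "h \<in> set_pmf (Pi_pmf ({..<length (net c)} - {v}) idle (\<lambda>u. \<Lambda> (local_view c u)))"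
    and c': "c' = (let s = (\<lambda>u. case map_of (zip [v] xs) u of Some x \<Rightarrow> x | None \<Rightarrow> h u)
         in advance c s ((\<lambda>u. decision (s u))(v := ov)))"
    using assms(2) by (auto simp: cheat_round_def)
  \<comment> \<open>\<open>zip\<close> truncates, so whatever list the strategy returns, only the
    step of \<open>v\<close> can be overridden.\<close>
  have "(case map_of (zip [v] xs) u of Some x \<Rightarrow> x | None \<Rightarrow> h u) = h u" if "u \<noteq> v" for u
    using that by (cases xs) auto
  then show ?thesis
    unfolding c' Let_def using h assms(1)
    by (intro reach_step) (auto simp: set_Pi_pmf PiE_dflt_def)
qed

lemma net_honest_run: "c' \<in> set_pmf (honest_run \<Lambda> c k) \<Longrightarrow> net c' = net c"
  by (induction k arbitrary: c') (auto simp: honest_round_def)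

lemma net_cheat_run: "c' \<in> set_pmf (cheat_run \<Lambda> v C \<tau> c k) \<Longrightarrow> net c' = net c"
  by (induction k arbitrary: c') (fastforce simp: cheat_round_def Let_def)+

lemma reach_honest_run:
  assumes "reach \<Lambda> {..<length (net c)} c0 t c" "c' \<in> set_pmf (honest_run \<Lambda> c k)"
  shows "reach \<Lambda> {..<length (net c)} c0 (t + k) c'"
  using assms(2)
proof (induction k arbitrary: c')
  case (Suc k)
  then obtain d where d: "d \<in> set_pmf (honest_run \<Lambda> c k)" "c' \<in> set_pmf (honest_round \<Lambda> d)" by auto
  then show ?case using Suc.IH reach_honest_round[of \<Lambda> d] net_honest_run[OF d(1)] by simp
qed (use assms in simp)

lemma reach_cheat_run:
  assumes "reach \<Lambda> ({..<length (net c)} - {v}) c0 t c" "c' \<in> set_pmf (cheat_run \<Lambda> v [v] \<tau> c k)"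
  shows "reach \<Lambda> ({..<length (net c)} - {v}) c0 (t + k) c'"
  using assms(2)
proof (induction k arbitrary: c')
  case (Suc k)
  then obtain d where d: "d \<in> set_pmf (cheat_run \<Lambda> v [v] \<tau> c k)" "c' \<in> set_pmf (cheat_round \<Lambda> v [v] \<tau> d)"
    by auto
  then show ?case using Suc.IH reach_cheat_round[of \<Lambda> d] net_cheat_run[OF d(1)] by simp
qed (use assms in simp)

section \<open>Values and election probabilities as monotone limits\<close>

lemma utility_unit: "0 \<le> utility n v p os" "utility n v p os \<le> 1"
  by (auto simp: utility_def)

lemma legal_outputs: "legal n os \<Longrightarrow> u < n \<Longrightarrow> os u \<noteq> None"
  by (cases "os u") (auto simp: legal_def)

text \<open>A legal vector has an output for every real agent, and outputs are irrevocable, so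
  legality once reached is frozen.\<close>

lemma utility_advance:
  assumes "v < n"
  shows "utility n v p (out c) \<le> utility n v p (out (advance c s ds))"
proof (cases "legal n (out c)")
  case True
  then have eq: "out (advance c s ds) u = out c u" if "u < n" for u
    using legal_outputs[OF True that] by (auto split: option.splits)
  have "legal n (out (advance c s ds))"
    using True unfolding legal_def by (metis eq)
  then show ?thesis using True eq[OF assms] by (auto simp: utility_def)
qed (simp add: utility_unit utility_def)

lemma honest_round_advance: "c' \<in> set_pmf (honest_round \<Lambda> c) \<Longrightarrow> \<exists>s ds. c' = advance c s ds"
  by (auto simp: honest_round_def)

lemma cheat_round_advance: "c' \<in> set_pmf (cheat_round \<Lambda> v C \<tau> c) \<Longrightarrow> \<exists>s ds. c' = advance c s ds"
  by (fastforce simp: cheat_round_def Let_def)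

lemma honest_value_limit:
  fixes c \<Lambda> v
  defines "e \<equiv> \<lambda>k. measure_pmf.expectation (honest_run \<Lambda> c k)
                (\<lambda>c'. utility (length (net c)) v (pref c v) (out c'))"
  assumes "v < length (net c)"
  shows "e \<longlonglongrightarrow> honest_value \<Lambda> v c" "0 \<le> honest_value \<Lambda> v c" "honest_value \<Lambda> v c \<le> 1"
    "e k \<le> honest_value \<Lambda> v c"
proof -
  have val: "honest_value \<Lambda> v c = lim e" by (simp add: honest_value_def e_def)
  have "utility (length (net c)) v (pref c v) (out x) \<le> utility (length (net c)) v (pref c v) (out y)"
    if "y \<in> set_pmf (honest_round \<Lambda> x)" for x y
    using honest_round_advance[OF that] utility_advance[OF assms(2)] by auto
  note m = monotone_process[where p = "honest_run \<Lambda> c" and f = "honest_round \<Lambda>"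
      and u = "\<lambda>c'. utility (length (net c)) v (pref c v) (out c')", OF _ this utility_unit, simplified]
  show "e \<longlonglongrightarrow> honest_value \<Lambda> v c" "0 \<le> honest_value \<Lambda> v c" "honest_value \<Lambda> v c \<le> 1"
    "e k \<le> honest_value \<Lambda> v c"
    unfolding val e_def by (rule m)+
qed

lemma cheat_value_limit:
  fixes c \<Lambda> v C \<tau> n
  defines "e \<equiv> \<lambda>k. measure_pmf.expectation (cheat_run \<Lambda> v C \<tau> c k)
                (\<lambda>c'. utility n v (pref c v) (out c'))"
  assumes "v < n"
  shows "e \<longlonglongrightarrow> cheat_value \<Lambda> n v C \<tau> c" "0 \<le> cheat_value \<Lambda> n v C \<tau> c" "cheat_value \<Lambda> n v C \<tau> c \<le> 1"
    "e k \<le> cheat_value \<Lambda> n v C \<tau> c"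
proof -
  have val: "cheat_value \<Lambda> n v C \<tau> c = lim e" by (simp add: cheat_value_def e_def)
  have "utility n v (pref c v) (out x) \<le> utility n v (pref c v) (out y)"
    if "y \<in> set_pmf (cheat_round \<Lambda> v C \<tau> x)" for x y
    using cheat_round_advance[OF that] utility_advance[OF assms(2)] by auto
  note m = monotone_process[where p = "cheat_run \<Lambda> v C \<tau> c" and f = "cheat_round \<Lambda> v C \<tau>"
      and u = "\<lambda>c'. utility n v (pref c v) (out c')", OF _ this utility_unit, simplified]
  show "e \<longlonglongrightarrow> cheat_value \<Lambda> n v C \<tau> c" "0 \<le> cheat_value \<Lambda> n v C \<tau> c" "cheat_value \<Lambda> n v C \<tau> c \<le> 1"
    "e k \<le> cheat_value \<Lambda> n v C \<tau> c"
    unfolding val e_def by (rule m)+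
qed

lemma elected_utility: "(if elected n a os then 1 else 0) = utility n a One os"
  by (auto simp: elected_def utility_def)

lemma election_prob_limit:
  fixes c \<Lambda> a
  assumes "a < length (net c)"
  shows "(\<lambda>k. measure_pmf.prob (honest_run \<Lambda> c k) {c'. elected (length (net c)) a (out c')})
     \<longlonglongrightarrow> election_prob \<Lambda> c a"
proof -
  have "utility (length (net c)) a One (out x) \<le> utility (length (net c)) a One (out y)"
    if "y \<in> set_pmf (honest_round \<Lambda> x)" for x y
    using honest_round_advance[OF that] utility_advance[OF assms] by auto
  from monotone_process(2)[where p = "honest_run \<Lambda> c" and f = "honest_round \<Lambda>"
      and u = "\<lambda>c'. utility (length (net c)) a One (out c')", OF _ this utility_unit]
  show ?thesis
    by (simp add: election_prob_def expectation_indicator_pmf flip: elected_utility)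
qed

text \<open>With at most one neighbour \<open>x\<close>, removing \<open>x\<close> would cut
  \<open>v\<close> off from some third vertex. The split needs two ports, so that both halves keep
  an outside neighbour.\<close>

lemma two_vertex_connected_degree:
  assumes "two_vertex_connected G" "v < length G"
  shows "2 \<le> length (G ! v)"
proof (rule ccontr)
  assume "\<not> 2 \<le> length (G ! v)"
  then obtain w where w: "set (G ! v) \<subseteq> {w}" 
    by (cases "G ! v") (auto simp: Suc_le_eq)
  have tv: "bidirectional G" "3 \<le> length G" "connected_on G {..<length G}"
    "\<And>x. x < length G \<Longrightarrow> connected_on G ({..<length G} - {x})"
    using assms(1) by (auto simp: two_vertex_connected_def)
  \<comment> \<open>If \<open>v\<close> had no neighbour at all, any other vertex could serve as
    \<open>x\<close>.\<close>
  obtain x where x: "x < length G" "x \<noteq> v" "set (G ! v) \<subseteq> {x}"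
  proof (cases "w < length G \<and> w \<noteq> v")
    case False
    moreover have "set (G ! v) \<subseteq> {..<length G} - {v}"
      using tv(1) assms(2) by (auto simp: bidirectional_def)
    ultimately have "set (G ! v) = {}" using w by (auto simp: subset_singleton_iff)
    moreover obtain x where "x < length G" "x \<noteq> v" using tv(2) that
      by (metis One_nat_def less_le_trans numeral_3_eq_3 zero_less_Suc n_not_Suc_n Suc_less_eq)
    ultimately show ?thesis using that by auto
  qed (use w that in auto)
  have "card ({..<length G} - {v, x}) > 0" using tv(2) x assms(2) by (subst card_Diff_subset) auto
  then obtain y where y: "y < length G" "y \<noteq> v" "y \<noteq> x"
    by (metis card_gt_0_iff Diff_iff ex_in_conv insert_iff lessThan_iff)
  let ?S = "{..<length G} - {x}"
  have "(v, y) \<in> {(a, b). a \<in> ?S \<and> b \<in> ?S \<and> b \<in> set (G ! a)}\<^sup>*"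
    using tv(4)[OF x(1)] x y assms(2) unfolding connected_on_def by auto
  then show False
    using x(3) y(2) by (cases rule: converse_rtranclE) auto
qed

subsection \<open>The election algorithm\<close>

text \<open>Round 0 messages have the form \<open>[id, number]\<close>. On a silent or malformed
  greeting \<open>!\<close> yields an unspecified but fixed number, so a claim exists whatever a
  cheating neighbour sends.\<close>

definition claim_of :: "view \<Rightarrow> claim" where
  "claim_of h = (let (s, ms) = hd (my_history h) in
     (my_id h, map (\<lambda>p. (ms ! p ! 0, sent s ! p ! 1, ms ! p ! 1)) [0..<my_degree h]))"

text \<open>A whole list of claims travels as one number by countability; messages of any other
  length count as no claims.\<close>

definition decode :: "msg \<Rightarrow> claim list" where
  "decode m = (case m of [x] \<Rightarrow> from_nat x | _ \<Rightarrow> [])"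

text \<open>Round \<open>0\<close> is left to the exchange of numbers, and nothing that arrives after round \<open>N\<close> is taken into
  account.\<close>

definition known :: "nat \<Rightarrow> view \<Rightarrow> claim list" where
  "known N h = claim_of h #
     concat (map (\<lambda>(s, ms). concat (map decode ms)) (tl (take (Suc N) (my_history h))))"

definition verdict :: "nat \<Rightarrow> nat \<Rightarrow> view \<Rightarrow> outval" where
  "verdict n N h = (let K = set (known N h) in
     if coherent n K then (if winner n (links K) = my_id h then One else Zero) else Abort)"

definition greeting :: "nat \<Rightarrow> nat list \<Rightarrow> step" where
  "greeting i xs = \<lparr>sent = map (\<lambda>x. [i, x]) xs, decision = None\<rparr>"

definition draws :: "nat \<Rightarrow> nat \<Rightarrow> nat list set" where
  "draws n k = {xs. set xs \<subseteq> {..<n} \<and> length xs = k}"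

text \<open>The decision is repeated in all rounds after \<open>N\<close>. This is harmless, as only
  the first output counts and \<open>known\<close> ignores later arrivals.\<close>

definition elect :: "nat \<Rightarrow> nat \<Rightarrow> algorithm" where
  "elect n N h = (let t = length (my_history h) in
     if t = 0 then map_pmf (greeting (my_id h)) (pmf_of_set (draws n (my_degree h)))
     else if t \<le> N then return_pmf \<lparr>sent = replicate (my_degree h) [to_nat (known N h)], decision = None\<rparr>
     else return_pmf \<lparr>sent = [], decision = Some (verdict n N h)\<rparr>)"

definition claim_at :: "config \<Rightarrow> nat \<Rightarrow> claim" where
  "claim_at c u = claim_of (local_view c u)"

text \<open>The outcome is good for agent \<open>v\<close> with preference \<open>p\<close> according to the claims of the others.\<close>

definition fate :: "nat \<Rightarrow> nat \<Rightarrow> outval \<Rightarrow> config \<Rightarrow> bool" where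
  "fate n v p c \<longleftrightarrow> (let A = {..<n} - {v}; H = claim_at c ` A in
     admissible n H \<and> (winner n (sym_links H) \<in> ident c ` A \<longleftrightarrow> p = Zero))"

lemma legal_unique:
  assumes "legal n os" "os u = Some One" "os v = Some One" "u < n" "v < n"
  shows "u = v"
proof -
  obtain a where a: "\<And>b. b < n \<Longrightarrow> b \<noteq> a \<Longrightarrow> os b = Some Zero" using assms(1) by (auto simp: legal_def)
  show ?thesis using a[of u] a[of v] assms by (cases "u = a"; cases "v = a") auto
qed

lemma finite_draws: "finite (draws n k)"
  unfolding draws_def using finite_lists_length_eq[of "{..<n}" k] by simp

lemma draws_nonempty: "0 < n \<Longrightarrow> draws n k \<noteq> {}"
proof -
  assume "0 < n"
  then have "replicate k 0 \<in> draws n k" by (auto simp: draws_def)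
  then show ?thesis by blast
qed

lemma port_correct:
  assumes "u \<in> set (G ! v)"
  shows "port G v u < length (G ! v)" "G ! v ! port G v u = u"
proof -
  obtain p where "p < length (G ! v) \<and> G ! v ! p = u" using assms by (auto simp: in_set_conv_nth)
  from LeastI[of "\<lambda>p. p < length (G ! v) \<and> G ! v ! p = u", OF this]
  show "port G v u < length (G ! v)" "G ! v ! port G v u = u" by (auto simp: port_def)
qed

lemma length_received [simp]: "length (received G s v) = length (G ! v)"
  by (simp add: received_def)

lemma received_nth:
  assumes "p < length (G ! v)" "port G (G ! v ! p) v < length (sent (s (G ! v ! p)))"
  shows "received G s v ! p = sent (s (G ! v ! p)) ! port G (G ! v ! p) v"
  using assms by (simp add: received_def)

lemma local_view_simps [simp]:
  "my_id (local_view c v) = ident c v" "my_degree (local_view c v) = length (net c ! v)"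
  "my_history (local_view c v) = hist c v" "my_pref (local_view c v) = pref c v"
  by (auto simp: local_view_def)

lemma claim_at_advance:
  "u < length (net c) \<Longrightarrow> hist c u \<noteq> [] \<Longrightarrow> claim_at (advance c s ds) u = claim_at c u"
  by (simp add: claim_at_def claim_of_def)

lemma known_first:
  "length (hist c u) = 1 \<Longrightarrow> known N (local_view c u) = [claim_at c u]"
  by (cases "hist c u") (auto simp: known_def claim_at_def)

lemma claim_at_known: "claim_at c u \<in> set (known N (local_view c u))"
  by (simp add: known_def claim_at_def)

lemma known_advance:
  assumes "u < length (net c)" "hist c u \<noteq> []"
  shows "known N (local_view (advance c s ds) u) = known N (local_view c u) @
     (if length (hist c u) \<le> N then concat (map decode (received (net c) s u)) else [])"
  using assms claim_at_advance[OF assms] by (cases "hist c u") (auto simp: known_def claim_at_def)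

lemma verdict_advance:
  assumes "u < length (net c)" "N < length (hist c u)"
  shows "verdict n N (local_view (advance c s ds) u) = verdict n N (local_view c u)"
proof -
  have "hist c u \<noteq> []" using assms(2) by auto
  then show ?thesis using known_advance[OF assms(1)] assms(2) by (simp add: verdict_def Let_def)
qed

lemma fate_advance:
  assumes "n = length (net c)" "\<And>u. u < n \<Longrightarrow> hist c u \<noteq> []"
  shows "fate n v p (advance c s ds) \<longleftrightarrow> fate n v p c"
proof -
  have "claim_at (advance c s ds) ` ({..<n} - {v}) = claim_at c ` ({..<n} - {v})"
    using claim_at_advance assms by (intro image_cong) auto
  then show ?thesis by (simp add: fate_def)
qed

lemma elect_first:
  assumes "hist c u = []" "s \<in> set_pmf (elect n N (local_view c u))" "0 < n"
  obtains xs where "xs \<in> draws n (length (net c ! u))" "s = greeting (ident c u) xs"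
proof -
  have "s \<in> greeting (ident c u) ` draws n (length (net c ! u))"
    using assms(1,2) finite_draws draws_nonempty[OF assms(3)] by (simp add: elect_def)
  then show thesis by (elim imageE) (rule that)
qed

lemma elect_flood:
  assumes "hist c u \<noteq> []" "length (hist c u) \<le> N" "s \<in> set_pmf (elect n N (local_view c u))"
  shows "s = \<lparr>sent = replicate (length (net c ! u)) [to_nat (known N (local_view c u))], decision = None\<rparr>"
proof -
  have "elect n N (local_view c u) =
      return_pmf \<lparr>sent = replicate (length (net c ! u)) [to_nat (known N (local_view c u))], decision = None\<rparr>"
    using assms(1,2) by (simp add: elect_def)
  then show ?thesis using assms(3) by (simp only: set_return_pmf singleton_iff)
qed

lemma elect_last:
  assumes "N < length (hist c u)" "s \<in> set_pmf (elect n N (local_view c u))"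
  shows "s = \<lparr>sent = [], decision = Some (verdict n N (local_view c u))\<rparr>"
proof -
  have "hist c u \<noteq> []" using assms(1) by auto
  then have "elect n N (local_view c u) =
      return_pmf \<lparr>sent = [], decision = Some (verdict n N (local_view c u))\<rparr>"
    using assms(1) by (simp add: elect_def)
  then show ?thesis using assms(2) by (simp only: set_return_pmf singleton_iff)
qed

lemma elect_decision_None:
  assumes "length (hist c u) \<le> N" "s \<in> set_pmf (elect n N (local_view c u))" "0 < n"
  shows "decision s = None"
proof (cases "hist c u = []")
  case True
  show ?thesis by (rule elect_first[OF True assms(2,3)]) (simp add: greeting_def)
next
  case False
  from elect_flood[OF this assms(1,2)] show ?thesis by simp
qed

section \<open>Flooding and verdicts on one fixed network\<close>

locale election =
  fixes n N :: nat and G :: network and ids :: "nat \<Rightarrow> nat" and prefs :: "nat \<Rightarrow> outval"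
  assumes conn: "two_vertex_connected G" and len: "length G = n" and inj: "inj_on ids {..<n}"
    and N: "n * n \<le> N" \<comment> \<open>bounds the length of paths by the number of edges\<close>
begin

definition c0 :: config where "c0 = init_config G ids prefs"

lemma bidir: "bidirectional G"
  using conn by (simp add: two_vertex_connected_def)

lemma n3: "3 \<le> n"
  using conn len by (simp add: two_vertex_connected_def)

lemma nbr: "v < n \<Longrightarrow> u \<in> set (G ! v) \<Longrightarrow> u < n \<and> u \<noteq> v \<and> v \<in> set (G ! u)"
  using bidir len unfolding bidirectional_def by auto

lemma distinct_nbrs: "v < n \<Longrightarrow> distinct (G ! v)"
  using bidir len unfolding bidirectional_def by auto

lemma port_nth:
  assumes "v < n" "p < length (G ! v)"
  shows "port G v (G ! v ! p) = p"
proof -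
  have "G ! v ! p \<in> set (G ! v)" using assms by simp
  from port_correct[OF this] show ?thesis
    using nth_eq_iff_index_eq[OF distinct_nbrs] assms by blast
qed

lemma reach_static:
  assumes "reach \<Lambda> A c0 t c"
  shows "net c = G" "ident c = ids" "pref c = prefs" "u < n \<Longrightarrow> length (hist c u) = t"
  using assms by (induction rule: reach.induct) (auto simp: c0_def len)

lemma reach_hist: "reach \<Lambda> A c0 t c \<Longrightarrow> 0 < t \<Longrightarrow> u < n \<Longrightarrow> hist c u \<noteq> []"
  using reach_static(4)[of \<Lambda> A t c u] by auto

definition edges :: "nat set \<Rightarrow> (nat \<times> nat) set" where
  "edges A = {(x, y). x \<in> A \<and> y \<in> A \<and> y \<in> set (G ! x)}"

lemma flood_step:
  assumes r: "reach (elect n N) A c0 t c" and A: "A \<subseteq> {..<n}" and t: "0 < t" "t \<le> N"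
    and s: "\<And>u. u \<in> A \<Longrightarrow> s u \<in> set_pmf (elect n N (local_view c u))"
    and u: "u < n" "p < length (G ! u)" "G ! u ! p \<in> A"
  shows "decode (received G s u ! p) = known N (local_view c (G ! u ! p))"
proof -
  let ?w = "G ! u ! p"
  have w: "?w < n" "u \<in> set (G ! ?w)" using u nbr[OF u(1) nth_mem[OF u(2)]] by auto
  have "s ?w = \<lparr>sent = replicate (length (G ! ?w)) [to_nat (known N (local_view c ?w))], decision = None\<rparr>"
    using elect_flood[of c ?w, OF _ _ s] reach_static[OF r] reach_hist[OF r] t u w by auto
  then show ?thesis
    using port_correct(1)[OF w(2)] by (subst received_nth) (auto simp: u decode_def)
qed

text \<open>A claim moves one hop per round along agents of \<open>A\<close>. Since round 0 is spent
  on the numbers, distance \<open>d\<close> is covered once \<open>d + 1\<close> rounds are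
  complete. What is known stays known, so only the last hop \<open>d = t\<close> needs an
  argument.\<close>

lemma flood:
  assumes "reach (elect n N) A c0 t c" "A \<subseteq> {..<n}" "d < t" "d \<le> N" "x \<in> A" "(x, u) \<in> edges A ^^ d"
  shows "claim_at c x \<in> set (known N (local_view c u))"
  using assms
proof (induction arbitrary: d u rule: reach.induct)
  case (reach_step t c s ds)
  have "u \<in> A" using \<open>x \<in> A\<close> \<open>(x, u) \<in> edges A ^^ d\<close> by (cases d) (auto simp: edges_def)
  then have un: "u < n" "x < n" using reach_step.prems by auto
  note st = reach_static[OF reach_step.hyps(1)]
  show ?case
  proof (cases "t = 0")
    case True
    then have "x = u" using reach_step.prems by simp
    then show ?thesis by (simp add: claim_at_known)
  next
    case t: False
    then have h: "hist c w \<noteq> []" if "w < n" for w using reach_hist[OF reach_step.hyps(1)] that by simp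
    have claim_at: "claim_at (advance c s ds) x = claim_at c x" using un h st len by (simp add: claim_at_advance)
    note kn = known_advance[of u c N s ds, OF _ h[OF un(1)], unfolded st(1), unfolded len, OF un(1)]
    show ?thesis
    proof (cases "d < t")
      case True
      then have "claim_at c x \<in> set (known N (local_view c u))" using reach_step by auto
      then show ?thesis by (simp add: claim_at kn)
    next
      case False
      then have d: "d = t" "t \<le> N" using reach_step.prems by auto
      then obtain d' where d': "d = Suc d'" using t by (cases d) auto
      then obtain w where w: "(x, w) \<in> edges A ^^ d'" "(w, u) \<in> edges A"
        using reach_step.prems by auto
      have IH: "claim_at c x \<in> set (known N (local_view c w))"
        by (rule reach_step.IH) (use reach_step.prems w d d' in auto)
      have "w \<in> set (G ! u)" "w \<in> A" using w(2) nbr[of w u] reach_step.prems(1) by (auto simp: edges_def)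
      then obtain p where p: "p < length (G ! u)" "G ! u ! p = w" by (auto simp: in_set_conv_nth)
      have "decode (received G s u ! p) = known N (local_view c w)"
        using flood_step[OF reach_step.hyps(1) reach_step.prems(1) _ _ reach_step.hyps(2) un(1) p(1)] p \<open>w \<in> A\<close> t d
        by auto
      then have "claim_at c x \<in> set (concat (map decode (received G s u)))"
      proof -
        have "received G s u ! p \<in> set (received G s u)" by (rule nth_mem) (simp add: p)
        then show ?thesis
          using IH \<open>decode (received G s u ! p) = known N (local_view c w)\<close> by force
      qed
      then show ?thesis using st un d by (simp add: claim_at kn)
    qed
  qed
qed simp

lemma card_edges: "A \<subseteq> {..<n} \<Longrightarrow> card (edges A) \<le> N"
proof -
  assume "A \<subseteq> {..<n}"
  then have "edges A \<subseteq> {..<n} \<times> {..<n}" by (auto simp: edges_def)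
  from card_mono[OF _ this] show ?thesis using N by (simp add: card_cartesian_product)
qed

text \<open>A path needs at most as many steps as there are edges, that is at most
  \<open>n * n \<le> N\<close>. With \<open>A\<close> all agents but the cheater, the connectivity
  hypothesis is 2-vertex-connectivity: no relay is under the cheater's control.\<close>

lemma flood_complete:
  assumes "reach (elect n N) A c0 t c" "A \<subseteq> {..<n}" "N < t" "connected_on G A" "u \<in> A"
  shows "claim_at c ` A \<subseteq> set (known N (local_view c u))"
proof (rule image_subsetI)
  fix x assume x: "x \<in> A"
  have "edges A \<subseteq> {..<n} \<times> {..<n}" using assms(2) by (auto simp: edges_def)
  then have fin: "finite (edges A)" by (rule finite_subset) auto
  have "(x, u) \<in> (edges A)\<^sup>*" using assms x unfolding connected_on_def edges_def by auto
  then obtain d where d: "d \<le> card (edges A)" "(x, u) \<in> edges A ^^ d"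
    using rtrancl_finite_eq_relpow[OF fin] by auto
  show "claim_at c x \<in> set (known N (local_view c u))"
    by (rule flood[OF assms(1,2) _ _ x d(2)]) (use d card_edges[OF assms(2)] assms(3) in auto)
qed

text \<open>Converse to \<open>flood_complete\<close>: without a cheater no invented claims
  circulate, so in the end all agents judge the same set.\<close>

lemma known_honest:
  assumes "reach (elect n N) {..<n} c0 t c" "0 < t" "u < n"
  shows "set (known N (local_view c u)) \<subseteq> claim_at c ` {..<n}"
  using assms
proof (induction arbitrary: u rule: reach.induct)
  case (reach_step t c s ds)
  note st = reach_static[OF reach_step.hyps(1)]
  show ?case
  proof (cases "t = 0")
    case True
    have "length (hist (advance c s ds) u) = 1"
      using True st(1) st(4)[of u] reach_step.prems len by simp
    then show ?thesis using reach_step.prems by (simp add: known_first)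
  next
    case False
    then have h: "hist c w \<noteq> []" if "w < n" for w using reach_hist[OF reach_step.hyps(1)] that by simp
    have claim_at: "claim_at (advance c s ds) ` {..<n} = claim_at c ` {..<n}"
      by (intro image_cong) (use h st len in \<open>auto simp: claim_at_advance\<close>)
    have IH: "set (known N (local_view c w)) \<subseteq> claim_at c ` {..<n}" if "w < n" for w
      using reach_step.IH that False by simp
    have "set (decode m) \<subseteq> claim_at c ` {..<n}" if m: "t \<le> N" "m \<in> set (received G s u)" for m
    proof -
      obtain p where p: "p < length (G ! u)" "m = received G s u ! p"
        using m(2) by (auto simp: in_set_conv_nth)
      have w: "G ! u ! p < n" using nbr[OF \<open>u < n\<close> nth_mem[OF p(1)]] by simp
      have "decode m = known N (local_view c (G ! u ! p))"
        unfolding p(2)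
        by (rule flood_step[OF reach_step.hyps(1) subset_refl _ m(1) reach_step.hyps(2) \<open>u < n\<close> p(1)])
          (use w False in auto)
      then show ?thesis using IH[OF w] by simp
    qed
    then have "set (concat (map decode (received G s u))) \<subseteq> claim_at c ` {..<n}" if "t \<le> N"
      unfolding set_concat using that by auto
    then show ?thesis
      unfolding known_advance[of u c N s ds, unfolded st(1) len, OF \<open>u < n\<close> h[OF \<open>u < n\<close>]] st(4)[OF \<open>u < n\<close>] claim_at
      using IH[OF \<open>u < n\<close>] by (auto simp del: set_concat)
  qed
qed simp

text \<open>\<open>t\<close> counts completed rounds. The decision falls in round
  \<open>N + 1\<close>, at a history of length \<open>N + 1\<close>, and is visible from
  \<open>t = N + 2\<close> on; afterwards the verdict no longer changes.\<close>

lemma reach_out: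
  assumes "reach (elect n N) A c0 t c" "A \<subseteq> {..<n}" "u \<in> A"
  shows "out c u = (if t \<le> Suc N then None else Some (verdict n N (local_view c u)))"
  using assms
proof (induction rule: reach.induct)
  case (reach_step t c s ds)
  note st = reach_static[OF reach_step.hyps(1)]
  have u: "u < n" using reach_step.prems by auto
  have s: "s u \<in> set_pmf (elect n N (local_view c u))" "ds u = decision (s u)"
    using reach_step by auto
  consider "t \<le> N" | "t = Suc N" | "Suc N < t" by linarith
  then show ?case
  proof cases
    case 1
    then show ?thesis using elect_decision_None[OF _ s(1)] st(4)[OF u] n3 reach_step s(2) by simp
  next
    case 2
    then show ?thesis
      using elect_last[OF _ s(1)] st(1) st(4)[OF u] reach_step s(2) verdict_advance[of u c N n s ds] u len
      by simp
  next
    case 3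
    then show ?thesis
      using st(1) st(4)[OF u] reach_step verdict_advance[of u c N n s ds] u len
      by simp
  qed
qed (simp add: c0_def)

lemma fst_claim_at: "reach \<Lambda> A c0 t c \<Longrightarrow> fst (claim_at c u) = ids u"
  using reach_static(2)[of \<Lambda> A t c] by (simp add: claim_at_def claim_of_def split: prod.split)

lemma card_claims:
  assumes "reach \<Lambda> A c0 t c" "B \<subseteq> {..<n}"
  shows "card (claim_at c ` B) = card B" "fst ` claim_at c ` B = ids ` B"
proof -
  show ids: "fst ` claim_at c ` B = ids ` B" using fst_claim_at[OF assms(1)] by (auto simp: image_iff)
  have "inj_on (claim_at c) B"
    using fst_claim_at[OF assms(1)] inj assms(2) unfolding inj_on_def by (metis subset_iff)
  then show "card (claim_at c ` B) = card B" by (rule card_image)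
qed

text \<open>A legal outcome requires a verdict other than \<open>Abort\<close> from each of the
  others, and all these verdicts name the same winner, computed from the claims of the others. A
  cheater can therefore spoil an outcome but not turn an unfavourable one into a favourable
  one.\<close>

lemma utility_le_fate:
  assumes r: "reach (elect n N) ({..<n} - {v}) c0 t c" and v: "v < n" and p: "p \<noteq> Abort"
  shows "utility n v p (out c) \<le> (if fate n v p c then 1 else 0)"
proof (cases "legal n (out c) \<and> out c v = Some p")
  case True
  define A where "A = {..<n} - {v}"
  have A: "A \<subseteq> {..<n}" "card A = n - 1" using v by (auto simp: A_def)
  note r = r[folded A_def]
  define H where "H = claim_at c ` A"
  define T where "T = sym_links H"
  have con: "connected_on G A" using conn v len by (simp add: two_vertex_connected_def A_def)
  have cardH: "card H = n - 1" "fst ` H = ids ` A" using card_claims[OF r A(1)] A by (auto simp: H_def)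
  have legal: "legal n (out c)" using True by simp
  \<comment> \<open>Any second agent: its output shows that the flooding is over, and its set of
    claims is a coherent one containing \<open>H\<close>.\<close>
  obtain u0 where u0: "u0 \<in> A" using A n3 by fastforce
  have "out c u0 \<noteq> None" using legal_outputs[OF legal] u0 A by auto
  then have t: "Suc N < t" using reach_out[OF r A(1) u0] by (auto split: if_splits)
  have out: "out c u = Some (if winner n T = ids u then One else Zero) \<and> coherent n (set (known N (local_view c u)))
      \<and> H \<subseteq> set (known N (local_view c u))" if u: "u \<in> A" for u
  proof -
    let ?K = "set (known N (local_view c u))"
    have o: "out c u = Some (verdict n N (local_view c u))" using reach_out[OF r A(1) u] t by simp
    moreover have "out c u \<noteq> Some Abort" using legal u A by (auto simp: legal_def)
    ultimately have "coherent n ?K" by (auto simp: verdict_def Let_def split: if_splits)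
    moreover have "H \<subseteq> ?K" unfolding H_def using flood_complete[OF r A(1) _ con u] t by simp
    \<comment> \<open>The cheater may have shown different claims to different agents, yet every
      coherent set has the same links.\<close>
    moreover have "links ?K = T" unfolding T_def
      by (rule links_coherent) (use calculation n3 cardH in auto)
    ultimately show ?thesis using o reach_static[OF r] by (simp add: verdict_def)
  qed
  let ?K = "set (known N (local_view c u0))"
  have "admissible n H"
    using admissible_coherent[of n ?K H] out[OF u0] n3 cardH by auto
  moreover have "winner n T \<in> ids ` A \<longleftrightarrow> p = Zero"
  proof (cases p)
    case One
    have "winner n T \<noteq> ids u" if "u \<in> A" for u
    proof
      assume "winner n T = ids u"
      then have "out c u = Some One" using out[OF that] by simp
      then show False using legal_unique[OF legal, of u v] True One that v by (auto simp: A_def)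
    qed
    then show ?thesis using One by auto
  next
    case Zero
    obtain a where a: "a < n" "out c a = Some One" using legal by (auto simp: legal_def)
    then have "a \<in> A" using True Zero by (auto simp: A_def)
    then have "winner n T = ids a" using out[OF \<open>a \<in> A\<close>] a by (auto split: if_splits)
    then show ?thesis using Zero \<open>a \<in> A\<close> by auto
  qed (use p in simp)
  ultimately have "fate n v p c"
    using reach_static(2)[OF r] by (simp add: fate_def H_def A_def T_def)
  then show ?thesis by (simp add: utility_unit)
qed (auto simp: utility_def)

end

subsection \<open>The first round\<close>

lemma map_Pi_pmf_upd:
  assumes "finite A" "a \<in> A" "map_pmf f (P a) = P a"
  shows "map_pmf (\<lambda>h. h(a := f (h a))) (Pi_pmf A d P) = Pi_pmf A d P"
proof -
  let ?B = "A - {a}"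
  have A: "A = insert a ?B" using assms(2) by auto
  have P: "Pi_pmf A d P = map_pmf (\<lambda>(y, g). g(a := y)) (pair_pmf (P a) (Pi_pmf ?B d P))"
    by (subst A, rule Pi_pmf_insert) (use assms in auto)
  have "map_pmf (\<lambda>h. h(a := f (h a))) (Pi_pmf A d P) =
      map_pmf (\<lambda>(y, g). g(a := y)) (map_pmf (apfst f) (pair_pmf (P a) (Pi_pmf ?B d P)))"
    unfolding P pmf.map_comp by (intro map_pmf_cong) (auto simp: fun_eq_iff)
  also have "map_pmf (apfst f) (pair_pmf (P a) (Pi_pmf ?B d P)) = pair_pmf (P a) (Pi_pmf ?B d P)"
    unfolding pair_map_pmf1[symmetric] by (simp add: assms(3))
  also have "map_pmf (\<lambda>(y, g). g(a := y)) (pair_pmf (P a) (Pi_pmf ?B d P)) = Pi_pmf A d P"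
    by (rule P[symmetric])
  finally show ?thesis .
qed

lemma bij_betw_rotate_draw:
  assumes "0 < n"
  shows "bij_betw (\<lambda>xs. xs[p := Suc (xs ! p) mod n]) (draws n k) (draws n k)"
proof -
  let ?f = "\<lambda>xs. xs[p := Suc (xs ! p) mod n]"
  have into: "?f ` draws n k \<subseteq> draws n k"
    using assms by (auto simp: draws_def dest: set_update_subset_insert[THEN subsetD])
  have "inj_on ?f (draws n k)"
  proof (rule inj_onI)
    fix xs ys assume xs: "xs \<in> draws n k" and ys: "ys \<in> draws n k" and eq: "?f xs = ?f ys"
    have len: "length xs = k" "length ys = k" using xs ys by (auto simp: draws_def)
    show "xs = ys"
    proof (rule nth_equalityI)
      fix i assume i: "i < length xs"
      show "xs ! i = ys ! i"
      proof (cases "i = p")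
        case True
        have "xs ! i < n" "ys ! i < n"
          using xs ys i len by (auto simp: draws_def subset_iff)
        moreover have "Suc (xs ! i) mod n = Suc (ys ! i) mod n"
          using arg_cong[OF eq, of "\<lambda>zs. zs ! i"] i len True by simp
        ultimately show ?thesis by (auto simp: mod_Suc split: if_splits)
      next
        case False
        then show ?thesis using arg_cong[OF eq, of "\<lambda>zs. zs ! i"] by simp
      qed
    qed (simp add: len)
  qed
  then show ?thesis using endo_inj_surj[OF finite_draws into] by (auto simp: bij_betw_def)
qed

context election
begin

definition drawn :: "(nat \<Rightarrow> step) \<Rightarrow> nat \<Rightarrow> nat \<Rightarrow> nat" where
  "drawn s u p = sent (s u) ! p ! 1"

text \<open>The claim as a function of the first steps alone, which moves all questions about
  \<open>fate\<close> to the product distribution of round 0.\<close>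

definition first_claim :: "(nat \<Rightarrow> step) \<Rightarrow> nat \<Rightarrow> claim" where
  "first_claim s u = (ids u, map (\<lambda>p. (received G s u ! p ! 0, drawn s u p, received G s u ! p ! 1))
     [0..<length (G ! u)])"

definition greets :: "(nat \<Rightarrow> step) \<Rightarrow> nat \<Rightarrow> bool" where
  "greets s u \<longleftrightarrow> (\<exists>xs \<in> draws n (length (G ! u)). s u = greeting (ids u) xs)"

lemma c0_simps [simp]:
  "net c0 = G" "ident c0 = ids" "pref c0 = prefs" "hist c0 u = []"
  by (simp_all add: c0_def)

lemma greets_elect: "s u \<in> set_pmf (elect n N (local_view c0 u)) \<longleftrightarrow> greets s u"
proof -
  have "draws n (length (G ! u)) \<noteq> {}" using n3 by (intro draws_nonempty) simp
  then show ?thesis by (auto simp: greets_def elect_def finite_draws)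
qed

lemma claim_at_first: "u < n \<Longrightarrow> claim_at (advance c0 s ds) u = first_claim s u"
  by (simp add: claim_at_def claim_of_def first_claim_def drawn_def len)

text \<open>Claims are read off round 0 and never change. The witness \<open>s\<close> is the joint
  first step; outside \<open>A\<close> it is arbitrary.\<close>

lemma reach_first:
  assumes "reach (elect n N) A c0 t c" "0 < t"
  obtains s where "\<And>u. u \<in> A \<Longrightarrow> greets s u" "\<And>u. u < n \<Longrightarrow> claim_at c u = first_claim s u"
proof -
  have "\<exists>s. (\<forall>u \<in> A. greets s u) \<and> (\<forall>u<n. claim_at c u = first_claim s u)"
    using assms
  proof (induction rule: reach.induct)
    case (reach_step t c s ds)
    show ?case
    proof (cases "t = 0")
      case True
      then have "c = c0" using reach_step.hyps(1) by (auto elim: reach.cases)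
      then show ?thesis using reach_step.hyps(2) claim_at_first by (auto simp: greets_elect)
    next
      case False
      then have "claim_at (advance c s ds) u = claim_at c u" if "u < n" for u
        using claim_at_advance[of u c s ds] reach_static(1)[OF reach_step.hyps(1)]
          reach_hist[OF reach_step.hyps(1) _ that] that len by simp
      then show ?thesis using reach_step.IH False by auto
    qed
  qed simp
  then show thesis using that by blast
qed

lemma greets_sent:
  assumes "greets s u" "p < length (G ! u)"
  shows "length (sent (s u)) = length (G ! u)" "sent (s u) ! p = [ids u, drawn s u p]"
  using assms by (auto simp: greets_def greeting_def draws_def drawn_def)

lemma received_greets:
  assumes "u < n" "p < length (G ! u)" "greets s (G ! u ! p)"
  shows "received G s u ! p = [ids (G ! u ! p), drawn s (G ! u ! p) (port G (G ! u ! p) u)]"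
proof -
  have "u \<in> set (G ! (G ! u ! p))" using nbr[OF assms(1) nth_mem[OF assms(2)]] by simp
  note q = port_correct(1)[OF this]
  show ?thesis
    using greets_sent[OF assms(3) q] q assms(2) by (subst received_nth) auto
qed

lemma first_claim_honest:
  assumes "\<And>u. u < n \<Longrightarrow> greets s u" "u < n"
  shows "first_claim s u =
    (ids u, map (\<lambda>w. (ids w, drawn s u (port G u w), drawn s w (port G w u))) (G ! u))"
  unfolding first_claim_def
  using assms received_greets[OF assms(2)] port_nth[OF assms(2)] nbr[OF assms(2) nth_mem]
  by (auto intro!: nth_equalityI)

lemma first_claim_coherent:
  assumes g: "\<And>u. u < n \<Longrightarrow> greets s u"
  shows "coherent n (first_claim s ` {..<n})" (is "coherent n ?K")
proof -
  note cl = first_claim_honest[OF g]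
  have links: "links ?K = {(ids u, ids w, drawn s u (port G u w), drawn s w (port G w u)) | u w.
      u < n \<and> w \<in> set (G ! u)}" (is "_ = ?L")
  proof
    show "links ?K \<subseteq> ?L" by (auto simp: links_def cl) blast
    show "?L \<subseteq> links ?K"
    proof clarify
      fix u w assume "u < n" "w \<in> set (G ! u)"
      then show "(ids u, ids w, drawn s u (port G u w), drawn s w (port G w u)) \<in> links ?K"
        unfolding links_def using cl[of u]
        by (auto intro!: exI[of _ "map (\<lambda>w. (ids w, drawn s u (port G u w), drawn s w (port G w u))) (G ! u)"]
            rev_image_eqI[of u])
    qed
  qed
  have "fst ` links ?K = ids ` {..<n}"
  proof
    show "fst ` links ?K \<subseteq> ids ` {..<n}" by (auto simp: links)
    show "ids ` {..<n} \<subseteq> fst ` links ?K"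
    proof (rule image_subsetI)
      \<comment> \<open>A neighbour exists by the degree bound, so every id occurs as the end of a
        link.\<close>
      fix u assume u: "u \<in> {..<n}"
      then obtain w where "w \<in> set (G ! u)"
        using two_vertex_connected_degree[OF conn, of u] len by (cases "G ! u") auto
      then have "(ids u, ids w, drawn s u (port G u w), drawn s w (port G w u)) \<in> links ?K"
        using u by (auto simp: links)
      then show "ids u \<in> fst ` links ?K" by (rule rev_image_eqI) simp
    qed
  qed
  then have c1: "card (fst ` links ?K) = n" using card_image[OF inj] by simp
  have "inj_on (first_claim s) {..<n}"
    using inj by (auto simp: inj_on_def first_claim_def)
  then have c2: "card ?K = n" using card_image by fastforce
  have "(b, a, y, x) \<in> links ?K \<and> a \<noteq> b" if mem: "(a, b, x, y) \<in> links ?K" for a b x y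
  proof -
    obtain u w where u: "u < n" "w \<in> set (G ! u)" and t: "a = ids u" "b = ids w"
      "x = drawn s u (port G u w)" "y = drawn s w (port G w u)"
      using mem unfolding links by blast
    have w: "w < n" "w \<noteq> u" "u \<in> set (G ! w)" using nbr[OF u] by auto
    have "(b, a, y, x) \<in> links ?K" unfolding links t using w by blast
    moreover have "a \<noteq> b" using inj u(1) w by (auto simp: t inj_on_def)
    ultimately show ?thesis by simp
  qed
  moreover have "distinct (map fst L)" if aL: "(a, L) \<in> ?K" for a L
  proof -
    obtain u where u: "u < n" "L = map (\<lambda>w. (ids w, drawn s u (port G u w), drawn s w (port G w u))) (G ! u)"
      using aL by (auto simp: cl)
    have "set (G ! u) \<subseteq> {..<n}" using nbr[OF u(1)] by auto
    then have "inj_on ids (set (G ! u))" by (rule inj_on_subset[OF inj])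
    then show ?thesis using distinct_nbrs[OF u(1)] by (simp add: u(2) distinct_map comp_def)
  qed
  ultimately show ?thesis unfolding coherent_def using c1 c2 by blast
qed

lemma honest_fate:
  assumes r: "reach (elect n N) {..<n} c0 t c" "0 < t"
  defines "K \<equiv> claim_at c ` {..<n}"
  shows "coherent n K" "winner n (links K) \<in> ids ` {..<n}"
    and "v < n \<Longrightarrow> fate n v p c \<longleftrightarrow> (winner n (links K) = ids v \<longleftrightarrow> p \<noteq> Zero)"
proof -
  obtain s where s: "\<And>u. u \<in> {..<n} \<Longrightarrow> greets s u" "\<And>u. u < n \<Longrightarrow> claim_at c u = first_claim s u"
    by (rule reach_first[OF r]) (rule that; assumption)
  have K: "K = first_claim s ` {..<n}" unfolding K_def using s(2) by (intro image_cong) auto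
  show coh: "coherent n K" unfolding K using s(1) by (intro first_claim_coherent) auto
  have ids: "fst ` K = ids ` {..<n}" unfolding K_def using card_claims(2)[OF r(1)] by simp
  have n0: "0 < n" using n3 by simp
  \<comment> \<open>An honest run is also a run with potential cheater \<open>v\<close>, for each
    \<open>v\<close>; hence the claims of the others already determine all links.\<close>
  have *: "admissible n (claim_at c ` ({..<n} - {v}))"
    "links K = sym_links (claim_at c ` ({..<n} - {v}))" "winner n (links K) \<in> ids ` {..<n}" if "v < n" for v
  proof -
    have H: "claim_at c ` ({..<n} - {v}) \<subseteq> K" "card (claim_at c ` ({..<n} - {v})) = n - 1"
      using card_claims(1)[OF r(1), of "{..<n} - {v}"] that by (auto simp: K_def)
    show eq: "links K = sym_links (claim_at c ` ({..<n} - {v}))" by (rule links_coherent[OF coh n0 H])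
    show "admissible n (claim_at c ` ({..<n} - {v}))" by (rule admissible_coherent(1)[OF coh n0 H])
    show "winner n (links K) \<in> ids ` {..<n}"
      using admissible_coherent(2)[OF coh n0 H] by (simp add: eq ids)
  qed
  show win: "winner n (links K) \<in> ids ` {..<n}" using *(3) n0 by blast
  assume v: "v < n"
  have "winner n (links K) \<in> ids ` ({..<n} - {v}) \<longleftrightarrow> winner n (links K) \<noteq> ids v"
    using win inj v by (auto simp: inj_on_def)
  then show "fate n v p c \<longleftrightarrow> (winner n (links K) = ids v \<longleftrightarrow> p \<noteq> Zero)"
    using *(1,2)[OF v] reach_static(2)[OF r(1)] by (auto simp: fate_def Let_def)
qed

text \<open>All claims have arrived and none is false, so every agent judges the same set
  \<open>K\<close> and the bound of \<open>utility_le_fate\<close> is attained.\<close>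

lemma honest_final:
  assumes r: "reach (elect n N) {..<n} c0 t c" and t: "Suc N < t"
  shows "legal n (out c)"
    and "v < n \<Longrightarrow> p \<noteq> Abort \<Longrightarrow> utility n v p (out c) = (if fate n v p c then 1 else 0)"
proof -
  define K where "K = claim_at c ` {..<n}"
  have t0: "0 < t" using t by simp
  note hf = honest_fate[OF r t0, folded K_def]
  have out: "out c u = Some (if winner n (links K) = ids u then One else Zero)" if u: "u < n" for u
  proof -
    have "connected_on G {..<n}" using conn len by (simp add: two_vertex_connected_def)
    then have "set (known N (local_view c u)) = K"
      using flood_complete[OF r, of u] known_honest[OF r t0 u] t u by (auto simp: K_def)
    then show ?thesis
      using reach_out[OF r, of u] u t hf(1) reach_static(2)[OF r] by (simp add: verdict_def)
  qed
  obtain a where a: "a < n" "winner n (links K) = ids a" using hf(2) by auto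
  have other: "winner n (links K) \<noteq> ids b" if "b < n" "b \<noteq> a" for b
    using inj a that by (auto simp: inj_on_def)
  show legal: "legal n (out c)"
    unfolding legal_def using a out other by (intro exI[of _ a]) auto
  show "utility n v p (out c) = (if fate n v p c then 1 else 0)" if "v < n" "p \<noteq> Abort"
    unfolding utility_def hf(3)[OF that(1)] using legal out[OF that(1)] that(2) by (cases p) auto
qed

text \<open>The number that \<open>a\<close> sends to \<open>b\<close> is visible in two claims
  only: as sent in that of \<open>a\<close> and as received in that of \<open>b\<close>. Third
  agents, a cheater among them, may act arbitrarily.\<close>

lemma first_claim_upd:
  assumes xs: "s a = greeting (ids a) xs" "xs \<in> draws n (length (G ! a))"
    and ab: "a < n" "b \<in> set (G ! a)" "greets s b"
    and s': "s' = s(a := greeting (ids a) (xs[port G a b := x']))"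
  defines "x \<equiv> xs ! port G a b" and "y \<equiv> drawn s b (port G b a)"
  defines "La \<equiv> snd (first_claim s a)" and "Lb \<equiv> snd (first_claim s b)"
  shows "port G a b < length La" "port G b a < length Lb"
    "La ! port G a b = (ids b, x, y)" "Lb ! port G b a = (ids a, y, x)"
    "first_claim s' a = (ids a, La[port G a b := (ids b, x', y)])"
    "first_claim s' b = (ids b, Lb[port G b a := (ids a, y, x')])"
    "\<And>c. c < n \<Longrightarrow> c \<noteq> a \<Longrightarrow> c \<noteq> b \<Longrightarrow> first_claim s' c = first_claim s c"
proof -
  let ?p = "port G a b" and ?q = "port G b a"
  have b: "b < n" "b \<noteq> a" "a \<in> set (G ! b)" using nbr[OF ab(1,2)] by auto
  have p: "?p < length (G ! a)" "G ! a ! ?p = b" using port_correct[OF ab(2)] by auto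
  have q: "?q < length (G ! b)" "G ! b ! ?q = a" using port_correct[OF b(3)] by auto
  have lxs: "length xs = length (G ! a)" using xs(2) by (simp add: draws_def)
  have ga: "greets s a" using xs by (auto simp: greets_def)
  have sent: "sent (s a) = map (\<lambda>x. [ids a, x]) xs" "sent (s' a) = map (\<lambda>x. [ids a, x]) (xs[?p := x'])"
    by (simp_all add: xs(1) s' greeting_def)
  have eq: "s' c = s c" if "c \<noteq> a" for c using that by (simp add: s')
  show len': "?p < length La" "?q < length Lb" using p q by (simp_all add: La_def Lb_def first_claim_def)
  have ra: "received G s a ! ?p = [ids b, y]"
    using received_greets[OF ab(1) p(1)] p ab(3) by (simp add: y_def)
  have rb: "received G s b ! ?q = [ids a, x]"
    using received_greets[OF b(1) q(1)] q p(1) ga lxs by (simp add: x_def drawn_def sent)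
  have da: "drawn s a ?p = x" using p lxs by (simp add: drawn_def sent x_def)
  show "La ! ?p = (ids b, x, y)" using p by (simp add: La_def first_claim_def ra da)
  show "Lb ! ?q = (ids a, y, x)" using q by (simp add: Lb_def first_claim_def rb y_def)
  have rec: "received G s' c ! i = (if c = b \<and> i = ?q then [ids a, x'] else received G s c ! i)"
    if "c < n" "i < length (G ! c)" for c i
  proof (cases "G ! c ! i = a")
    case True
    have j: "port G a c < length (G ! a)" "G ! a ! port G a c = c"
      using port_correct[of c G a] nbr[OF that(1) nth_mem[OF that(2)]] True by auto
    show ?thesis
    proof (cases "c = b")
      case True
      then have "i = ?q" using port_nth[OF that] \<open>G ! c ! i = a\<close> by simp
      then show ?thesis using True that p lxs \<open>G ! c ! i = a\<close> by (subst received_nth) (auto simp: sent)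
    next
      case False
      then have "port G a c \<noteq> ?p" using j p by auto
      then show ?thesis using False that True j lxs by (subst (1 2) received_nth) (auto simp: sent)
    qed
  next
    case False
    then have "\<not> (c = b \<and> i = ?q)" using q by auto
    then show ?thesis using that False by (auto simp: received_def eq)
  qed
  have dr: "drawn s' c i = (if c = a \<and> i = ?p then x' else drawn s c i)" if "i < length (G ! c)" for c i
  proof (cases "c = a")
    case True
    then show ?thesis using that lxs by (auto simp: drawn_def sent nth_list_update)
  qed (simp add: drawn_def eq)
  show "first_claim s' a = (ids a, La[?p := (ids b, x', y)])"
    using b ab(1) p by (auto simp: first_claim_def La_def rec dr ra nth_list_update intro!: nth_equalityI)
  show "first_claim s' b = (ids b, Lb[?q := (ids a, y, x')])"
    using b q by (auto simp: first_claim_def Lb_def rec dr y_def nth_list_update intro!: nth_equalityI)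
  show "first_claim s' c = first_claim s c" if "c < n" "c \<noteq> a" "c \<noteq> b" for c
    using that by (simp add: first_claim_def rec dr)
qed

text \<open>How many of the \<open>n\<close> residues lead to an outcome the agent likes.\<close>

definition seats :: "outval \<Rightarrow> nat" where
  "seats p = (if p = Zero then n - 1 else 1)"

definition first_fate :: "nat \<Rightarrow> outval \<Rightarrow> (nat \<Rightarrow> step) \<Rightarrow> bool" where
  "first_fate v p s \<longleftrightarrow> (let A = {..<n} - {v}; H = first_claim s ` A in
     admissible n H \<and> (winner n (sym_links H) \<in> ids ` A \<longleftrightarrow> p = Zero))"

lemma fate_first: "fate n v p (advance c0 s ds) \<longleftrightarrow> first_fate v p s"
proof -
  have "claim_at (advance c0 s ds) ` ({..<n} - {v}) = first_claim s ` ({..<n} - {v})"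
    by (intro image_cong) (auto simp: claim_at_first)
  then show ?thesis by (simp add: fate_def first_fate_def)
qed

text \<open>Supplies a link whose numbers the cheater does not see: at least two others remain, and
  they stay connected without \<open>v\<close>.\<close>

lemma ex_honest_edge:
  assumes "v < n"
  obtains a b where "a < n" "b < n" "a \<noteq> v" "b \<noteq> v" "b \<in> set (G ! a)"
proof -
  let ?A = "{..<n} - {v}"
  have "card ?A \<ge> 2" using assms n3 by simp
  then obtain a a' where a: "a \<in> ?A" "a' \<in> ?A" "a \<noteq> a'"
    by (metis card_le_Suc0_iff_eq finite_Diff finite_lessThan not_less_eq_eq numeral_2_eq_2)
  have "connected_on G ?A" using conn assms len by (simp add: two_vertex_connected_def)
  then have "(a, a') \<in> {(x, y). x \<in> ?A \<and> y \<in> ?A \<and> y \<in> set (G ! x)}\<^sup>*"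
    using a unfolding connected_on_def by blast
  then show thesis
  proof (cases rule: converse_rtranclE)
    case base
    then show ?thesis using a by simp
  next
    case (step y)
    then show ?thesis using that[of a y] by auto
  qed
qed

text \<open>The cheater's first step \<open>z\<close> is fixed independently of the number on some
  link between two others. Rotating that number preserves the distribution and shifts the total, so
  no \<open>z\<close> influences the residue, and exactly \<open>seats p\<close> residues are
  favourable.\<close>

lemma first_fate_prob:
  assumes v: "v < n"
  shows "measure_pmf.prob (Pi_pmf ({..<n} - {v}) idle (\<lambda>u. elect n N (local_view c0 u)))
     {h. first_fate v p (h(v := z))} \<le> real (seats p) / real n"
proof -
  define A where "A = {..<n} - {v}"
  define M where "M = Pi_pmf A idle (\<lambda>u. elect n N (local_view c0 u))"
  define H where "H h = first_claim (h(v := z)) ` A" for h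
  have A: "finite A" "card A = n - 1" "A \<subseteq> {..<n}" using v by (auto simp: A_def)
  obtain a b where ab: "a < n" "b < n" "a \<noteq> v" "b \<noteq> v" "b \<in> set (G ! a)"
    by (rule ex_honest_edge[OF v])
  have aA: "a \<in> A" and bA: "b \<in> A" using ab by (auto simp: A_def)
  have "a \<noteq> b" using nbr[OF ab(1,5)] by simp
  let ?p = "port G a b"
  \<comment> \<open>Increments the number that \<open>a\<close> puts on its link to
    \<open>b\<close>; on greetings it is the rotation of the drawn list.\<close>
  define rot where "rot st = st\<lparr>sent := (sent st)[?p := [ids a, Suc (sent st ! ?p ! 1) mod n]]\<rparr>" for st :: step
  define \<phi> where "\<phi> h = h(a := rot (h a))" for h :: "nat \<Rightarrow> step"
  have p: "?p < length (G ! a)" using port_correct[OF ab(5)] by simp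
  have n0: "0 < n" using n3 by simp
  have rot: "rot (greeting (ids a) xs) = greeting (ids a) (xs[?p := Suc (xs ! ?p) mod n])"
    if "xs \<in> draws n (length (G ! a))" for xs
    using that p by (simp add: rot_def greeting_def draws_def map_update)
  have "map_pmf rot (elect n N (local_view c0 a)) = elect n N (local_view c0 a)"
  proof -
    let ?U = "pmf_of_set (draws n (length (G ! a)))"
    have "map_pmf rot (map_pmf (greeting (ids a)) ?U) =
        map_pmf (greeting (ids a)) (map_pmf (\<lambda>xs. xs[?p := Suc (xs ! ?p) mod n]) ?U)"
      unfolding pmf.map_comp
      by (rule map_pmf_cong) (use rot finite_draws draws_nonempty[OF n0] in auto)
    also have "map_pmf (\<lambda>xs. xs[?p := Suc (xs ! ?p) mod n]) ?U = ?U"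
      by (rule map_pmf_of_set_bij_betw[OF bij_betw_rotate_draw[OF n0] draws_nonempty[OF n0] finite_draws])
    finally show ?thesis by (simp add: elect_def)
  qed
  then have inv: "map_pmf \<phi> M = M"
    unfolding M_def \<phi>_def by (rule map_Pi_pmf_upd[OF A(1) aA])
  have shift: "(admissible n (H (\<phi> h)) \<longleftrightarrow> admissible n (H h)) \<and>
      (admissible n (H h) \<longrightarrow> fst ` sym_links (H (\<phi> h)) = fst ` sym_links (H h) \<and>
        total (sym_links (H (\<phi> h))) mod n = Suc (total (sym_links (H h))) mod n)"
    if "h \<in> set_pmf M" for h
  proof -
    define s where "s = h(v := z)"
    have g: "greets s u" if "u \<in> A" for u
    proof -
      have "h u \<in> set_pmf (elect n N (local_view c0 u))"
        using \<open>h \<in> set_pmf M\<close> that A(1) by (auto simp: M_def set_Pi_pmf PiE_dflt_def)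
      then have "greets h u" by (simp add: greets_elect)
      then show ?thesis using that by (simp add: greets_def s_def A_def)
    qed
    obtain xs where xs: "xs \<in> draws n (length (G ! a))" "s a = greeting (ids a) xs"
      using g[OF aA] by (auto simp: greets_def)
    define s' where "s' = s(a := greeting (ids a) (xs[?p := Suc (xs ! ?p) mod n]))"
    have s'_eq: "(\<phi> h)(v := z) = s'"
      using xs rot[OF xs(1)] ab by (auto simp: s'_def \<phi>_def s_def fun_upd_twist)
    note cu = first_claim_upd[OF xs(2,1) ab(1,5) g[OF bA] s'_def]
    define H0 where "H0 = first_claim s ` (A - {a, b})"
    define La Lb where "La = snd (first_claim s a)" and "Lb = snd (first_claim s b)"
    have A': "A = insert a (insert b (A - {a, b}))" using aA bA by auto
    have Hh: "H h = insert (ids a, La) (insert (ids b, Lb) H0)"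
      unfolding H_def s_def[symmetric] H0_def by (subst A') (simp add: La_def Lb_def first_claim_def)
    have "first_claim s' ` (A - {a, b}) = H0"
      unfolding H0_def by (intro image_cong) (use cu(7) A(3) in auto)
    then have H': "H (\<phi> h) = insert (ids a, La[?p := (ids b, Suc (xs ! ?p) mod n, drawn s b (port G b a))])
        (insert (ids b, Lb[port G b a := (ids a, drawn s b (port G b a), Suc (xs ! ?p) mod n)]) H0)"
      unfolding H_def s'_eq by (subst A') (simp add: cu(5,6) La_def Lb_def)
    have ne: "ids a \<noteq> ids b" using inj ab \<open>a \<noteq> b\<close> by (auto simp: inj_on_def)
    have fr: "ids a \<notin> fst ` H0" "ids b \<notin> fst ` H0"
      using inj ab A(3) by (auto simp: H0_def first_claim_def inj_on_def)
    have "finite H0" by (simp add: H0_def A(1))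
    note rl = rotate_link[OF cu(1-4) ne fr this n0]
    show ?thesis unfolding Hh H' La_def Lb_def using rl by blast
  qed
  \<comment> \<open>The favourable positions in the sorted list of ids. The rotation leaves the ids,
    and hence \<open>J\<close>, unchanged.\<close>
  define J where "J h = {i. i < n \<and>
      (sorted_list_of_set (fst ` sym_links (H h)) ! i \<in> ids ` A \<longleftrightarrow> p = Zero)}" for h
  have cardJ: "card (J h) = seats p" if ad: "admissible n (H h)" for h
  proof -
    define l where "l = sorted_list_of_set (fst ` sym_links (H h))"
    have ids: "fst ` H h = ids ` A" by (auto simp: H_def first_claim_def image_image)
    have c: "card (fst ` sym_links (H h)) = n" using ad by (simp add: admissible_def)
    then have fin: "finite (fst ` sym_links (H h))" using n0 by (intro card_ge_0_finite) simp
    have l: "distinct l" "length l = n" "ids ` A \<subseteq> set l"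
      using ad c fin ids by (auto simp: l_def admissible_def)
    have "inj_on ids A" using inj A(3) by (rule inj_on_subset)
    then have "card (ids ` A) = n - 1" using A(2) by (simp add: card_image)
    then have Z: "card {i. i < n \<and> l ! i \<in> ids ` A} = n - 1"
      using card_nth_in[OF l(1,3)] l(2) by simp
    show ?thesis
    proof (cases "p = Zero")
      case True
      then show ?thesis using Z by (simp add: J_def l_def[symmetric] seats_def)
    next
      case False
      \<comment> \<open>\<open>n - 1\<close> of the \<open>n\<close> listed ids belong to the
        others. The one left over, whatever id the cheater has announced, is the single seat for a
        preference other than \<open>Zero\<close>.\<close>
      then have "J h = {..<n} - {i. i < n \<and> l ! i \<in> ids ` A}" by (auto simp: J_def l_def)
      moreover have "card ({..<n} - {i. i < n \<and> l ! i \<in> ids ` A}) = n - (n - 1)"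
        using Z by (subst card_Diff_subset) auto
      ultimately show ?thesis using False n0 by (simp add: seats_def)
    qed
  qed
  have "measure_pmf.prob M {h. admissible n (H h) \<and> total (sym_links (H h)) mod n \<in> J h} \<le> real (seats p) / real n"
    using shift cardJ n0 by (intro rotation_bound[OF n0 inv]) (auto simp: J_def)
  moreover have "{h. admissible n (H h) \<and> total (sym_links (H h)) mod n \<in> J h} = {h. first_fate v p (h(v := z))}"
    using n0 by (auto simp: first_fate_def J_def H_def A_def winner_def Let_def)
  ultimately show ?thesis by (simp add: M_def A_def)
qed

end

subsection \<open>Equilibrium for a known number of agents\<close>

text \<open>Honesty as a special cheat, so that bounds valid for all strategies also apply to honest
  runs.\<close>

definition honest_strategy :: "algorithm \<Rightarrow> strategy" where
  "honest_strategy \<Lambda> hs = map_pmf (\<lambda>s. ([s], decision s)) (\<Lambda> (hd hs))"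

lemma honest_round_as_cheat:
  assumes "v < length (net c)"
  shows "cheat_round \<Lambda> v [v] (honest_strategy \<Lambda>) c = honest_round \<Lambda> c"
proof -
  let ?A = "{..<length (net c)} - {v}" and ?P = "\<lambda>u. \<Lambda> (local_view c u)"
  have A: "{..<length (net c)} = insert v ?A" using assms by auto
  have P: "Pi_pmf {..<length (net c)} idle ?P = map_pmf (\<lambda>(y, g). g(v := y)) (pair_pmf (?P v) (Pi_pmf ?A idle ?P))"
    by (subst A, rule Pi_pmf_insert) auto
  have "(let s = (\<lambda>u. case map_of (zip [v] [y]) u of Some x \<Rightarrow> x | None \<Rightarrow> h u)
         in advance c s ((\<lambda>u. decision (s u))(v := decision y))) =
      advance c (h(v := y)) (\<lambda>u. decision ((h(v := y)) u))" for h y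
  proof -
    have "(\<lambda>u. case map_of (zip [v] [y]) u of Some x \<Rightarrow> x | None \<Rightarrow> h u) = h(v := y)"
      by (auto simp: fun_eq_iff)
    moreover have "(\<lambda>u. decision ((h(v := y)) u))(v := decision y) = (\<lambda>u. decision ((h(v := y)) u))"
      by (auto simp: fun_eq_iff)
    ultimately show ?thesis by (simp only: Let_def)
  qed
  then have "cheat_round \<Lambda> v [v] (honest_strategy \<Lambda>) c =
      bind_pmf (Pi_pmf ?A idle ?P) (\<lambda>h. bind_pmf (?P v) (\<lambda>y.
        return_pmf (advance c (h(v := y)) (\<lambda>u. decision ((h(v := y)) u)))))"
    by (simp add: cheat_round_def honest_strategy_def map_pmf_def bind_assoc_pmf bind_return_pmf)
  also have "\<dots> = bind_pmf (?P v) (\<lambda>y. bind_pmf (Pi_pmf ?A idle ?P) (\<lambda>h.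
        return_pmf (advance c (h(v := y)) (\<lambda>u. decision ((h(v := y)) u)))))"
    by (rule bind_commute_pmf)
  also have "\<dots> = honest_round \<Lambda> c"
    unfolding honest_round_def P
    by (simp add: map_pmf_def pair_pmf_def bind_assoc_pmf bind_return_pmf)
  finally show ?thesis .
qed

lemma honest_run_as_cheat:
  assumes "v < length (net c)"
  shows "cheat_run \<Lambda> v [v] (honest_strategy \<Lambda>) c k = honest_run \<Lambda> c k"
proof (induction k)
  case (Suc k)
  then show ?case
    using honest_round_as_cheat[of v _ \<Lambda>] assms net_honest_run
    by (auto intro!: bind_pmf_cong)
qed simp

context election
begin

lemma fate_step:
  assumes "reach \<Lambda> A c0 t c" "0 < t"
  shows "fate n v p (advance c s ds) \<longleftrightarrow> fate n v p c"
  using fate_advance[of n c v p s ds] reach_static(1)[OF assms(1)] reach_hist[OF assms] len by simp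

lemma fate_honest_run:
  assumes "reach (elect n N) {..<n} c0 t c" "0 < t" "c' \<in> set_pmf (honest_run (elect n N) c k)"
  shows "fate n v p c' \<longleftrightarrow> fate n v p c"
  using assms(3)
proof (induction k arbitrary: c')
  case (Suc k)
  then obtain d where d: "d \<in> set_pmf (honest_run (elect n N) c k)" "c' \<in> set_pmf (honest_round (elect n N) d)"
    by auto
  have "net c = G" using reach_static(1)[OF assms(1)] .
  then have "reach (elect n N) {..<n} c0 (t + k) d"
    using reach_honest_run[of "elect n N" c c0 t d k] assms(1) d(1) len by simp
  moreover obtain s ds where "c' = advance d s ds" using honest_round_advance[OF d(2)] by blast
  ultimately show ?case using fate_step assms(2) Suc.IH[OF d(1)] by (metis add_gr_0)
qed simp

lemma fate_cheat_run:
  assumes "reach (elect n N) ({..<n} - {v}) c0 t c" "0 < t" "c' \<in> set_pmf (cheat_run (elect n N) v [v] \<tau> c k)"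
  shows "fate n v p c' \<longleftrightarrow> fate n v p c"
  using assms(3)
proof (induction k arbitrary: c')
  case (Suc k)
  then obtain d where d: "d \<in> set_pmf (cheat_run (elect n N) v [v] \<tau> c k)"
    "c' \<in> set_pmf (cheat_round (elect n N) v [v] \<tau> d)"
    by auto
  have "net c = G" using reach_static(1)[OF assms(1)] .
  then have "reach (elect n N) ({..<n} - {v}) c0 (t + k) d"
    using reach_cheat_run[of "elect n N" c v c0 t d \<tau> k] assms(1) d(1) len by simp
  moreover obtain s ds where "c' = advance d s ds" using cheat_round_advance[OF d(2)] by blast
  ultimately show ?case using fate_step assms(2) Suc.IH[OF d(1)] by (metis add_gr_0)
qed simp

text \<open>After round 0 \<open>fate\<close> is constant along the run and dominates the utility at
  every horizon, hence also in the limit.\<close>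

lemma cheat_le_fate:
  assumes r: "reach (elect n N) ({..<n} - {v}) c0 t c" "0 < t" and v: "v < n" and p: "prefs v \<noteq> Abort"
  shows "cheat_value (elect n N) n v [v] \<tau> c \<le> (if fate n v (prefs v) c then 1 else 0)"
proof (rule LIMSEQ_le_const2[OF cheat_value_limit(1)[OF v]], intro exI allI impI)
  fix k :: nat
  have st: "net c = G" "pref c = prefs" using reach_static[OF r(1)] by auto
  have "measure_pmf.expectation (cheat_run (elect n N) v [v] \<tau> c k) (\<lambda>c'. utility n v (pref c v) (out c'))
    \<le> measure_pmf.expectation (cheat_run (elect n N) v [v] \<tau> c k) (\<lambda>_. if fate n v (prefs v) c then 1 else 0)"
  proof (rule expectation_pmf_mono)
    fix c' assume c': "c' \<in> set_pmf (cheat_run (elect n N) v [v] \<tau> c k)"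
    have "reach (elect n N) ({..<n} - {v}) c0 (t + k) c'"
      using reach_cheat_run[of "elect n N" c v c0 t c' \<tau> k] r c' st len by simp
    from utility_le_fate[OF this v p]
    show "utility n v (pref c v) (out c') \<le> (if fate n v (prefs v) c then 1 else 0)"
      using fate_cheat_run[OF r c'] st by simp
  qed (auto simp: utility_unit)
  then show "measure_pmf.expectation (cheat_run (elect n N) v [v] \<tau> c k) (\<lambda>c'. utility n v (pref c v) (out c'))
    \<le> (if fate n v (prefs v) c then 1 else 0)" by simp
qed

text \<open>After \<open>N + 2\<close> further rounds everybody has decided, whatever the starting
  round, and the utility then equals \<open>fate\<close>. With \<open>cheat_le_fate\<close> this
  sandwiches every late deviation.\<close>

lemma fate_le_honest:
  assumes r: "reach (elect n N) {..<n} c0 t c" "0 < t" and v: "v < n" and p: "prefs v \<noteq> Abort"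
  shows "(if fate n v (prefs v) c then 1 else 0) \<le> honest_value (elect n N) v c"
proof -
  have st: "net c = G" "pref c = prefs" using reach_static[OF r(1)] by auto
  let ?k = "Suc (Suc N)"
  have "(if fate n v (prefs v) c then 1 else 0) =
    measure_pmf.expectation (honest_run (elect n N) c ?k) (\<lambda>_. if fate n v (prefs v) c then 1 else (0::real))"
    by simp
  also have "\<dots> = measure_pmf.expectation (honest_run (elect n N) c ?k)
      (\<lambda>c'. utility (length (net c)) v (pref c v) (out c'))"
  proof (rule expectation_pmf_cong)
    fix c' assume c': "c' \<in> set_pmf (honest_run (elect n N) c ?k)"
    have "reach (elect n N) {..<n} c0 (t + ?k) c'"
      using reach_honest_run[of "elect n N" c c0 t c' ?k] r c' st len by simp
    from honest_final(2)[OF this _ v p]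
    show "(if fate n v (prefs v) c then 1 else 0) = utility (length (net c)) v (pref c v) (out c')"
      using fate_honest_run[OF r c'] st len by simp
  qed
  also have "\<dots> \<le> honest_value (elect n N) v c" using v st len by (intro honest_value_limit) simp
  finally show ?thesis .
qed

lemma reach0: "reach \<Lambda> A c0 0 c0"
  by (rule reach_init)

lemma cheat_fate_prob:
  assumes v: "v < n" and k: "0 < k"
  shows "measure_pmf.prob (cheat_run (elect n N) v [v] \<tau> c0 k) {c. fate n v p c} \<le> real (seats p) / real n"
proof -
  let ?run = "cheat_run (elect n N) v [v] \<tau> c0"
  \<comment> \<open>Only the first round counts, as later ones leave \<open>fate\<close>
    unchanged.\<close>
  have "measure_pmf.prob (?run k) {c. fate n v p c} = measure_pmf.prob (?run 1) {c. fate n v p c}"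
  proof (rule invariant_process)
    fix i x y assume i: "1 \<le> i" and x: "x \<in> set_pmf (?run i)" and y: "y \<in> set_pmf (cheat_round (elect n N) v [v] \<tau> x)"
    have "reach (elect n N) ({..<n} - {v}) c0 (0 + i) x"
      using reach_cheat_run[of "elect n N" c0 v c0 0 x \<tau> i] reach0 x len by simp
    moreover obtain s ds where "y = advance x s ds" using cheat_round_advance[OF y] by blast
    ultimately show "fate n v p y = fate n v p x" using fate_step i by simp
  qed (use k in auto)
  also have "\<dots> = measure_pmf.expectation (cheat_round (elect n N) v [v] \<tau> c0) (\<lambda>c. if fate n v p c then 1 else 0)"
    by (simp add: bind_return_pmf expectation_indicator_pmf)
  \<comment> \<open>The cheater's step depends on its own initial view only, so it can be drawn
    before the steps of the others and then be held fixed.\<close>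
  also have "cheat_round (elect n N) v [v] \<tau> c0 =
    bind_pmf (\<tau> [local_view c0 v]) (\<lambda>(xs, ov).
      bind_pmf (Pi_pmf ({..<n} - {v}) idle (\<lambda>u. elect n N (local_view c0 u))) (\<lambda>h. return_pmf (
         let s = (\<lambda>u. case map_of (zip [v] xs) u of Some x \<Rightarrow> x | None \<Rightarrow> h u)
         in advance c0 s ((\<lambda>u. decision (s u))(v := ov)))))"
    unfolding cheat_round_def map_pmf_def
    by (subst bind_commute_pmf) (simp add: len split_def)
  also have "measure_pmf.expectation \<dots> (\<lambda>c. if fate n v p c then 1 else 0) \<le> real (seats p) / real n"
  proof (subst expectation_bind_pmf_unit)
    let ?M = "Pi_pmf ({..<n} - {v}) idle (\<lambda>u. elect n N (local_view c0 u))"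
    let ?step = "\<lambda>xs h u. case map_of (zip [v] xs) u of Some x \<Rightarrow> x | None \<Rightarrow> h u"
    have "measure_pmf.expectation (case y of (xs, ov) \<Rightarrow> bind_pmf ?M (\<lambda>h. return_pmf (
         let s = ?step xs h in advance c0 s ((\<lambda>u. decision (s u))(v := ov)))))
           (\<lambda>c. if fate n v p c then 1 else 0) \<le> real (seats p) / real n" for y :: "step list \<times> outval option"
    proof -
      obtain xs ov where y: "y = (xs, ov)" by (cases y)
      \<comment> \<open>An empty list assigns no step to \<open>v\<close>; \<open>h v\<close> is
        then the default \<open>idle\<close> of \<open>Pi_pmf\<close>.\<close>
      define z where "z = (case xs of [] \<Rightarrow> idle | x # _ \<Rightarrow> x)"
      have st: "?step xs h = h(v := z)" if "h \<in> set_pmf ?M" for h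
        using that by (cases xs) (auto simp: z_def set_Pi_pmf PiE_dflt_def fun_eq_iff)
      have "measure_pmf.expectation (case y of (xs, ov) \<Rightarrow> bind_pmf ?M (\<lambda>h. return_pmf (
         let s = ?step xs h in advance c0 s ((\<lambda>u. decision (s u))(v := ov)))))
           (\<lambda>c. if fate n v p c then 1 else 0) =
         measure_pmf.expectation ?M (\<lambda>h. if first_fate v p (?step xs h) then 1 else (0::real))"
        unfolding y prod.case Let_def
        by (subst expectation_bind_pmf_unit) (auto simp: fate_first)
      also have "\<dots> = measure_pmf.expectation ?M (\<lambda>h. if first_fate v p (h(v := z)) then 1 else 0)"
        by (rule expectation_pmf_cong) (simp only: st)
      also have "\<dots> \<le> real (seats p) / real n"
        unfolding expectation_indicator_pmf by (rule first_fate_prob[OF v])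
      finally show ?thesis .
    qed note * = this
    have s1: "real (seats p) / real n \<le> 1" using n3 by (simp add: seats_def)
    have "measure_pmf.expectation (\<tau> [local_view c0 v]) (\<lambda>y. measure_pmf.expectation (case y of (xs, ov) \<Rightarrow> bind_pmf ?M (\<lambda>h. return_pmf (
         let s = ?step xs h in advance c0 s ((\<lambda>u. decision (s u))(v := ov)))))
           (\<lambda>c. if fate n v p c then 1 else 0)) \<le> measure_pmf.expectation (\<tau> [local_view c0 v]) (\<lambda>_. real (seats p) / real n)"
      by (rule expectation_pmf_mono) (use * s1 in \<open>auto intro!: expectation_pmf_unit\<close>)
    then show "measure_pmf.expectation (\<tau> [local_view c0 v]) (\<lambda>y. measure_pmf.expectation (case y of (xs, ov) \<Rightarrow> bind_pmf ?M (\<lambda>h. return_pmf (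
         let s = ?step xs h in advance c0 s ((\<lambda>u. decision (s u))(v := ov)))))
           (\<lambda>c. if fate n v p c then 1 else 0)) \<le> real (seats p) / real n" by simp
  qed auto
  finally show ?thesis .
qed

lemma seats_sum: "real (seats One) / real n + real (seats Zero) / real n = 1"
  using n3 by (simp add: seats_def field_simps)

text \<open>In an honest run the fates for \<open>One\<close> and \<open>Zero\<close> are
  complementary, and their upper bounds add up to 1; so both bounds are equalities. The case
  \<open>One\<close> yields fairness.\<close>

lemma honest_fate_prob:
  assumes v: "v < n" and k: "0 < k" and p: "p \<noteq> Abort"
  shows "measure_pmf.prob (honest_run (elect n N) c0 k) {c. fate n v p c} = real (seats p) / real n"
proof -
  let ?M = "honest_run (elect n N) c0 k"
  have le: "measure_pmf.prob ?M {c. fate n v q c} \<le> real (seats q) / real n" for q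
    using cheat_fate_prob[OF v k, of "honest_strategy (elect n N)" q] honest_run_as_cheat[of v c0] v len by simp
  have "measure_pmf.prob ?M {c. fate n v Zero c} = 1 - measure_pmf.prob ?M {c. fate n v One c}"
  proof -
    have "measure_pmf.prob ?M {c. fate n v Zero c} = measure_pmf.prob ?M (space ?M - {c. fate n v One c})"
    proof (rule measure_pmf.finite_measure_eq_AE)
      show "AE x in ?M. (x \<in> {c. fate n v Zero c}) = (x \<in> space ?M - {c. fate n v One c})"
        unfolding AE_measure_pmf_iff
      proof
        fix c assume "c \<in> set_pmf ?M"
        then have "reach (elect n N) {..<n} c0 (0 + k) c"
          using reach_honest_run[of "elect n N" c0 c0 0 c k] reach0 len by simp
        from honest_fate(3)[OF this _ v] k
        show "(c \<in> {c. fate n v Zero c}) = (c \<in> space ?M - {c. fate n v One c})" by simp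
      qed
    qed auto
    then show ?thesis by (subst (asm) measure_pmf.prob_compl) auto
  qed
  then show ?thesis using le[of One] le[of Zero] seats_sum p by (cases p) auto
qed

lemma honest_value_start:
  assumes v: "v < n" and p: "prefs v \<noteq> Abort"
  shows "honest_value (elect n N) v c0 \<ge> real (seats (prefs v)) / real n"
proof -
  let ?k = "Suc (Suc N)"
  have "real (seats (prefs v)) / real n = measure_pmf.expectation (honest_run (elect n N) c0 ?k)
      (\<lambda>c. if fate n v (prefs v) c then 1 else 0)"
    unfolding expectation_indicator_pmf by (rule honest_fate_prob[OF v _ p, symmetric]) simp
  also have "\<dots> = measure_pmf.expectation (honest_run (elect n N) c0 ?k)
      (\<lambda>c'. utility (length (net c0)) v (pref c0 v) (out c'))"
  proof (rule expectation_pmf_cong)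
    fix c' assume c': "c' \<in> set_pmf (honest_run (elect n N) c0 ?k)"
    have "reach (elect n N) {..<n} c0 (0 + ?k) c'"
      using reach_honest_run[of "elect n N" c0 c0 0 c' ?k] reach0 c' len by simp
    from honest_final(2)[OF this _ v p]
    show "(if fate n v (prefs v) c' then 1 else 0) = utility (length (net c0)) v (pref c0 v) (out c')"
      using len by simp
  qed
  also have "\<dots> \<le> honest_value (elect n N) v c0" using v len by (intro honest_value_limit) simp
  finally show ?thesis .
qed

lemma cheat_value_start:
  assumes v: "v < n" and p: "prefs v \<noteq> Abort"
  shows "cheat_value (elect n N) n v [v] \<tau> c0 \<le> real (seats (prefs v)) / real n"
proof (rule LIMSEQ_le_const2[OF cheat_value_limit(1)[OF v]], intro exI[of _ 1] allI impI)
  fix k :: nat assume k: "1 \<le> k"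
  have "measure_pmf.expectation (cheat_run (elect n N) v [v] \<tau> c0 k) (\<lambda>c'. utility n v (pref c0 v) (out c'))
    \<le> measure_pmf.expectation (cheat_run (elect n N) v [v] \<tau> c0 k) (\<lambda>c. if fate n v (prefs v) c then 1 else 0)"
  proof (rule expectation_pmf_mono)
    fix c' assume c': "c' \<in> set_pmf (cheat_run (elect n N) v [v] \<tau> c0 k)"
    have "reach (elect n N) ({..<n} - {v}) c0 (0 + k) c'"
      using reach_cheat_run[of "elect n N" c0 v c0 0 c' \<tau> k] reach0 c' len by simp
    from utility_le_fate[OF this v p]
    show "utility n v (pref c0 v) (out c') \<le> (if fate n v (prefs v) c' then 1 else 0)" by simp
  qed (auto simp: utility_unit)
  also have "\<dots> \<le> real (seats (prefs v)) / real n"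
    unfolding expectation_indicator_pmf using k by (intro cheat_fate_prob[OF v]) simp
  finally show "measure_pmf.expectation (cheat_run (elect n N) v [v] \<tau> c0 k) (\<lambda>c'. utility n v (pref c0 v) (out c'))
    \<le> real (seats (prefs v)) / real n" .
qed

lemma election_prob_elect:
  assumes v: "v < n"
  shows "election_prob (elect n N) c0 v = 1 / real n"
proof -
  have "measure_pmf.prob (honest_run (elect n N) c0 k) {c'. elected n v (out c')} = 1 / real n" if "Suc N < k" for k
  proof -
    have "measure_pmf.prob (honest_run (elect n N) c0 k) {c'. elected n v (out c')} =
      measure_pmf.prob (honest_run (elect n N) c0 k) {c. fate n v One c}"
    proof (rule measure_pmf.finite_measure_eq_AE)
      show "AE x in honest_run (elect n N) c0 k. (x \<in> {c'. elected n v (out c')}) = (x \<in> {c. fate n v One c})"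
        unfolding AE_measure_pmf_iff
      proof
        fix c assume "c \<in> set_pmf (honest_run (elect n N) c0 k)"
        then have "reach (elect n N) {..<n} c0 (0 + k) c"
          using reach_honest_run[of "elect n N" c0 c0 0 c k] reach0 len by simp
        from honest_final(2)[OF this _ v, of One] that
        show "(c \<in> {c'. elected n v (out c')}) = (c \<in> {c. fate n v One c})"
          by (simp add: elected_utility[symmetric] split: if_splits)
      qed
    qed auto
    also have "\<dots> = 1 / real n" using honest_fate_prob[OF v, of k One] that by (simp add: seats_def)
    finally show ?thesis .
  qed
  then have "(\<lambda>k. measure_pmf.prob (honest_run (elect n N) c0 k) {c'. elected n v (out c')}) \<longlonglongrightarrow> 1 / real n"
    by (intro tendsto_eventually eventually_sequentiallyI[of "Suc (Suc N)"]) simp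
  then show ?thesis using election_prob_limit[of v c0 "elect n N"] v len by (auto intro: LIMSEQ_unique)
qed

lemma legal_elect:
  "(\<lambda>k. measure_pmf.prob (honest_run (elect n N) c0 k) {c'. legal n (out c')}) \<longlonglongrightarrow> 1"
proof (intro tendsto_eventually eventually_sequentiallyI[of "Suc (Suc N)"])
  fix k assume k: "Suc (Suc N) \<le> k"
  have "legal n (out c)" if "c \<in> set_pmf (honest_run (elect n N) c0 k)" for c
  proof -
    have "reach (elect n N) {..<n} c0 (0 + k) c"
      using reach_honest_run[of "elect n N" c0 c0 0 c k] reach0 len that by simp
    from honest_final(1)[OF this] k show ?thesis by simp
  qed
  then show "measure_pmf.prob (honest_run (elect n N) c0 k) {c'. legal n (out c')} = 1"
    by (simp add: measure_pmf.prob_eq_1 AE_measure_pmf_iff)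
qed

end

section \<open>From fixed networks to the agents' beliefs\<close>

lemma finite_injections: "finite I \<Longrightarrow> finite A \<Longrightarrow> finite (injections A I)"
  unfolding injections_def by (rule finite_subset[of _ "A \<rightarrow>\<^sub>E I"]) (auto intro: finite_PiE)

lemma injections_nonempty:
  assumes "finite I" "finite A" "card A \<le> card I"
  shows "injections A I \<noteq> {}"
proof -
  obtain f where f: "f ` A \<subseteq> I" "inj_on f A" using card_le_inj[OF assms(2,1,3)] by blast
  then have "restrict f A \<in> injections A I" by (auto simp: injections_def inj_on_def)
  then show ?thesis by blast
qed

definition possible_start :: "nat set \<Rightarrow> (network \<times> nat) pmf \<Rightarrow> nat \<Rightarrow> config \<Rightarrow> bool" where
  "possible_start I \<mu> v c \<longleftrightarrow> (\<exists>G ids prefs. c = init_config G ids prefs \<and> (G, v) \<in> set_pmf \<mu> \<and>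
     ids \<in> injections {..<length G} I \<and> prefs \<in> {..<length G} \<rightarrow>\<^sub>E {Zero, One})"

lemma prior_start_support:
  assumes "finite I" "\<And>G v. (G, v) \<in> set_pmf \<mu> \<Longrightarrow> length G \<le> card I"
    and "(v, c) \<in> set_pmf (prior_start I \<mu>)"
  shows "possible_start I \<mu> v c"
proof -
  obtain G w where G: "(G, w) \<in> set_pmf \<mu>"
    "(v, c) \<in> set_pmf (bind_pmf (pmf_of_set (injections {..<length G} I)) (\<lambda>ids.
     bind_pmf (pmf_of_set ({..<length G} \<rightarrow>\<^sub>E {Zero, One})) (\<lambda>prefs.
     return_pmf (w, init_config G ids prefs))))"
    using assms(3) by (auto simp: prior_start_def)
  \<comment> \<open>\<open>pmf_of_set\<close> has the intended support only for finite nonempty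
    sets; nonemptiness is where a sufficient supply of ids enters.\<close>
  have "finite (injections {..<length G} I)" "injections {..<length G} I \<noteq> {}"
    using assms(1) assms(2)[OF G(1)] finite_injections injections_nonempty[of I "{..<length G}"] by simp_all
  moreover have "finite ({..<length G} \<rightarrow>\<^sub>E {Zero, One})" "{..<length G} \<rightarrow>\<^sub>E {Zero, One} \<noteq> {}"
    by (auto intro!: finite_PiE simp: PiE_eq_empty_iff)
  ultimately show ?thesis using G unfolding possible_start_def by auto
qed

lemma geometric_prior_support:
  assumes "geometric_prior \<alpha> \<beta> \<mu>" "(G, v) \<in> set_pmf \<mu>"
  shows "two_vertex_connected G" "v < length G" "\<alpha> \<le> length G" "length G \<le> \<beta>"
proof -
  show "two_vertex_connected G" "v < length G" using assms by (auto simp: geometric_prior_def)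
  have "length G \<in> set_pmf (map_pmf (\<lambda>(G, v). length G) \<mu>)"
    using assms(2) by (force simp: image_iff)
  then have "pmf (map_pmf (\<lambda>(G, v). length G) \<mu>) (length G) \<noteq> 0" unfolding set_pmf_iff by simp
  moreover have "pmf (map_pmf (\<lambda>(G, v). length G) \<mu>) (length G) = geometric \<alpha> \<beta> (length G)"
    using assms(1) unfolding geometric_prior_def by blast
  ultimately have "geometric \<alpha> \<beta> (length G) \<noteq> 0" by simp
  then show "\<alpha> \<le> length G" "length G \<le> \<beta>" by (auto simp: geometric_def split: if_splits)
qed

lemma duplication_value_unit:
  assumes "v < length (net c)"
  shows "0 \<le> duplication_value I \<beta> \<Lambda> v S \<tau> c" "duplication_value I \<beta> \<Lambda> v S \<tau> c \<le> 1"
  using cheat_value_limit(2,3)[OF assms]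
  by (auto simp: duplication_value_def Let_def intro!: expectation_pmf_unit)

lemma election_possible_start:
  assumes "geometric_prior n n \<mu>" "possible_start I \<mu> v c"
  obtains G ids prefs where "election n (n * n) G ids" "c = init_config G ids prefs" "v < n" "length G = n"
    "prefs v \<noteq> Abort"
proof -
  obtain G ids prefs where c: "c = init_config G ids prefs" "(G, v) \<in> set_pmf \<mu>"
    "ids \<in> injections {..<length G} I" "prefs \<in> {..<length G} \<rightarrow>\<^sub>E {Zero, One}"
    using assms(2) unfolding possible_start_def by blast
  note G = geometric_prior_support[OF assms(1) c(2)]
  then have len: "length G = n" by simp
  have "election n (n * n) G ids"
    by unfold_locales (use G c(3) len in \<open>auto simp: injections_def\<close>)
  moreover have "prefs v \<noteq> Abort" using PiE_mem[OF c(4), of v] G(2) by auto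
  ultimately show thesis using that c(1) G(2) len by simp
qed

lemma elect_leader_election_fair:
  shows "leader_election I n n (elect n (n * n))" "fair I n n (elect n (n * n))"
proof -
  have el: "election n (n * n) G ids"
    if "two_vertex_connected G" "n \<le> length G" "length G \<le> n" "ids \<in> injections {..<length G} I" for G ids
    by unfold_locales (use that in \<open>auto simp: injections_def\<close>)
  show "leader_election I n n (elect n (n * n))"
    unfolding leader_election_def instances_def
    using election.legal_elect[OF el] by (auto simp: election.c0_def[OF el])
  show "fair I n n (elect n (n * n))"
    unfolding fair_def instances_def
    using election.election_prob_elect[OF el] by (auto simp: election.c0_def[OF el])
qed

text \<open>Both values are compared with \<open>seats / n\<close> at round 0 and with
  \<open>fate\<close> afterwards. As this holds in every single configuration, it survives averaging
  over any belief.\<close>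

lemma elect_no_cheating:
  assumes "geometric_prior n n \<mu>" "possible_start I \<mu> v c1" "c \<in> set_pmf (honest_run (elect n (n * n)) c1 r)"
  shows "v < n" "length (net c) = n"
    and "cheat_value (elect n (n * n)) (length (net c)) v [v] \<tau> c \<le> honest_value (elect n (n * n)) v c"
proof -
  let ?\<Lambda> = "elect n (n * n)"
  obtain G ids prefs where el: "election n (n * n) G ids" and c1: "c1 = init_config G ids prefs"
    and v: "v < n" and len: "length G = n" and p: "prefs v \<noteq> Abort"
    by (rule election_possible_start[OF assms(1,2)])
  interpret election n "n * n" G ids prefs by (rule el)
  have run: "c \<in> set_pmf (honest_run ?\<Lambda> c0 r)" using assms(3) by (simp add: c1 c0_def)
  have reach: "reach ?\<Lambda> {..<n} c0 r c"
    using reach_honest_run[of ?\<Lambda> c0 c0 0 c r] reach0 run len by simp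
  show "v < n" by (rule v)
  show "length (net c) = n" using reach_static(1)[OF reach] len by simp
  moreover have "cheat_value ?\<Lambda> n v [v] \<tau> c \<le> honest_value ?\<Lambda> v c"
  proof (cases "r = 0")
    case True
    then have "c = c0" using run by simp
    then show ?thesis using cheat_value_start[OF v p] honest_value_start[OF v p] by (auto intro: order_trans)
  next
    case False
    have "reach ?\<Lambda> ({..<n} - {v}) c0 r c" by (rule reach_antimono[OF reach]) auto
    from cheat_le_fate[OF this _ v p] fate_le_honest[OF reach _ v p] False
    show ?thesis by (meson order_trans gr0I)
  qed
  ultimately show "cheat_value ?\<Lambda> (length (net c)) v [v] \<tau> c \<le> honest_value ?\<Lambda> v c" by simp
qed

lemma elect_equilibrium:
  assumes \<mu>: "geometric_prior n n \<mu>" and I: "finite I" "n \<le> card I"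
  shows "equilibrium I n \<mu> (elect n (n * n))"
proof -
  let ?\<Lambda> = "elect n (n * n)"
  have start: "\<exists>c1. possible_start I \<mu> v c1 \<and> c \<in> set_pmf (honest_run ?\<Lambda> c1 r)"
    if ne: "set_pmf (executions I \<mu> ?\<Lambda> r) \<inter> consistent h \<noteq> {}" and "(v, c) \<in> set_pmf (belief I \<mu> ?\<Lambda> r h)" for r h v c
  proof -
    have "(v, c) \<in> set_pmf (executions I \<mu> ?\<Lambda> r)"
      using that(2) by (simp add: belief_def set_cond_pmf[OF ne])
    then obtain c1 where "(v, c1) \<in> set_pmf (prior_start I \<mu>)" "c \<in> set_pmf (honest_run ?\<Lambda> c1 r)"
      by (auto simp: executions_def)
    moreover have "length G \<le> card I" if "(G, v) \<in> set_pmf \<mu>" for G v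
      using geometric_prior_support(4)[OF \<mu> that] I(2) by simp
    ultimately show ?thesis using prior_start_support[OF I(1)] by blast
  qed
  show ?thesis
    unfolding equilibrium_def
  proof (intro allI impI conjI)
    fix r h \<tau> assume ne: "set_pmf (executions I \<mu> ?\<Lambda> r) \<inter> consistent h \<noteq> {}"
    show "measure_pmf.expectation (belief I \<mu> ?\<Lambda> r h) (\<lambda>(v, c). cheat_value ?\<Lambda> (length (net c)) v [v] \<tau> c)
      \<le> measure_pmf.expectation (belief I \<mu> ?\<Lambda> r h) (\<lambda>(v, c). honest_value ?\<Lambda> v c)"
    proof (rule expectation_pmf_mono)
      fix vc assume vc: "vc \<in> set_pmf (belief I \<mu> ?\<Lambda> r h)"
      obtain v c where e: "vc = (v, c)" by (cases vc)
      obtain c1 where c1: "possible_start I \<mu> v c1" "c \<in> set_pmf (honest_run ?\<Lambda> c1 r)"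
        using start[OF ne] vc e by blast
      note nc = elect_no_cheating[OF \<mu> c1]
      then have v: "v < length (net c)" by simp
      show "0 \<le> (case vc of (v, c) \<Rightarrow> cheat_value ?\<Lambda> (length (net c)) v [v] \<tau> c)"
        "(case vc of (v, c) \<Rightarrow> cheat_value ?\<Lambda> (length (net c)) v [v] \<tau> c) \<le> (case vc of (v, c) \<Rightarrow> honest_value ?\<Lambda> v c)"
        "(case vc of (v, c) \<Rightarrow> honest_value ?\<Lambda> v c) \<le> 1"
        using nc(3) cheat_value_limit(2)[OF v] honest_value_limit(3)[OF v] by (simp_all add: e)
    qed
  next
    fix r h S \<tau> assume ne: "set_pmf (executions I \<mu> ?\<Lambda> r) \<inter> consistent h \<noteq> {}"
      and S: "valid_duplication (my_degree h) S \<and> 2 \<le> length S"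
    show "measure_pmf.expectation (belief I \<mu> ?\<Lambda> r h) (\<lambda>(v, c). duplication_value I n ?\<Lambda> v S \<tau> c)
      \<le> measure_pmf.expectation (belief I \<mu> ?\<Lambda> r h) (\<lambda>(v, c). honest_value ?\<Lambda> v c)"
    proof (rule expectation_pmf_mono)
      fix vc assume vc: "vc \<in> set_pmf (belief I \<mu> ?\<Lambda> r h)"
      obtain v c where e: "vc = (v, c)" by (cases vc)
      obtain c1 where c1: "possible_start I \<mu> v c1" "c \<in> set_pmf (honest_run ?\<Lambda> c1 r)"
        using start[OF ne] vc e by blast
      note nc = elect_no_cheating(1,2)[OF \<mu> c1]
      then have v: "v < length (net c)" by simp
      \<comment> \<open>Here \<beta> is the actual size, so two or more simulated agents always
        exceed it.\<close>
      have "duplication_value I n ?\<Lambda> v S \<tau> c = 0" using S nc by (auto simp: duplication_value_def Let_def)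
      then show "0 \<le> (case vc of (v, c) \<Rightarrow> duplication_value I n ?\<Lambda> v S \<tau> c)"
        "(case vc of (v, c) \<Rightarrow> duplication_value I n ?\<Lambda> v S \<tau> c) \<le> (case vc of (v, c) \<Rightarrow> honest_value ?\<Lambda> v c)"
        "(case vc of (v, c) \<Rightarrow> honest_value ?\<Lambda> v c) \<le> 1"
        using honest_value_limit(2,3)[OF v] by (simp_all add: e)
    qed
  qed
qed

subsection \<open>Splitting an agent in two\<close>

text \<open>Port 0 goes to one half and the remaining ports to the other: at degree at least 2 each
  half keeps an outside neighbour. The division depends only on the degree, which the agent
  sees.\<close>

definition split_off :: "nat \<Rightarrow> duplication" where
  "split_off k = [[Outer 0, Inner 1], map Outer [1..<k] @ [Inner 0]]"

lemma less_2_cases_ball: "(\<forall>j<2. P j) \<longleftrightarrow> P 0 \<and> P (1::nat)"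
  by (auto simp: less_2_cases_iff)

lemma length_split_off [simp]: "length (split_off k) = 2"
  by (simp add: split_off_def)

lemma split_off_nth:
  "split_off k ! 0 = [Outer 0, Inner 1]" "split_off k ! 1 = map Outer [1..<k] @ [Inner 0]"
  "split_off k ! Suc 0 = map Outer [1..<k] @ [Inner 0]"
  by (simp_all add: split_off_def)

lemma valid_split_off:
  assumes "0 < k"
  shows "valid_duplication k (split_off k)"
proof -
  have "\<exists>!j. j < 2 \<and> Outer p \<in> set (split_off k ! j)" if "p < k" for p
  proof (cases "p = 0")
    case True
    then show ?thesis by (intro ex1I[of _ 0]) (auto simp: split_off_nth less_2_cases_iff)
  next
    case False
    then show ?thesis using that by (intro ex1I[of _ 1]) (auto simp: split_off_nth less_2_cases_iff)
  qed
  then show ?thesis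
    using assms
    by (auto simp: valid_duplication_def less_2_cases_ball split_off_nth distinct_map inj_on_def)
qed

lemma owner_split_off:
  assumes "p < k"
  shows "owner (split_off k) p = (if p = 0 then 0 else 1)"
  unfolding owner_def
  by (rule the_equality) (use assms in \<open>auto simp: split_off_nth less_2_cases_iff split: if_splits\<close>)

lemma connected_on_insert:
  assumes con: "connected_on G T" and y: "y \<in> T" "y \<in> set (G ! w)" "w \<in> set (G ! y)"
  shows "connected_on G (insert w T)"
proof -
  let ?R = "\<lambda>T. {(x, y). x \<in> T \<and> y \<in> T \<and> y \<in> set (G ! x)}"
  have mono: "(?R T)\<^sup>* \<subseteq> (?R (insert w T))\<^sup>*" by (rule rtrancl_mono) auto
  have yw: "(y, w) \<in> (?R (insert w T))\<^sup>*" "(w, y) \<in> (?R (insert w T))\<^sup>*" using y by auto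
  have *: "(a, y) \<in> (?R (insert w T))\<^sup>*" "(y, a) \<in> (?R (insert w T))\<^sup>*" if "a \<in> insert w T" for a
    using that yw mono con y(1) unfolding connected_on_def by blast+
  show ?thesis unfolding connected_on_def
    using * by (meson rtrancl_trans)
qed

locale vertex_split =
  fixes G :: network and v :: nat
  assumes conn: "two_vertex_connected G" and v: "v < length G"
begin

definition G' :: network where
  "G' = enlarge G v (split_off (length (G ! v)))"

abbreviation n :: nat where "n \<equiv> length G"
abbreviation u0 :: nat where "u0 \<equiv> G ! v ! 0"

lemma deg: "2 \<le> length (G ! v)"
  by (rule two_vertex_connected_degree[OF conn v])

lemma nbr: "x < n \<Longrightarrow> y \<in> set (G ! x) \<Longrightarrow> y < n \<and> y \<noteq> x \<and> x \<in> set (G ! y)"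
  and distinct_nbrs: "x < n \<Longrightarrow> distinct (G ! x)"
  using conn unfolding two_vertex_connected_def bidirectional_def by blast+

lemma u0: "u0 \<in> set (G ! v)" "u0 < n" "u0 \<noteq> v"
proof -
  show "u0 \<in> set (G ! v)" using deg by (intro nth_mem) linarith
  then show "u0 < n" "u0 \<noteq> v" using nbr[OF v] by auto
qed

lemma length_G' [simp]: "length G' = Suc n"
  by (simp add: G'_def enlarge_def Let_def)

lemma G'_v: "G' ! v = [u0, n]"
  using v by (simp add: G'_def enlarge_def Let_def nth_append split_off_nth sim_name_def)

lemma G'_n: "G' ! n = tl (G ! v) @ [v]"
proof -
  have "map ((!) (G ! v)) [Suc 0..<length (G ! v)] = tl (G ! v)"
    by (rule nth_equalityI) (auto simp: nth_tl)
  then show ?thesis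
    by (simp add: G'_def enlarge_def Let_def nth_append split_off_nth sim_name_def comp_def)
qed

lemma G'_other:
  assumes "u < n" "u \<noteq> v"
  shows "G' ! u = map (\<lambda>w. if w = v then (if u = u0 then v else n) else w) (G ! u)"
proof -
  have "sim_name n v (owner (split_off (length (G ! v))) (port G v u)) = (if u = u0 then v else n)"
    if "v \<in> set (G ! u)"
  proof -
    have "u \<in> set (G ! v)" using nbr[OF assms(1) that] by simp
    note p = port_correct[OF this]
    have "port G v u = 0 \<longleftrightarrow> u = u0"
      using p nth_eq_iff_index_eq[OF distinct_nbrs[OF v] p(1), of 0] deg by fastforce
    then show ?thesis using owner_split_off[OF p(1)] by (simp add: sim_name_def)
  qed
  then show ?thesis
    using assms by (auto simp: G'_def enlarge_def Let_def nth_append)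
qed

lemma set_tl: "set (tl (G ! v)) = set (G ! v) - {u0}"
  using distinct_nbrs[OF v] deg by (cases "G ! v") auto

lemma nbrs_v: "set (G' ! v) = {u0, n}"
  by (simp add: G'_v)

lemma nbrs_n: "set (G' ! n) = insert v (set (G ! v) - {u0})"
  by (simp add: G'_n set_tl)

lemma nbrs_other:
  "u < n \<Longrightarrow> u \<noteq> v \<Longrightarrow> set (G' ! u) = set (G ! u) - {v} \<union> (if v \<in> set (G ! u) then {if u = u0 then v else n} else {})"
  by (auto simp: G'_other)

lemma adjacent_v: "u < n \<Longrightarrow> v \<in> set (G ! u) \<longleftrightarrow> u \<in> set (G ! v)"
  using nbr v by blast

lemma bidirectional_G': "bidirectional G'"
proof -
  have dist: "distinct (G' ! x) \<and> set (G' ! x) \<subseteq> {..<Suc n} - {x}" if x: "x < Suc n" for x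
  proof -
    consider "x = v" | "x = n" | "x < n" "x \<noteq> v" using x by linarith
    then show ?thesis
    proof cases
      case 1
      then show ?thesis using u0 v by (auto simp: G'_v)
    next
      case 2
      have "v \<notin> set (tl (G ! v))" using nbr[OF v, of v] set_tl by auto
      then have "distinct (G' ! n)" using distinct_nbrs[OF v] by (simp add: G'_n distinct_tl)
      then show ?thesis using 2 v nbr[OF v] by (auto simp: nbrs_n less_SucI)
    next
      case 3
      have "inj_on (\<lambda>w. if w = v then (if x = u0 then v else n) else w) (set (G ! x))"
        using nbr[OF 3(1)] by (auto simp: inj_on_def)
      then have "distinct (G' ! x)"
        using distinct_nbrs[OF 3(1)] by (simp add: G'_other[OF 3] distinct_map)
      then show ?thesis using 3 nbr[OF 3(1)] v by (auto simp: nbrs_other less_SucI split: if_splits)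
    qed
  qed
  have sym: "y \<in> set (G' ! x)" if xy: "x < Suc n" "y < Suc n" "x \<in> set (G' ! y)" for x y
  proof -
    have vn: "v \<noteq> n" using v by simp
    have nn: "w \<noteq> n" if "z < n" "w \<in> set (G ! z)" for w z using nbr[OF that] by simp
    consider "y = v" | "y = n" | "y < n" "y \<noteq> v" using xy by linarith
    then show ?thesis
    proof cases
      case 1
      then have "x = u0 \<or> x = n" using xy(3) by (simp add: nbrs_v)
      then show ?thesis
        using 1 u0 adjacent_v[of u0] by (auto simp: nbrs_n nbrs_other)
    next
      case 2
      then have "x = v \<or> x \<in> set (G ! v) \<and> x \<noteq> u0" using xy(3) by (simp add: nbrs_n)
      then show ?thesis
        using 2 nbr[OF v] by (auto simp: nbrs_v nbrs_other)
    next
      case 3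
      then have "x \<in> set (G ! y) \<and> x \<noteq> v \<or> v \<in> set (G ! y) \<and> x = (if y = u0 then v else n)"
        using xy(3) by (auto simp: nbrs_other split: if_splits)
      then show ?thesis
      proof
        assume x: "x \<in> set (G ! y) \<and> x \<noteq> v"
        then show ?thesis using nbr[OF 3(1), of x] 3 by (auto simp: nbrs_other)
      next
        assume x: "v \<in> set (G ! y) \<and> x = (if y = u0 then v else n)"
        then show ?thesis using nbr[OF 3(1), of v] 3 by (auto simp: nbrs_v nbrs_n)
      qed
    qed
  qed
  show ?thesis unfolding bidirectional_def using dist sym by auto
qed

lemma connected_without_v: "connected_on G' ({..<n} - {v})"
proof -
  let ?T = "{..<n} - {v}"
  have "{(x, y). x \<in> ?T \<and> y \<in> ?T \<and> y \<in> set (G ! x)} = {(x, y). x \<in> ?T \<and> y \<in> ?T \<and> y \<in> set (G' ! x)}"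
    by (auto simp: nbrs_other split: if_splits)
  moreover have "connected_on G ?T" using conn v by (simp add: two_vertex_connected_def)
  ultimately show ?thesis by (simp add: connected_on_def)
qed

text \<open>Old walks through \<open>v\<close> can be rerouted: \<open>u0\<close> remains adjacent
  to \<open>v\<close>, every other neighbour is now adjacent to \<open>n\<close>, and the inner edge
  joins the halves.\<close>

lemma connected_with_both:
  assumes T: "connected_on G T" "v \<in> T" "T \<subseteq> {..<n}"
  shows "connected_on G' (insert n T)"
proof -
  let ?R = "{(x, y). x \<in> T \<and> y \<in> T \<and> y \<in> set (G ! x)}"
  let ?R' = "{(x, y). x \<in> insert n T \<and> y \<in> insert n T \<and> y \<in> set (G' ! x)}"
  have nv: "(n, v) \<in> ?R'\<^sup>*" "(v, n) \<in> ?R'\<^sup>*"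
    using T(2) by (auto simp: nbrs_v nbrs_n)
  have vb: "(v, b) \<in> ?R'\<^sup>* \<and> (b, v) \<in> ?R'\<^sup>*" if b: "b \<in> T" "b \<in> set (G ! v)" for b
  proof -
    have bn: "b < n" "b \<noteq> v" "v \<in> set (G ! b)" using nbr[OF v b(2)] by auto
    show ?thesis
    proof (cases "b = u0")
      case True
      then have "(v, b) \<in> ?R'" "(b, v) \<in> ?R'" using b T(2) bn by (auto simp: nbrs_v nbrs_other)
      then show ?thesis by blast
    next
      case False
      then have "(n, b) \<in> ?R'" "(b, n) \<in> ?R'" using b bn by (auto simp: nbrs_n nbrs_other)
      then show ?thesis using nv by (meson r_into_rtrancl rtrancl_trans)
    qed
  qed
  have "?R \<subseteq> ?R'\<^sup>*"
  proof clarify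
    fix a b assume ab: "a \<in> T" "b \<in> T" "b \<in> set (G ! a)"
    have n: "a < n" "b < n" "b \<noteq> a" "a \<in> set (G ! b)" using nbr[of a b] ab T(3) by auto
    consider "a = v" | "b = v" | "a \<noteq> v" "b \<noteq> v" by blast
    then show "(a, b) \<in> ?R'\<^sup>*"
    proof cases
      case 3
      then have "(a, b) \<in> ?R'" using ab n by (auto simp: nbrs_other)
      then show ?thesis by blast
    qed (use vb ab n in auto)
  qed
  then have sub: "?R\<^sup>* \<subseteq> ?R'\<^sup>*" by (rule rtrancl_subset_rtrancl)
  have *: "(a, v) \<in> ?R'\<^sup>*" "(v, a) \<in> ?R'\<^sup>*" if "a \<in> insert n T" for a
    using that nv T(1,2) sub unfolding connected_on_def by blast+
  show ?thesis unfolding connected_on_def using * by (meson rtrancl_trans)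
qed

text \<open>If one half is removed, the other hangs on the connected rest by an outside edge:
  \<open>n\<close> through port 1, \<open>v\<close> through port 0. If a different vertex is
  removed, the two halves together play the role of \<open>v\<close>.\<close>

lemma two_vertex_connected_G': "two_vertex_connected G'"
proof -
  have tv: "3 \<le> n" "connected_on G {..<n}" "\<And>x. x < n \<Longrightarrow> connected_on G ({..<n} - {x})"
    using conn by (auto simp: two_vertex_connected_def)
  have "connected_on G' ({..<Suc n} - {x})" if x: "x < Suc n" for x
  proof -
    consider "x = v" | "x = n" | "x < n" "x \<noteq> v" using x by linarith
    then show ?thesis
    proof cases
      case 1
      have "G ! v ! 1 \<in> set (G ! v)" using deg by (intro nth_mem) simp
      moreover have "G ! v ! 1 \<noteq> u0"
        using nth_eq_iff_index_eq[OF distinct_nbrs[OF v], of 1 0] deg by fastforce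
      ultimately have "connected_on G' (insert n ({..<n} - {v}))"
        using nbr[OF v, of "G ! v ! 1"]
        by (intro connected_on_insert[OF connected_without_v, of "G ! v ! 1"]) (auto simp: nbrs_n nbrs_other)
      moreover have "insert n ({..<n} - {v}) = {..<Suc n} - {x}" using 1 v by auto
      ultimately show ?thesis by simp
    next
      case 2
      have "connected_on G' (insert v ({..<n} - {v}))"
        using u0 adjacent_v[of u0]
        by (intro connected_on_insert[OF connected_without_v, of u0]) (auto simp: nbrs_v nbrs_other)
      moreover have "insert v ({..<n} - {v}) = {..<Suc n} - {x}" using 2 v by auto
      ultimately show ?thesis by simp
    next
      case 3
      have "connected_on G' (insert n ({..<n} - {x}))"
        using 3 v by (intro connected_with_both tv(3)) auto
      moreover have "insert n ({..<n} - {x}) = {..<Suc n} - {x}" using 3 by auto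
      ultimately show ?thesis by simp
    qed
  qed
  moreover have "connected_on G' {..<Suc n}"
    using connected_with_both[OF tv(2)] v by (simp add: lessThan_Suc)
  ultimately show ?thesis
    using bidirectional_G' tv(1) by (simp add: two_vertex_connected_def)
qed

end

section \<open>Coupling the split agent with an honest run\<close>

primrec first_decision :: "(step \<times> msg list) list \<Rightarrow> outval option" where
  "first_decision [] = None"
| "first_decision (x # xs) = (case decision (fst x) of None \<Rightarrow> first_decision xs | Some d \<Rightarrow> Some d)"

lemma first_decision_append [simp]:
  "first_decision (xs @ [x]) = (case first_decision xs of None \<Rightarrow> decision (fst x) | Some d \<Rightarrow> Some d)"
  by (induction xs) (auto split: option.splits)

text \<open>What the simulated agents appear to have output, the cheater's own output being hidden.\<close>

definition apparent :: "config \<Rightarrow> config" where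
  "apparent c = c\<lparr>pref := (\<lambda>u. if u < length (net c) then pref c u else undefined),
     out := (\<lambda>u. if u < length (net c) then first_decision (hist c u) else None)\<rparr>"

text \<open>\<open>Zero\<close> is never output: staying silent keeps open that a twin is elected in
  a later round.\<close>

definition twin_output :: "step \<Rightarrow> step \<Rightarrow> outval option" where
  "twin_output s t = (if decision s = Some One \<or> decision t = Some One then Some One else None)"

definition twin_strategy :: "algorithm \<Rightarrow> strategy" where
  "twin_strategy \<Lambda> hs = map_pmf (\<lambda>(s, t). ([s, t], twin_output s t)) (pair_pmf (\<Lambda> (hs ! 0)) (\<Lambda> (hs ! 1)))"

lemma apparent_simps [simp]:
  "net (apparent c) = net c" "ident (apparent c) = ident c" "hist (apparent c) = hist c"
  "u < length (net c) \<Longrightarrow> out (apparent c) u = first_decision (hist c u)"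
  "u < length (net c) \<Longrightarrow> local_view (apparent c) u = local_view c u"
  by (auto simp: apparent_def local_view_def)

lemma apparent_advance:
  assumes "\<And>u. length (net c) \<le> u \<Longrightarrow> decision (s u) = None"
  shows "apparent (advance c s ds) = advance (apparent c) s (\<lambda>u. decision (s u))"
  using assms by (auto simp: apparent_def advance_def fun_eq_iff split: option.splits)

text \<open>The twins draw their steps independently, so the steps of all \<open>n + 1\<close> names
  follow the honest product distribution; only the output recorded for \<open>v\<close> is
  special.\<close>

lemma cheat_round_twin:
  assumes v: "v < n" and len: "length (net c) = Suc n"
  shows "cheat_round \<Lambda> v [v, n] (twin_strategy \<Lambda>) c =
    map_pmf (\<lambda>s. advance c s ((\<lambda>u. decision (s u))(v := twin_output (s v) (s n))))
      (Pi_pmf {..<length (net c)} idle (\<lambda>u. \<Lambda> (local_view c u)))"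
proof -
  let ?P = "\<lambda>u. \<Lambda> (local_view c u)" and ?A = "{..<length (net c)}"
  let ?D = "Pi_pmf (?A - {v, n}) idle ?P"
  let ?F = "\<lambda>s. advance c s ((\<lambda>u. decision (s u))(v := twin_output (s v) (s n)))"
  have A: "?A = insert v (insert n (?A - {v, n}))" using v len by auto
  have "Pi_pmf ?A idle ?P = bind_pmf (?P v) (\<lambda>y. bind_pmf (?P n) (\<lambda>z. bind_pmf ?D (\<lambda>h. return_pmf (h(n := z, v := y)))))"
    by (subst A, subst Pi_pmf_insert, use v in simp, use v in simp, subst Pi_pmf_insert)
      (simp_all add: map_pmf_def pair_pmf_def bind_assoc_pmf bind_return_pmf)
  then have "map_pmf ?F (Pi_pmf ?A idle ?P) =
      bind_pmf (?P v) (\<lambda>y. bind_pmf (?P n) (\<lambda>z. bind_pmf ?D (\<lambda>h. return_pmf (?F (h(n := z, v := y))))))"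
    by (simp add: map_pmf_def bind_assoc_pmf bind_return_pmf)
  also have "\<dots> = bind_pmf (?P v) (\<lambda>y. bind_pmf ?D (\<lambda>h. bind_pmf (?P n) (\<lambda>z. return_pmf (?F (h(n := z, v := y))))))"
    by (subst bind_commute_pmf) (rule refl)
  also have "\<dots> = bind_pmf ?D (\<lambda>h. bind_pmf (?P v) (\<lambda>y. bind_pmf (?P n) (\<lambda>z. return_pmf (?F (h(n := z, v := y))))))"
    by (rule bind_commute_pmf)
  also have "\<dots> = cheat_round \<Lambda> v [v, n] (twin_strategy \<Lambda>) c"
  proof -
    have "?F (h(n := z, v := y)) = (let s = (\<lambda>u. case map_of (zip [v, n] [y, z]) u of Some x \<Rightarrow> x | None \<Rightarrow> h u)
         in advance c s ((\<lambda>u. decision (s u))(v := twin_output y z)))" for h y z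
    proof -
      have "(\<lambda>u. case map_of (zip [v, n] [y, z]) u of Some x \<Rightarrow> x | None \<Rightarrow> h u) = h(n := z, v := y)"
        using v by (auto simp: fun_eq_iff)
      then show ?thesis using v by (simp only: Let_def) simp
    qed
    then show ?thesis
      by (simp add: cheat_round_def twin_strategy_def map_pmf_def pair_pmf_def bind_assoc_pmf bind_return_pmf)
  qed
  finally show ?thesis ..
qed

lemma apparent_cheat_round:
  assumes v: "v < n" and len: "length (net c) = Suc n"
  shows "map_pmf apparent (cheat_round \<Lambda> v [v, n] (twin_strategy \<Lambda>) c) = honest_round \<Lambda> (apparent c)"
proof -
  have "Pi_pmf {..<length (net c)} idle (\<lambda>u. \<Lambda> (local_view (apparent c) u)) =
      Pi_pmf {..<length (net c)} idle (\<lambda>u. \<Lambda> (local_view c u))"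
    by (rule Pi_pmf_cong) auto
  then show ?thesis
    unfolding cheat_round_twin[OF assms] honest_round_def pmf.map_comp apparent_simps(1)
    by (auto intro!: map_pmf_cong apparent_advance simp: set_Pi_pmf PiE_dflt_def idle_def)
qed

text \<open>With the cheater's output hidden, the cheating run is distributed exactly as an honest
  run on the enlarged network, so fairness among \<open>n + 1\<close> agents applies to it.\<close>

lemma apparent_cheat_run:
  assumes v: "v < n" and len: "length (net c) = Suc n"
  shows "map_pmf apparent (cheat_run \<Lambda> v [v, n] (twin_strategy \<Lambda>) c k) = honest_run \<Lambda> (apparent c) k"
proof (induction k)
  case (Suc k)
  have "map_pmf apparent (cheat_run \<Lambda> v [v, n] (twin_strategy \<Lambda>) c (Suc k)) =
      bind_pmf (cheat_run \<Lambda> v [v, n] (twin_strategy \<Lambda>) c k) (\<lambda>d. honest_round \<Lambda> (apparent d))"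
    using apparent_cheat_round[OF v] net_cheat_run[of _ \<Lambda> v "[v, n]" "twin_strategy \<Lambda>" c k] len
    by (simp add: map_bind_pmf cong: bind_pmf_cong_simp)
  also have "\<dots> = honest_run \<Lambda> (apparent c) (Suc k)"
    by (simp add: Suc.IH[symmetric] bind_map_pmf)
  finally show ?case .
qed simp

definition twin_invariant :: "nat \<Rightarrow> nat \<Rightarrow> config \<Rightarrow> bool" where
  "twin_invariant n v c \<longleftrightarrow> length (net c) = Suc n \<and>
     (\<forall>u<n. u \<noteq> v \<longrightarrow> out c u = first_decision (hist c u)) \<and>
     (out c v = None \<or> out c v = Some One) \<and>
     (first_decision (hist c v) = Some One \<or> first_decision (hist c n) = Some One \<longrightarrow> out c v = Some One)"

lemma twin_invariant_round:
  assumes v: "v < n" and inv: "twin_invariant n v c"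
    and d: "d \<in> set_pmf (cheat_round \<Lambda> v [v, n] (twin_strategy \<Lambda>) c)"
  shows "twin_invariant n v d"
proof -
  have len: "length (net c) = Suc n" using inv by (simp add: twin_invariant_def)
  obtain s where d: "d = advance c s ((\<lambda>u. decision (s u))(v := twin_output (s v) (s n)))"
    using d unfolding cheat_round_twin[OF v len] by auto
  have lt: "v < length (net c)" "n < length (net c)" "u < n \<Longrightarrow> u < length (net c)" for u using v len by auto
  have i: "out c v = None \<or> out c v = Some One"
    "first_decision (hist c v) = Some One \<or> first_decision (hist c n) = Some One \<Longrightarrow> out c v = Some One"
    "u < n \<Longrightarrow> u \<noteq> v \<Longrightarrow> out c u = first_decision (hist c u)" for u
    using inv by (auto simp: twin_invariant_def)
  have other: "out d u = first_decision (hist d u)" if "u < n" "u \<noteq> v" for u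
    using that lt(3)[OF that(1)] i(3)[OF that] by (cases "first_decision (hist c u)") (simp_all add: d)
  show ?thesis
  proof (cases "out c v")
    case (Some x)
    then have "out d v = Some One" using i(1) by (auto simp: d)
    moreover have "length (net d) = Suc n" using len by (simp add: d)
    ultimately show ?thesis using other by (simp add: twin_invariant_def)
  next
    case None
    then have ov: "out d v = twin_output (s v) (s n)" by (simp add: d)
    have "decision (s v) = Some One \<or> decision (s n) = Some One"
      if "first_decision (hist d v) = Some One \<or> first_decision (hist d n) = Some One"
    proof -
      have step: "first_decision (hist c w) = Some One \<or> decision (s w) = Some One"
        if "first_decision (hist d w) = Some One" "w < length (net c)" for w
        using that by (cases "first_decision (hist c w)") (simp_all add: d)
      have "first_decision (hist c v) \<noteq> Some One" "first_decision (hist c n) \<noteq> Some One"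
        using i(2) None by (metis option.distinct(1))+
      then show ?thesis using that step[OF _ lt(1)] step[OF _ lt(2)] by blast
    qed
    moreover have "length (net d) = Suc n" using len by (simp add: d)
    ultimately show ?thesis using other ov by (simp add: twin_invariant_def twin_output_def)
  qed
qed

lemma twin_invariant_run:
  assumes v: "v < n" and inv: "twin_invariant n v c"
    and "d \<in> set_pmf (cheat_run \<Lambda> v [v, n] (twin_strategy \<Lambda>) c k)"
  shows "twin_invariant n v d"
  using assms(3)
proof (induction k arbitrary: d)
  case (Suc k)
  then obtain d' where d': "d' \<in> set_pmf (cheat_run \<Lambda> v [v, n] (twin_strategy \<Lambda>) c k)"
    "d \<in> set_pmf (cheat_round \<Lambda> v [v, n] (twin_strategy \<Lambda>) d')"
    by auto
  show ?case by (rule twin_invariant_round[OF v Suc.IH[OF d'(1)] d'(2)])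
qed (use inv in simp)

text \<open>If a twin is elected among \<open>n + 1\<close> agents, all real agents other than the
  cheater output \<open>Zero\<close>. Merging the twins into one agent with output
  \<open>One\<close> is thus legal for the \<open>n\<close> real agents.\<close>

lemma twin_utility:
  assumes v: "v < n" and inv: "twin_invariant n v c"
    and el: "elected (Suc n) v (out (apparent c)) \<or> elected (Suc n) n (out (apparent c))"
  shows "utility n v One (out c) = 1"
proof -
  have len: "length (net c) = Suc n" using inv by (simp add: twin_invariant_def)
  obtain a where a: "a = v \<or> a = n" "legal (Suc n) (out (apparent c))" "out (apparent c) a = Some One"
    using el by (auto simp: elected_def)
  have "first_decision (hist c a) = Some One" using a(1,3) v len by auto
  then have "out c v = Some One" using inv a(1) by (auto simp: twin_invariant_def)
  moreover have "out c u = Some Zero" if "u < n" "u \<noteq> v" for u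
  proof -
    obtain b where b: "b < Suc n" "out (apparent c) b = Some One"
      "\<And>w. w < Suc n \<Longrightarrow> w \<noteq> b \<Longrightarrow> out (apparent c) w = Some Zero"
      using a(2) by (auto simp: legal_def)
    have "b = a" using b(3)[of a] a v by (auto simp: less_Suc_eq)
    then have "out (apparent c) u = Some Zero" using b(3)[of u] that a(1) by auto
    then show ?thesis using inv that len by (simp add: twin_invariant_def)
  qed
  ultimately show ?thesis using v by (auto simp: utility_def legal_def)
qed

lemma elected_disjoint:
  assumes "elected n a os" "elected n b os" "a < n" "b < n"
  shows "a = b"
  using assms legal_unique[of n os a b] by (simp add: elected_def)

text \<open>At most one twin is elected in any outcome, so the two probabilities add up.\<close>

lemma twin_cheat_value:
  assumes v: "v < n" and inv: "twin_invariant n v c" and p: "pref c v = One"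
  shows "election_prob \<Lambda> (apparent c) v + election_prob \<Lambda> (apparent c) n \<le>
    cheat_value \<Lambda> n v [v, n] (twin_strategy \<Lambda>) c"
proof (rule LIMSEQ_le_const2)
  have len: "length (net c) = Suc n" using inv by (simp add: twin_invariant_def)
  let ?P = "\<lambda>a k. measure_pmf.prob (honest_run \<Lambda> (apparent c) k) {c'. elected (Suc n) a (out c')}"
  show "(\<lambda>k. ?P v k + ?P n k) \<longlonglongrightarrow> election_prob \<Lambda> (apparent c) v + election_prob \<Lambda> (apparent c) n"
    using election_prob_limit[of v "apparent c" \<Lambda>] election_prob_limit[of n "apparent c" \<Lambda>] v len
    by (intro tendsto_add) simp_all
  show "\<exists>k0. \<forall>k\<ge>k0. ?P v k + ?P n k \<le> cheat_value \<Lambda> n v [v, n] (twin_strategy \<Lambda>) c"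
  proof (intro exI allI impI)
    fix k :: nat
    let ?run = "cheat_run \<Lambda> v [v, n] (twin_strategy \<Lambda>) c k"
    let ?E = "\<lambda>a. {d. elected (Suc n) a (out (apparent d))}"
    have "?P a k = measure_pmf.prob ?run (?E a)" for a
      unfolding apparent_cheat_run[OF v len, symmetric] by (simp add: vimage_def)
    then have "?P v k + ?P n k = measure_pmf.prob ?run (?E v) + measure_pmf.prob ?run (?E n)" by simp
    also have "\<dots> = measure_pmf.prob ?run (?E v \<union> ?E n)"
      using v by (intro measure_pmf.finite_measure_Union[symmetric]) (auto dest: elected_disjoint)
    also have "\<dots> = measure_pmf.expectation ?run (\<lambda>d. if d \<in> ?E v \<union> ?E n then 1 else 0)"
      unfolding expectation_indicator_pmf by (simp only: Collect_mem_eq)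
    also have "\<dots> \<le> measure_pmf.expectation ?run (\<lambda>d. utility n v (pref c v) (out d))"
    proof (rule expectation_pmf_mono)
      fix d assume "d \<in> set_pmf ?run"
      then have "twin_invariant n v d" by (rule twin_invariant_run[OF v inv])
      from twin_utility[OF v this]
      show "(if d \<in> ?E v \<union> ?E n then 1 else 0) \<le> utility n v (pref c v) (out d)"
        using p by (auto simp: utility_unit)
    qed (auto simp: utility_unit)
    also have "\<dots> \<le> cheat_value \<Lambda> n v [v, n] (twin_strategy \<Lambda>) c" by (rule cheat_value_limit(4)[OF v])
    finally show "?P v k + ?P n k \<le> cheat_value \<Lambda> n v [v, n] (twin_strategy \<Lambda>) c" .
  qed
qed

section \<open>The profit of the split under fairness\<close>

text \<open>Legality is the disjoint union of the events that a given agent is elected; in the limit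
  these have total probability 1, and fairness makes them equally likely.\<close>

lemma fair_election_prob:
  assumes le: "leader_election I \<alpha> \<beta> \<Lambda>" and fair: "fair I \<alpha> \<beta> \<Lambda>" and c: "c \<in> instances I \<alpha> \<beta>"
    and a: "a < length (net c)"
  shows "election_prob \<Lambda> c a = 1 / real (length (net c))"
proof -
  let ?n = "length (net c)"
  let ?P = "\<lambda>a k. measure_pmf.prob (honest_run \<Lambda> c k) {c'. elected ?n a (out c')}"
  have "(\<Sum>b<?n. ?P b k) = measure_pmf.prob (honest_run \<Lambda> c k) {c'. legal ?n (out c')}" for k
  proof -
    have leg: "{c'. legal ?n (out c')} = (\<Union>b\<in>{..<?n}. {c'. elected ?n b (out c')})"
      by (auto simp: elected_def legal_def)
    show ?thesis
      unfolding leg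
      by (rule measure_pmf.finite_measure_finite_Union[symmetric])
        (auto simp: disjoint_family_on_def dest: elected_disjoint)
  qed
  moreover have "(\<lambda>k. \<Sum>b<?n. ?P b k) \<longlonglongrightarrow> (\<Sum>b<?n. election_prob \<Lambda> c b)"
    by (intro tendsto_sum election_prob_limit) simp
  moreover have "(\<lambda>k. measure_pmf.prob (honest_run \<Lambda> c k) {c'. legal ?n (out c')}) \<longlonglongrightarrow> 1"
    using le c by (auto simp: leader_election_def)
  ultimately have "(\<Sum>b<?n. election_prob \<Lambda> c b) = 1" by (auto intro: LIMSEQ_unique)
  moreover have "election_prob \<Lambda> c b = election_prob \<Lambda> c a" if "b < ?n" for b
    using fair c a that unfolding fair_def by blast
  ultimately have "real ?n * election_prob \<Lambda> c a = 1" by simp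
  moreover have "real ?n \<noteq> 0" using a by linarith
  ultimately show ?thesis by (simp add: nonzero_eq_divide_eq mult.commute)
qed

lemma honest_value_One: "pref c v = One \<Longrightarrow> honest_value \<Lambda> v c = election_prob \<Lambda> c v"
  unfolding honest_value_def election_prob_def expectation_indicator_pmf[symmetric] elected_utility
  by simp

text \<open>\<open>length G < \<beta>\<close> has two effects: the split goes undetected, and the
  enlarged network is still an instance, where each twin is elected with probability
  \<open>1 / (n + 1)\<close>.\<close>

lemma split_duplication_value:
  assumes le: "leader_election I \<alpha> \<beta> \<Lambda>" and fair: "fair I \<alpha> \<beta> \<Lambda>"
    and G: "two_vertex_connected G" "\<alpha> \<le> length G" "length G < \<beta>" and v: "v < length G"
    and ids: "ids \<in> injections {..<length G} I" and prefs: "prefs \<in> {..<length G} \<rightarrow>\<^sub>E {Zero, One}"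
    and p: "prefs v = One" and I: "finite I" "\<beta> \<le> card I"
  shows "2 / (real (length G) + 1) \<le>
    duplication_value I \<beta> \<Lambda> v (split_off (length (G ! v))) (twin_strategy \<Lambda>) (init_config G ids prefs)"
proof -
  interpret vertex_split G v by unfold_locales (use G v in auto)
  let ?c = "init_config G ids prefs" and ?S = "split_off (length (G ! v))"
  let ?J = "injections {n..<Suc n} (I - ids ` {..<n})"
  have ids': "inj_on ids {..<n}" "ids ` {..<n} \<subseteq> I" using ids by (auto simp: injections_def)
  have "card (I - ids ` {..<n}) = card I - n"
    using ids' I by (subst card_Diff_subset) (auto simp: card_image)
  \<comment> \<open>\<open>length G < \<beta> \<le> card I\<close> leaves a fresh id for the second
    twin.\<close>
  then have "finite ?J" "?J \<noteq> {}"
    using I G finite_injections[of "I - ids ` {..<n}"] injections_nonempty[of "I - ids ` {..<n}" "{n..<Suc n}"]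
    by simp_all
  then have set: "set_pmf (pmf_of_set ?J) = ?J" by simp
  have val: "2 / (real n + 1) \<le> cheat_value \<Lambda> n v [v, n] (twin_strategy \<Lambda>) c2"
    if mem: "c2 \<in> set_pmf (duplicate I v ?S ?c)" for c2
  proof -
    have "c2 \<in> (\<lambda>f. ?c\<lparr>net := G', ident := (\<lambda>u. if u < n then ids u else f u),
        pref := (\<lambda>u. if u < n then prefs u else prefs v)\<rparr>) ` ?J"
      using mem set by (simp add: duplicate_def Let_def G'_def cong: if_cong)
    then obtain f where f: "f \<in> ?J" and c2: "c2 = ?c\<lparr>net := G', ident := (\<lambda>u. if u < n then ids u else f u),
        pref := (\<lambda>u. if u < n then prefs u else prefs v)\<rparr>"
      by blast
    define ids2 where "ids2 = (\<lambda>u. if u < n then ids u else f u)"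
    \<comment> \<open>\<open>instances\<close> asks for extensional functions;
      \<open>apparent\<close> therefore makes preferences undefined beyond the \<open>n + 1\<close>
      agents.\<close>
    define prefs2 where "prefs2 = (\<lambda>u. if u < Suc n then (if u < n then prefs u else prefs v) else undefined)"
    have app: "apparent c2 = init_config G' ids2 prefs2"
      by (simp add: apparent_def c2 init_config_def ids2_def prefs2_def cong: if_cong)
    have fn: "f n \<in> I - ids ` {..<n}" "\<And>u. u \<notin> {n..<Suc n} \<Longrightarrow> f u = undefined"
    proof -
      have f': "f \<in> {n..<Suc n} \<rightarrow>\<^sub>E I - ids ` {..<n}" using f by (simp add: injections_def)
      show "f n \<in> I - ids ` {..<n}" by (rule PiE_mem[OF f']) simp
      show "f u = undefined" if "u \<notin> {n..<Suc n}" for u by (rule PiE_arb[OF f' that])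
    qed
    have "ids2 \<in> {..<Suc n} \<rightarrow>\<^sub>E I"
    proof (rule PiE_I)
      fix u assume "u \<in> {..<Suc n}"
      then consider "u < n" | "u = n" by fastforce
      then show "ids2 u \<in> I"
        by cases (use ids'(2) fn(1) in \<open>auto simp: ids2_def\<close>)
    next
      fix u assume "u \<notin> {..<Suc n}"
      then show "ids2 u = undefined" using fn(2)[of u] by (simp add: ids2_def)
    qed
    moreover have "inj_on ids2 {..<Suc n}"
    proof -
      have "inj_on ids2 {..<n}" using ids'(1) by (simp add: inj_on_def ids2_def)
      moreover have "ids2 n \<notin> ids2 ` {..<n}" using fn(1) by (auto simp: ids2_def)
      ultimately show ?thesis by (simp add: lessThan_Suc)
    qed
    ultimately have ids2: "ids2 \<in> injections {..<length G'} I" by (simp add: injections_def)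
    have prefs2: "prefs2 \<in> {..<length G'} \<rightarrow>\<^sub>E {Zero, One}"
    proof (rule PiE_I)
      fix u assume "u \<in> {..<length G'}"
      then show "prefs2 u \<in> {Zero, One}"
        using PiE_mem[OF prefs, of u] PiE_mem[OF prefs, of v] v by (simp add: prefs2_def)
    qed (simp add: prefs2_def)
    have inst: "apparent c2 \<in> instances I \<alpha> \<beta>"
      unfolding app instances_def mem_Collect_eq
      by (intro exI[of _ G'] exI[of _ ids2] exI[of _ prefs2])
        (use G two_vertex_connected_G' ids2 prefs2 in simp)
    have inv: "twin_invariant n v c2"
      by (simp add: twin_invariant_def c2 init_config_def)
    have "election_prob \<Lambda> (apparent c2) a = 1 / (real n + 1)" if "a < Suc n" for a
      using fair_election_prob[OF le fair inst, of a] that by (simp add: c2 add.commute)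
    then have "2 / (real n + 1) = election_prob \<Lambda> (apparent c2) v + election_prob \<Lambda> (apparent c2) n"
      using v by simp
    also have "\<dots> \<le> cheat_value \<Lambda> n v [v, n] (twin_strategy \<Lambda>) c2"
      by (rule twin_cheat_value[OF v inv]) (use p v in \<open>simp add: c2\<close>)
    finally show ?thesis .
  qed
  have "2 / (real n + 1) = measure_pmf.expectation (duplicate I v ?S ?c) (\<lambda>_. 2 / (real n + 1))" by simp
  also have "\<dots> \<le> measure_pmf.expectation (duplicate I v ?S ?c) (cheat_value \<Lambda> n v [v, n] (twin_strategy \<Lambda>))"
    by (rule expectation_pmf_mono) (use val cheat_value_limit(3)[OF v] in auto)
  also have "\<dots> = duplication_value I \<beta> \<Lambda> v ?S (twin_strategy \<Lambda>) ?c"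
    using G by (simp add: duplication_value_def Let_def)
  finally show ?thesis .
qed

section \<open>Averaging over the prior\<close>

lemma prefs_prob:
  fixes v n :: nat
  assumes "v < n"
  shows "measure_pmf.prob (pmf_of_set ({..<n} \<rightarrow>\<^sub>E {Zero, One})) {prefs. prefs v = One} = 1 / 2"
proof -
  let ?X = "{..<n} \<rightarrow>\<^sub>E {Zero, One}"
  let ?B = "\<lambda>i. if i = v then {One} else {Zero, One}"
  have X: "finite ?X" "?X \<noteq> {}" by (auto intro!: finite_PiE simp: PiE_eq_empty_iff)
  have split: "(\<Prod>i<n. g i) = g v * (\<Prod>i\<in>{..<n} - {v}. g i)" for g :: "nat \<Rightarrow> nat"
    using assms by (intro prod.remove) auto
  have "?X \<inter> {prefs. prefs v = One} = PiE {..<n} ?B"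
  proof (intro equalityI subsetI)
    fix f assume f: "f \<in> ?X \<inter> {prefs. prefs v = One}"
    then have f': "f \<in> ?X" "f v = One" by auto
    show "f \<in> PiE {..<n} ?B"
      by (rule PiE_I) (use PiE_mem[OF f'(1)] PiE_arb[OF f'(1)] f'(2) in auto)
  next
    fix f assume f: "f \<in> PiE {..<n} ?B"
    have "f \<in> ?X"
    proof (rule PiE_I)
      fix i assume "i \<in> {..<n}"
      from PiE_mem[OF f this] show "f i \<in> {Zero, One}" by (cases "i = v") simp_all
    qed (use PiE_arb[OF f] in auto)
    moreover have "f v = One" using PiE_mem[OF f, of v] assms by simp
    ultimately show "f \<in> ?X \<inter> {prefs. prefs v = One}" by simp
  qed
  then have "card (?X \<inter> {prefs. prefs v = One}) = (\<Prod>i<n. card (?B i))"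
    by (simp add: card_PiE)
  also have "\<dots> = (\<Prod>i\<in>{..<n} - {v}. 2)" unfolding split by (auto simp: numeral_2_eq_2)
  finally have c1: "card (?X \<inter> {prefs. prefs v = One}) = (\<Prod>i\<in>{..<n} - {v}. 2)" .
  have "card ?X = (\<Prod>i<n. 2)" by (simp add: card_PiE numeral_2_eq_2)
  also have "\<dots> = 2 * (\<Prod>i\<in>{..<n} - {v}. 2)" by (rule split)
  finally show ?thesis using X c1 by (simp add: measure_pmf_of_set)
qed

text \<open>The preference is a fair coin independent of network and position. Only the size
  distribution remains, with a factor 1/2 that cancels in the comparison.\<close>

lemma prior_start_expectation:
  assumes \<mu>: "\<And>G v. (G, v) \<in> set_pmf \<mu> \<Longrightarrow> v < length G"
    and unit: "\<And>t. 0 \<le> \<psi> t" "\<And>t. \<psi> t \<le> (1::real)"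
  shows "measure_pmf.expectation (prior_start I \<mu>)
      (\<lambda>(v, c). if pref c v = One then \<psi> (length (net c)) else 0) =
    measure_pmf.expectation (map_pmf (\<lambda>(G, v). length G) \<mu>) \<psi> / 2"
proof -
  let ?u = "\<lambda>(v, c :: config). if pref c v = One then \<psi> (length (net c)) else 0"
  have u: "0 \<le> ?u x" "?u x \<le> 1" for x using unit by (auto split: prod.split)
  have "measure_pmf.expectation (prior_start I \<mu>) ?u =
      measure_pmf.expectation \<mu> (\<lambda>x. measure_pmf.expectation (case x of (G, v) \<Rightarrow>
     bind_pmf (pmf_of_set (injections {..<length G} I)) (\<lambda>ids.
     bind_pmf (pmf_of_set ({..<length G} \<rightarrow>\<^sub>E {Zero, One})) (\<lambda>prefs.
     return_pmf (v, init_config G ids prefs)))) ?u)"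
    unfolding prior_start_def by (rule expectation_bind_pmf_unit[OF u])
  also have "\<dots> = measure_pmf.expectation \<mu> (\<lambda>x. \<psi> (length (fst x)) / 2)"
  proof (rule expectation_pmf_cong)
    fix x assume x: "x \<in> set_pmf \<mu>"
    obtain G v where e: "x = (G, v)" by (cases x)
    then have v: "v < length G" using \<mu> x by simp
    let ?M = "pmf_of_set ({..<length G} \<rightarrow>\<^sub>E {Zero, One})"
    have "measure_pmf.expectation (case x of (G, v) \<Rightarrow>
     bind_pmf (pmf_of_set (injections {..<length G} I)) (\<lambda>ids.
     bind_pmf (pmf_of_set ({..<length G} \<rightarrow>\<^sub>E {Zero, One})) (\<lambda>prefs.
     return_pmf (v, init_config G ids prefs)))) ?u =
      measure_pmf.expectation (pmf_of_set (injections {..<length G} I)) (\<lambda>ids.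
        measure_pmf.expectation ?M (\<lambda>prefs. ?u (v, init_config G ids prefs)))"
      unfolding e prod.case by (simp only: expectation_bind_pmf_unit[OF u]) simp
    also have "\<dots> = measure_pmf.expectation ?M (\<lambda>prefs. \<psi> (length G) * (if prefs v = One then 1 else 0))"
      by (simp add: mult_if_delta if_distrib cong: if_cong)
    also have "\<dots> = \<psi> (length G) / 2"
      by (simp only: integral_mult_right_zero expectation_indicator_pmf prefs_prob[OF v])
    finally show "measure_pmf.expectation (case x of (G, v) \<Rightarrow>
     bind_pmf (pmf_of_set (injections {..<length G} I)) (\<lambda>ids.
     bind_pmf (pmf_of_set ({..<length G} \<rightarrow>\<^sub>E {Zero, One})) (\<lambda>prefs.
     return_pmf (v, init_config G ids prefs)))) ?u = \<psi> (length (fst x)) / 2" by (simp add: e)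
  qed
  also have "\<dots> = measure_pmf.expectation (map_pmf (\<lambda>(G, v). length G) \<mu>) \<psi> / 2"
    by (simp add: case_prod_beta)
  finally show ?thesis .
qed

lemma executions_0: "executions I \<mu> \<Lambda> 0 = prior_start I \<mu>"
  by (simp add: executions_def bind_return_pmf')

text \<open>The preference is part of the view, so the averaging can be confined to agents that
  prefer \<open>One\<close>. Their honest value is \<open>1 / n\<close>, and the split earns at
  least \<open>\<phi> n\<close>, set to 0 at \<beta> because the split is detected there. The guard
  \<open>0 < t\<close> keeps \<open>\<phi>\<close> below or at 1.\<close>

lemma no_profit_on_average:
  assumes eq: "equilibrium I \<beta> \<mu> \<Lambda>" and \<mu>: "geometric_prior \<alpha> \<beta> \<mu>" and I: "finite I" "\<beta> \<le> card I"
    and le: "leader_election I \<alpha> \<beta> \<Lambda>" and fair: "fair I \<alpha> \<beta> \<Lambda>"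
  defines "\<phi> \<equiv> \<lambda>t. if 0 < t \<and> t < \<beta> then 2 / (real t + 1) else 0"
  shows "measure_pmf.expectation (prior_start I \<mu>) (\<lambda>(v, c). if pref c v = One then \<phi> (length (net c)) else 0)
    \<le> measure_pmf.expectation (prior_start I \<mu>) (\<lambda>(v, c). if pref c v = One then 1 / real (length (net c)) else 0)"
proof -
  let ?P = "prior_start I \<mu>"
  define w where "w = (\<lambda>(v, c). local_view c v)"
  \<comment> \<open>The cut-off outside the network keeps \<open>f\<close> and \<open>g\<close>
    within [0, 1] everywhere; starts of the prior never meet it.\<close>
  define f where "f = (\<lambda>(v, c). if v < length (net c) then honest_value \<Lambda> v c else 0)"
  define g where "g = (\<lambda>(v, c). if v < length (net c)
    then duplication_value I \<beta> \<Lambda> v (split_off (length (net c ! v))) (twin_strategy \<Lambda>) c else 0)"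
  have unit: "0 \<le> f x" "f x \<le> 1" "0 \<le> g x" "g x \<le> 1" for x
    using honest_value_limit(2,3) duplication_value_unit by (auto simp: f_def g_def split: prod.split)
  have start: "possible_start I \<mu> v c" if "(v, c) \<in> set_pmf ?P" for v c
    by (rule prior_start_support[OF I(1) _ that])
      (use geometric_prior_support(4)[OF \<mu>] I(2) in \<open>auto intro: order_trans\<close>)
  have vlen: "v < length (net c)" "2 \<le> length (net c ! v)" if "(v, c) \<in> set_pmf ?P" for v c
    using start[OF that] geometric_prior_support[OF \<mu>] two_vertex_connected_degree
    by (auto simp: possible_start_def)
  have avg: "measure_pmf.expectation ?P (\<lambda>x. if my_pref (w x) = One then g x else 0) \<le>
      measure_pmf.expectation ?P (\<lambda>x. if my_pref (w x) = One then f x else 0)"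
  proof (rule expectation_le_of_cond_le[where Q = "\<lambda>h. my_pref h = One" and w = w, OF unit])
    fix x assume x: "x \<in> set_pmf ?P"
    define h where "h = w x"
    have cons: "consistent h = {y. w y = h}" by (auto simp: consistent_def w_def)
    have ne: "set_pmf ?P \<inter> {y. w y = h} \<noteq> {}" using x by (auto simp: h_def)
    then have imp: "set_pmf (executions I \<mu> \<Lambda> 0) \<inter> consistent h \<noteq> {}" by (simp add: executions_0 cons)
    let ?B = "cond_pmf ?P {y. w y = h}"
    have bel: "belief I \<mu> \<Lambda> 0 h = ?B" by (simp add: belief_def executions_0 cons)
    have B: "set_pmf ?B = set_pmf ?P \<inter> {y. w y = h}" by (rule set_cond_pmf[OF ne])
    have "2 \<le> my_degree h" using vlen(2)[of "fst x" "snd x"] x by (simp add: h_def w_def case_prod_beta)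
    then have "0 < my_degree h" by linarith
    \<comment> \<open>The split is determined by the degree in the view, hence is one and the same
      deviation in all configurations considered possible.\<close>
    then have S: "valid_duplication (my_degree h) (split_off (my_degree h)) \<and> 2 \<le> length (split_off (my_degree h))"
      using valid_split_off by simp
    have "measure_pmf.expectation ?B (\<lambda>(v, c). duplication_value I \<beta> \<Lambda> v (split_off (my_degree h)) (twin_strategy \<Lambda>) c)
        \<le> measure_pmf.expectation ?B (\<lambda>(v, c). honest_value \<Lambda> v c)"
      by (rule eq[unfolded equilibrium_def, THEN spec[of _ 0], THEN spec[of _ h], THEN mp, OF imp,
            THEN conjunct2, THEN mp, OF refl, THEN spec, THEN spec, THEN mp, OF S, unfolded bel])
    moreover have "measure_pmf.expectation ?B g = measure_pmf.expectation ?B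
        (\<lambda>(v, c). duplication_value I \<beta> \<Lambda> v (split_off (my_degree h)) (twin_strategy \<Lambda>) c)"
      by (rule expectation_pmf_cong) (use vlen B in \<open>auto simp: g_def w_def\<close>)
    moreover have "measure_pmf.expectation ?B f = measure_pmf.expectation ?B (\<lambda>(v, c). honest_value \<Lambda> v c)"
      by (rule expectation_pmf_cong) (use vlen B in \<open>auto simp: f_def\<close>)
    ultimately show "measure_pmf.expectation (cond_pmf ?P {y. w y = w x}) g \<le>
        measure_pmf.expectation (cond_pmf ?P {y. w y = w x}) f"
      by (simp add: h_def)
  qed
  have vals: "f (v, c) = 1 / real (length (net c))" "\<phi> (length (net c)) \<le> g (v, c)"
    if mem: "(v, c) \<in> set_pmf ?P" "pref c v = One" for v c
  proof -
    obtain G ids prefs where c: "c = init_config G ids prefs" and G: "(G, v) \<in> set_pmf \<mu>"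
      and ids: "ids \<in> injections {..<length G} I" and prefs: "prefs \<in> {..<length G} \<rightarrow>\<^sub>E {Zero, One}"
      using start[OF mem(1)] unfolding possible_start_def by blast
    note G' = geometric_prior_support[OF \<mu> G]
    have "c \<in> instances I \<alpha> \<beta>" unfolding instances_def using c G' ids prefs by blast
    from fair_election_prob[OF le fair this, of v]
    show "f (v, c) = 1 / real (length (net c))"
      using mem(2) G'(2) by (simp add: f_def honest_value_One c)
    show "\<phi> (length (net c)) \<le> g (v, c)"
    proof (cases "length G < \<beta>")
      case True
      have "2 / (real (length G) + 1) \<le> duplication_value I \<beta> \<Lambda> v (split_off (length (G ! v))) (twin_strategy \<Lambda>) c"
        unfolding c by (rule split_duplication_value[OF le fair G'(1,3) True G'(2) ids prefs _ I])
          (use mem(2) in \<open>simp add: c\<close>)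
      then show ?thesis using True G'(2) by (auto simp: \<phi>_def g_def c)
    qed (use unit in \<open>simp add: \<phi>_def c\<close>)
  qed
  have "measure_pmf.expectation ?P (\<lambda>(v, c). if pref c v = One then \<phi> (length (net c)) else 0) \<le>
      measure_pmf.expectation ?P (\<lambda>x. if my_pref (w x) = One then g x else 0)"
  proof (rule expectation_pmf_mono)
    fix x assume x: "x \<in> set_pmf ?P"
    obtain v c where e: "x = (v, c)" by (cases x)
    show "(case x of (v, c) \<Rightarrow> if pref c v = One then \<phi> (length (net c)) else 0) \<le>
        (if my_pref (w x) = One then g x else 0)"
      using vals(2)[of v c] x by (simp add: e w_def)
  qed (use unit in \<open>auto simp: \<phi>_def split: prod.split\<close>)
  also note avg
  also have "measure_pmf.expectation ?P (\<lambda>x. if my_pref (w x) = One then f x else 0) =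
    measure_pmf.expectation ?P (\<lambda>(v, c). if pref c v = One then 1 / real (length (net c)) else 0)"
  proof (rule expectation_pmf_cong)
    fix x assume x: "x \<in> set_pmf ?P"
    obtain v c where e: "x = (v, c)" by (cases x)
    show "(if my_pref (w x) = One then f x else 0) =
        (case x of (v, c) \<Rightarrow> if pref c v = One then 1 / real (length (net c)) else 0)"
      using vals(1)[of v c] x by (simp add: e w_def)
  qed
  finally show ?thesis .
qed

section \<open>The gain at the smallest size against the loss at the largest\<close>

text \<open>With \<open>x\<close> the geometric term at \<beta> and \<open>y\<close> the additive
  constant of the prior, the claim is \<open>3 * x + y < 1\<close>; it follows from
  \<open>x \<le> 1/4\<close> and \<open>y \<le> x / 2\<close>, both due to
  \<open>\<beta> - \<alpha> \<ge> 1\<close>.\<close>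

lemma geometric_first_last:
  assumes "\<alpha> < \<beta>"
  shows "3 * geometric \<alpha> \<beta> \<beta> < 2 * geometric \<alpha> \<beta> \<alpha>"
proof -
  define x :: real where "x = 2 powi (int \<alpha> - int \<beta> - 1)"
  define y where "y = x / (real \<beta> - real \<alpha> + 1)"
  have e: "int \<alpha> - int \<beta> - 1 = - int (\<beta> - \<alpha> + 1)" using assms by simp
  have "x = (1 / 2) ^ (\<beta> - \<alpha> + 1)"
    unfolding x_def e power_int_minus power_int_of_nat by (simp add: power_one_over inverse_eq_divide)
  also have "\<dots> \<le> (1 / 2) ^ 2" using assms by (intro power_decreasing) auto
  finally have x: "0 < x" "x \<le> 1 / 4" by (simp_all add: x_def power2_eq_square)
  have "y \<le> x / 2" unfolding y_def using assms x by (intro divide_left_mono) auto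
  moreover have "geometric \<alpha> \<beta> \<alpha> = 1 / 2 + y" "geometric \<alpha> \<beta> \<beta> = x + y"
    using assms by (simp_all add: geometric_def x_def y_def power_int_minus_divide)
  ultimately show ?thesis using x by simp
qed

lemma geometric_nonneg: "0 \<le> geometric \<alpha> \<beta> t"
  by (simp add: geometric_def)

lemma geometric_expectation:
  assumes "geometric_prior \<alpha> \<beta> \<mu>"
  shows "measure_pmf.expectation (map_pmf (\<lambda>(G, v). length G) \<mu>) \<psi> = (\<Sum>t = \<alpha>..\<beta>. geometric \<alpha> \<beta> t * (\<psi> t :: real))"
proof -
  have p: "pmf (map_pmf (\<lambda>(G, v). length G) \<mu>) t = geometric \<alpha> \<beta> t" for t
    using assms unfolding geometric_prior_def by blast
  have supp: "t \<in> {\<alpha>..\<beta>}" if "t \<in> set_pmf (map_pmf (\<lambda>(G, v). length G) \<mu>)" for t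
    using that unfolding set_pmf_iff p by (auto simp: geometric_def split: if_splits)
  show ?thesis
    by (subst integral_measure_pmf[of "{\<alpha>..\<beta>}"]) (simp_all only: finite_atLeastAtMost supp p real_scaleR_def)
qed

text \<open>Sizes strictly between the ends only help, since \<open>2 / (t + 1) \<ge> 1 / t\<close>.
  What remains is to outweigh the \<open>1 / \<beta>\<close> forfeited at \<beta>, where the split
  is detected.\<close>

lemma no_equilibrium:
  assumes "\<alpha> < \<beta>" and \<mu>: "geometric_prior \<alpha> \<beta> \<mu>" and I: "finite I" "\<beta> \<le> card I"
    and le: "leader_election I \<alpha> \<beta> \<Lambda>" and fair: "fair I \<alpha> \<beta> \<Lambda>"
  shows "\<not> equilibrium I \<beta> \<mu> \<Lambda>"
proof
  assume eq: "equilibrium I \<beta> \<mu> \<Lambda>"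
  define \<phi> where "\<phi> t = (if 0 < t \<and> t < \<beta> then 2 / (real t + 1) else 0)" for t
  let ?P = "geometric \<alpha> \<beta>"
  have "geometric \<alpha> \<beta> \<alpha> \<noteq> 0" using geometric_first_last[OF assms(1)] geometric_nonneg[of \<alpha> \<beta> \<beta>] by simp
  then have "pmf (map_pmf (\<lambda>(G, v). length G) \<mu>) \<alpha> \<noteq> 0" using \<mu> unfolding geometric_prior_def by metis
  then have "\<alpha> \<in> set_pmf (map_pmf (\<lambda>(G, v). length G) \<mu>)" unfolding set_pmf_iff by simp
  then obtain G v where "(G, v) \<in> set_pmf \<mu>" "length G = \<alpha>" by auto
  \<comment> \<open>The prior gives positive mass to \<alpha>, and a 2-vertex-connected network has
    at least three agents.\<close>
  then have \<alpha>: "3 \<le> \<alpha>" using geometric_prior_support(1)[OF \<mu>] by (auto simp: two_vertex_connected_def)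
  have unit: "0 \<le> \<phi> t" "\<phi> t \<le> 1" "0 \<le> 1 / real t" "1 / real t \<le> 1" for t
    by (auto simp: \<phi>_def divide_le_eq_1)
  have avg: "measure_pmf.expectation (prior_start I \<mu>) (\<lambda>(v, c). if pref c v = One then \<psi> (length (net c)) else 0) =
      (\<Sum>t = \<alpha>..\<beta>. ?P t * \<psi> t) / 2"
    if "\<And>t. 0 \<le> \<psi> t" "\<And>t. \<psi> t \<le> 1" for \<psi> :: "nat \<Rightarrow> real"
    unfolding geometric_expectation[OF \<mu>, symmetric]
    by (rule prior_start_expectation[OF geometric_prior_support(2)[OF \<mu>] that])
  have avg1: "measure_pmf.expectation (prior_start I \<mu>) (\<lambda>(v, c). if pref c v = One then \<phi> (length (net c)) else 0) =
      (\<Sum>t = \<alpha>..\<beta>. ?P t * \<phi> t) / 2"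
    by (rule avg) (rule unit)+
  have avg2: "measure_pmf.expectation (prior_start I \<mu>) (\<lambda>(v, c). if pref c v = One then 1 / real (length (net c)) else 0) =
      (\<Sum>t = \<alpha>..\<beta>. ?P t * (1 / real t)) / 2"
    by (rule avg) (rule unit)+
  have "measure_pmf.expectation (prior_start I \<mu>) (\<lambda>(v, c). if pref c v = One then \<phi> (length (net c)) else 0)
    \<le> measure_pmf.expectation (prior_start I \<mu>) (\<lambda>(v, c). if pref c v = One then 1 / real (length (net c)) else 0)"
    using no_profit_on_average[OF eq \<mu> I le fair] unfolding \<phi>_def .
  then have le: "(\<Sum>t = \<alpha>..\<beta>. ?P t * \<phi> t) \<le> (\<Sum>t = \<alpha>..\<beta>. ?P t * (1 / real t))"
    unfolding avg1 avg2 by linarith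
  \<comment> \<open>The signed profit of the split at size \<open>t\<close>, weighted by the
    prior.\<close>
  define h where "h t = ?P t * (\<phi> t - 1 / real t)" for t
  have "(\<Sum>t = \<alpha>..\<beta>. h t) \<le> 0" using le by (simp add: h_def right_diff_distrib sum_subtractf)
  moreover have "(\<Sum>t = \<alpha>..\<beta>. h t) = h \<alpha> + (h \<beta> + (\<Sum>t \<in> {\<alpha>..\<beta>} - {\<alpha>} - {\<beta>}. h t))"
    using assms(1) by (subst sum.remove[of _ \<alpha>], simp, simp, subst sum.remove[of _ \<beta>]) auto
  moreover have "0 \<le> (\<Sum>t \<in> {\<alpha>..\<beta>} - {\<alpha>} - {\<beta>}. h t)"
  proof (rule sum_nonneg)
    fix t assume "t \<in> {\<alpha>..\<beta>} - {\<alpha>} - {\<beta>}"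
    then have "1 / real t \<le> \<phi> t" using \<alpha> by (auto simp: \<phi>_def field_simps)
    then show "0 \<le> h t" by (simp add: h_def geometric_nonneg)
  qed
  moreover have "0 < h \<alpha> + h \<beta>"
  proof -
    \<comment> \<open>The difference is \<open>((\<alpha> - 1) / \<alpha>) / (\<alpha> + 1)\<close>,
      and its first factor is at least 2/3 for \<alpha> \<ge> 3. Against a loss of at most
      \<open>1 / (\<alpha> + 1)\<close> this is the ratio 3 to 2 of
      \<open>geometric_first_last\<close>.\<close>
    have "2 / 3 / (real \<alpha> + 1) \<le> \<phi> \<alpha> - 1 / real \<alpha>"
    proof -
      have "1 / real \<alpha> \<le> 4 / 3 / (real \<alpha> + 1)" using \<alpha> by (simp add: field_simps)
      moreover have "2 / 3 / (real \<alpha> + 1) + 4 / 3 / (real \<alpha> + 1) = 2 / (real \<alpha> + 1)"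
        unfolding add_divide_distrib[symmetric] by simp
      ultimately show ?thesis using \<alpha> assms(1) by (simp add: \<phi>_def)
    qed
    then have "?P \<alpha> * (2 / 3 / (real \<alpha> + 1)) \<le> h \<alpha>"
      unfolding h_def by (intro mult_left_mono geometric_nonneg)
    moreover have "1 / real \<beta> \<le> 1 / (real \<alpha> + 1)" using assms(1) by (intro divide_left_mono) auto
    then have "- (?P \<beta> * (1 / (real \<alpha> + 1))) \<le> h \<beta>"
      using mult_left_mono[OF _ geometric_nonneg, of "1 / real \<beta>" "1 / (real \<alpha> + 1)" \<alpha> \<beta> \<beta>]
      by (simp add: h_def \<phi>_def)
    moreover have "0 < ?P \<alpha> * (2 / 3 / (real \<alpha> + 1)) + - (?P \<beta> * (1 / (real \<alpha> + 1)))"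
    proof -
      have "?P \<alpha> * (2 / 3 / (real \<alpha> + 1)) + - (?P \<beta> * (1 / (real \<alpha> + 1))) =
          (2 * ?P \<alpha> - 3 * ?P \<beta>) / (3 * (real \<alpha> + 1))"
        by (simp add: divide_simps) (simp add: algebra_simps)
      moreover have "0 < (2 * ?P \<alpha> - 3 * ?P \<beta>) / (3 * (real \<alpha> + 1))"
        using geometric_first_last[OF assms(1)] by (intro divide_pos_pos) simp_all
      ultimately show ?thesis by (simp only:)
    qed
    ultimately show ?thesis by linarith
  qed
  ultimately show False by linarith
qed

theorem theorem5p4:
  fixes \<alpha> \<beta> :: nat
    and I :: "nat set"
    and \<mu> :: "(network \<times> nat) pmf"
  assumes "\<alpha> \<le> \<beta>"
    and "finite I" and "\<beta> \<le> card I"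
    and "geometric_prior \<alpha> \<beta> \<mu>"
  shows "(\<exists>\<Lambda>. leader_election I \<alpha> \<beta> \<Lambda> \<and> fair I \<alpha> \<beta> \<Lambda> \<and> equilibrium I \<beta> \<mu> \<Lambda>) \<longleftrightarrow> \<beta> = \<alpha>"
proof
  assume "\<exists>\<Lambda>. leader_election I \<alpha> \<beta> \<Lambda> \<and> fair I \<alpha> \<beta> \<Lambda> \<and> equilibrium I \<beta> \<mu> \<Lambda>"
  then show "\<beta> = \<alpha>"
    using no_equilibrium[of \<alpha> \<beta> \<mu> I] assms by (metis le_neq_implies_less)
next
  assume "\<beta> = \<alpha>"
  then show "\<exists>\<Lambda>. leader_election I \<alpha> \<beta> \<Lambda> \<and> fair I \<alpha> \<beta> \<Lambda> \<and> equilibrium I \<beta> \<mu> \<Lambda>"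
    using assms elect_leader_election_fair[of I \<alpha>] elect_equilibrium[of \<alpha> \<mu> I] by blast
qed

end
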